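(* Let $(\Omega,\mathcal{F},\mathrm{P})$ be a probability space with a complete $\sigma$-additive measure $\mathrm{P}$, let $\mathcal{H}$ be a Hilbert space over $\mathbb{R}$, and let $\mathcal{L}(\mathcal{H})$ be the space of bounded linear operators on $\mathcal{H}$. Let $A\colon\Omega\to\mathcal{L}(\mathcal{H})$ be such that $\|A\|$ is bounded (i.e. there is a constant $\rho>0$ with $\|A\|\le\rho$). Let $A, A_1, A_2, \ldots$ be a sequence of independent identically distributed random operators. Then the sequence $$\sqrt{n}\left(e^{A_1/n}\cdots e^{A_n/n} - e^{\mathbb{E}A}\right)$$ of random operators converges in distribution in the Weak Operator Topology to $N(0,\Sigma)$ as $n\to\infty$, where $$\Sigma := \int_0^1 \left(e^{s\,\mathbb{E}A}\right)^{\otimes 2}\; \mathbb{E}\left[(A-\mathbb{E}A)^{\otimes 2}\right]\; \left(e^{(1-s)\,\mathbb{E}A}\right)^{\otimes 2}\,ds$$ is the Bochner integral. In other words, for any $x,y\in\mathcal{H}$ the real random variables $$\left\langle y,\ \sqrt{n}\left(e^{A_1/n}\cdots e^{A_n/n} - e^{\mathbb{E}A}\right)x\right\rangle$$ converge in distribution, as $n\to\infty$, to the normal distribution $N\left(0,\ \left\langle y^{\otimes 2},\Sigma\, x^{\otimes 2}\right\rangle\right)$ with mean $0$ and variance $\left\langle y^{\otimes 2},\Sigma\, x^{\otimes 2}\right\rangle$.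
   Context: A map $A\colon\Omega\to\mathcal{L}(\mathcal{H})$ is called a random operator if it is Bochner measurable, i.e. if there is a sequence of finitely-valued maps $\Omega\to\mathcal{L}(\mathcal{H})$ converging to $A$ uniformly almost surely. The expected value $\mathbb{E}A$ of a random operator is its Bochner integral; it exists if and only if the random variable $\|A\|$ is Lebesgue integrable. Independence of random operators is defined analogously to independence of random variables. $\mathcal{H}^{\otimes 2}=\mathcal{H}\otimes\mathcal{H}$ is the tensor square of $\mathcal{H}$; for $x\in\mathcal{H}$, $x^{\otimes2}=x\otimes x$; for $B\in\mathcal{L}(\mathcal{H})$, $B^{\otimes 2}=B\otimes B$ is the corresponding operator on $\mathcal{H}^{\otimes 2}$. The exponential of a bounded operator is given by the usual power series, and products of operators are compositions. For a linear bounded positive symmetric operator $\Sigma$ on $\mathcal{H}^{\otimes2}$, $N(0,\Sigma)$ denotes the distribution of a zero-mean random Gaussian operator $G$ with the covariance $\Sigma$; that is, for any $x,y\in\mathcal{H}$ the random variable $\langle y,Gx\rangle$ is a zero-mean Gaussian variable with the variance equal to $\langle y^{\otimes2},\Sigma x^{\otimes2}\rangle$. Convergence in distribution in the Weak Operator Topology to $N(0,\Sigma)$ means the convergence in distribution for every fixed pair $x,y\in\mathcal{H}$ spelled out in the last sentence of the claim. *)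

theory Defs
  imports "HOL-Probability.Probability"
begin

section \<open>Bochner measurability and the Bochner integral\<close>

text \<open>
  The library's \<open>has_bochner_integral\<close> and \<open>integral\<^sup>L\<close> are restricted to second countable
  codomains, which excludes spaces of bounded operators. The definitions below drop that
  restriction. Convergence in \<^typ>\<open>'a \<Rightarrow>\<^sub>L 'b\<close> is convergence in the operator norm, so
  \<open>bochner_measurable\<close> asks for simple (finitely-valued, measurable) maps that converge almost
  surely in the uniform operator topology.
\<close>

definition bochner_measurable :: "'w measure \<Rightarrow> ('w \<Rightarrow> 'b::real_normed_vector) \<Rightarrow> bool" where
  "bochner_measurable M f \<longleftrightarrow>
     (\<exists>s. (\<forall>i. simple_function M (s i)) \<and> (AE \<omega> in M. (\<lambda>i. s i \<omega>) \<longlonglongrightarrow> f \<omega>))"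

abbreviation random_operator ::
    "'w measure \<Rightarrow> ('w \<Rightarrow> 'a::real_normed_vector \<Rightarrow>\<^sub>L 'a) \<Rightarrow> bool" where
  "random_operator \<equiv> bochner_measurable"

text \<open>The clauses are those of \<^const>\<open>has_bochner_integral\<close>. On a complete measure space every
  Bochner measurable function is Borel measurable.\<close>

definition has_bochner_int ::
    "'w measure \<Rightarrow> ('w \<Rightarrow> 'b::real_normed_vector) \<Rightarrow> 'b \<Rightarrow> bool" where
  "has_bochner_int M f I \<longleftrightarrow> f \<in> borel_measurable M \<and>
     (\<exists>s. (\<forall>i. Bochner_Integration.simple_bochner_integrable M (s i)) \<and>
          (\<lambda>i. \<integral>\<^sup>+ \<omega>. ennreal (norm (f \<omega> - s i \<omega>)) \<partial>M) \<longlonglongrightarrow> 0 \<and>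
          (\<lambda>i. Bochner_Integration.simple_bochner_integral M (s i)) \<longlonglongrightarrow> I)"

definition bochner_integral ::
    "'w measure \<Rightarrow> ('w \<Rightarrow> 'b::real_normed_vector) \<Rightarrow> 'b" where
  "bochner_integral M f = (THE I. has_bochner_int M f I)"

lemma has_bochner_int_unique:
  fixes f :: "'w \<Rightarrow> 'b::real_normed_vector"
  assumes "has_bochner_int M f x" "has_bochner_int M f y"
  shows "x = y"
proof -
  from assms obtain s t where f: "f \<in> borel_measurable M"
    and s: "\<And>i. Bochner_Integration.simple_bochner_integrable M (s i)" and t: "\<And>i. Bochner_Integration.simple_bochner_integrable M (t i)"
    and S: "(\<lambda>i. \<integral>\<^sup>+ \<omega>. ennreal (norm (f \<omega> - s i \<omega>)) \<partial>M) \<longlonglongrightarrow> 0" (is "?S \<longlonglongrightarrow> 0")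
    and T: "(\<lambda>i. \<integral>\<^sup>+ \<omega>. ennreal (norm (f \<omega> - t i \<omega>)) \<partial>M) \<longlonglongrightarrow> 0" (is "?T \<longlonglongrightarrow> 0")
    and x: "(\<lambda>i. Bochner_Integration.simple_bochner_integral M (s i)) \<longlonglongrightarrow> x"
    and y: "(\<lambda>i. Bochner_Integration.simple_bochner_integral M (t i)) \<longlonglongrightarrow> y"
    unfolding has_bochner_int_def by blast
  have meas: "(\<lambda>\<omega>. ennreal (norm (f \<omega> - u \<omega>))) \<in> borel_measurable M"
    if u: "Bochner_Integration.simple_bochner_integrable M u" for u
  proof -
    from u have sf: "simple_function M u"
      by (auto elim: simple_bochner_integrable.cases)
    have "(\<lambda>\<omega>. f \<omega> - u \<omega>) \<in> borel_measurable M"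
    proof (rule measurableI)
      fix B :: "'b set" assume B: "B \<in> sets borel"
      have eq: "(\<lambda>\<omega>. f \<omega> - u \<omega>) -` B \<inter> space M =
          (\<Union>c\<in>u ` space M. (u -` {c} \<inter> space M) \<inter> ((\<lambda>\<omega>. f \<omega> - c) -` B \<inter> space M))"
        by auto
      have fc: "(\<lambda>\<omega>. f \<omega> - c) \<in> borel_measurable M" for c
        using f by (rule measurable_compose)
          (intro borel_measurable_continuous_onI continuous_intros)
      show "(\<lambda>\<omega>. f \<omega> - u \<omega>) -` B \<inter> space M \<in> sets M"
        unfolding eq using sf measurable_sets[OF fc B]
        by (intro sets.finite_UN) (auto simp: simple_function_def intro!: sets.Int[of "u -` _ \<inter> space M"])
    qed simp
    then have "(\<lambda>\<omega>. norm (f \<omega> - u \<omega>)) \<in> borel_measurable M"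
      by (rule measurable_compose) (intro borel_measurable_continuous_onI continuous_intros)
    then show ?thesis by (rule measurable_compose) simp
  qed
  have bound: "ennreal (norm (Bochner_Integration.simple_bochner_integral M (s i) - Bochner_Integration.simple_bochner_integral M (t i)))
      \<le> ?S i + ?T i" for i
  proof -
    have "ennreal (norm (Bochner_Integration.simple_bochner_integral M (s i) - Bochner_Integration.simple_bochner_integral M (t i)))
        = norm (Bochner_Integration.simple_bochner_integral M (\<lambda>\<omega>. s i \<omega> - t i \<omega>))"
      using s t by (subst simple_bochner_integral_diff) auto
    also have "\<dots> \<le> Bochner_Integration.simple_bochner_integral M (\<lambda>\<omega>. norm (s i \<omega> - t i \<omega>))"
      using simple_bochner_integrable_compose2[of "(-)" M "s i" "t i"] s t
      by (auto intro!: simple_bochner_integral_norm_bound)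
    also have "\<dots> = (\<integral>\<^sup>+\<omega>. norm (s i \<omega> - t i \<omega>) \<partial>M)"
      using simple_bochner_integrable_compose2[of "\<lambda>x y. norm (x - y)" M "s i" "t i"] s t
      by (auto intro!: simple_bochner_integral_eq_nn_integral)
    also have "\<dots> \<le> (\<integral>\<^sup>+\<omega>. ennreal (norm (f \<omega> - s i \<omega>)) + ennreal (norm (f \<omega> - t i \<omega>)) \<partial>M)"
    proof (rule nn_integral_mono)
      fix \<omega>
      have "norm (s i \<omega> - t i \<omega>) \<le> norm (f \<omega> - s i \<omega>) + norm (f \<omega> - t i \<omega>)"
        by (metis dual_order.refl norm_diff_triangle_le norm_minus_commute)
      then show "ennreal (norm (s i \<omega> - t i \<omega>))
          \<le> ennreal (norm (f \<omega> - s i \<omega>)) + ennreal (norm (f \<omega> - t i \<omega>))"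
        by (metis ennreal_leI ennreal_plus norm_ge_zero)
    qed
    also have "\<dots> = ?S i + ?T i"
      by (rule nn_integral_add) (intro meas s t)+
    finally show ?thesis .
  qed
  have "(\<lambda>i. ennreal (norm (Bochner_Integration.simple_bochner_integral M (s i) - Bochner_Integration.simple_bochner_integral M (t i))))
      \<longlonglongrightarrow> ennreal 0"
  proof (rule tendsto_sandwich[where f="\<lambda>_. 0"])
    show "(\<lambda>i. ?S i + ?T i) \<longlonglongrightarrow> ennreal 0" using tendsto_add[OF S T] by simp
  qed (auto intro!: always_eventually bound)
  then have "(\<lambda>i. norm (Bochner_Integration.simple_bochner_integral M (s i) - Bochner_Integration.simple_bochner_integral M (t i))) \<longlonglongrightarrow> 0"
    by (simp flip: ennreal_0)
  moreover have "(\<lambda>i. norm (Bochner_Integration.simple_bochner_integral M (s i) - Bochner_Integration.simple_bochner_integral M (t i)))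
      \<longlonglongrightarrow> norm (x - y)"
    using x y by (intro tendsto_intros)
  ultimately have "norm (x - y) = 0" by (rule LIMSEQ_unique[THEN sym])
  then show ?thesis by simp
qed

lemma bochner_integral_eqI: "has_bochner_int M f I \<Longrightarrow> bochner_integral M f = I"
  unfolding bochner_integral_def using has_bochner_int_unique by blast


section \<open>Exponentials and products of bounded operators\<close>

text \<open>\<^typ>\<open>'a \<Rightarrow>\<^sub>L 'a\<close> is not an instance of the normed algebra classes, so the library's
  \<^const>\<open>exp\<close> does not apply.\<close>

definition op_exp :: "('a::real_normed_vector \<Rightarrow>\<^sub>L 'a) \<Rightarrow> ('a \<Rightarrow>\<^sub>L 'a)" where
  "op_exp B = (\<Sum>k. (1 / fact k) *\<^sub>R (((o\<^sub>L) B ^^ k) id_blinfun))"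

text \<open>\<open>op_prod F n\<close> is \<open>F 1 \<circ> F 2 \<circ> \<dots> \<circ> F n\<close>.\<close>

primrec op_prod :: "(nat \<Rightarrow> 'a::real_normed_vector \<Rightarrow>\<^sub>L 'a) \<Rightarrow> nat \<Rightarrow> ('a \<Rightarrow>\<^sub>L 'a)" where
  "op_prod F 0 = id_blinfun"
| "op_prod F (Suc n) = op_prod F n o\<^sub>L F (Suc n)"


section \<open>Completion of an inner product space\<close>

text \<open>The completion is the closure of the canonical isometric image \<open>x \<mapsto> \<langle>x, \<cdot>\<rangle>\<close> of the space in
  its dual, which is a Banach space.\<close>

lemma norm_blinfun_inner_right_eq: "norm (blinfun_inner_right x) = norm x"
proof (rule norm_blinfun_eqI)
  show "norm x \<le> norm (blinfun_apply (blinfun_inner_right x) x) / norm x"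
    by (cases "x = 0") (simp_all add: dot_square_norm power2_eq_square)
qed (simp_all add: Cauchy_Schwarz_ineq2)

definition completion_set :: "('a::real_inner \<Rightarrow>\<^sub>L real) set" where
  "completion_set = closure (range blinfun_inner_right)"

lemma polarization_limit:
  fixes x y :: "nat \<Rightarrow> 'a::real_inner"
  assumes "(\<lambda>n. blinfun_inner_right (x n)) \<longlonglongrightarrow> f" "(\<lambda>n. blinfun_inner_right (y n)) \<longlonglongrightarrow> g"
  shows "(\<lambda>n. x n \<bullet> y n) \<longlonglongrightarrow> ((norm (f + g))\<^sup>2 - (norm (f - g))\<^sup>2) / 4"
proof -
  have "(\<lambda>n. ((norm (blinfun_inner_right (x n) + blinfun_inner_right (y n)))\<^sup>2 -
      (norm (blinfun_inner_right (x n) - blinfun_inner_right (y n)))\<^sup>2) / 4)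
    \<longlonglongrightarrow> ((norm (f + g))\<^sup>2 - (norm (f - g))\<^sup>2) / 4"
    using assms by (intro tendsto_intros) auto
  moreover have "((norm (blinfun_inner_right a + blinfun_inner_right b))\<^sup>2 -
      (norm (blinfun_inner_right a - blinfun_inner_right b))\<^sup>2) / 4 = a \<bullet> b" for a b :: 'a
  proof -
    have "blinfun_inner_right a + blinfun_inner_right b = blinfun_inner_right (a + b)"
      "blinfun_inner_right a - blinfun_inner_right b = blinfun_inner_right (a - b)"
      by (simp_all only: linear_add[OF bounded_linear.linear] linear_diff[OF bounded_linear.linear]
          bounded_linear_blinfun_inner_right)
    then show ?thesis
      by (simp only: norm_blinfun_inner_right_eq power2_norm_eq_inner)
        (simp add: inner_add_left inner_add_right inner_diff_left inner_diff_right inner_commute)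
  qed
  ultimately show ?thesis by simp
qed

lemma completion_set_seq:
  assumes "f \<in> completion_set"
  obtains x where "(\<lambda>n. blinfun_inner_right (x n)) \<longlonglongrightarrow> f"
proof -
  obtain g where g: "\<forall>n. g n \<in> range blinfun_inner_right" "g \<longlonglongrightarrow> f"
    using assms unfolding completion_set_def closure_sequential by (elim exE conjE)
  then have "\<forall>n. \<exists>y. g n = blinfun_inner_right y" by blast
  then obtain x where "\<And>n. g n = blinfun_inner_right (x n)" by metis
  then have "g = (\<lambda>n. blinfun_inner_right (x n))" by auto
  with g(2) show ?thesis by (intro that[of x]) simp
qed

lemma subspace_completion_set: "subspace completion_set"
proof -
  interpret bounded_linear "blinfun_inner_right :: 'a::real_inner \<Rightarrow> _"
    by (rule bounded_linear_blinfun_inner_right)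
  have lim: "f \<in> completion_set"
    if "(\<lambda>n. blinfun_inner_right (x n :: 'a)) \<longlonglongrightarrow> f" for x f
    unfolding completion_set_def closure_sequential
    by (rule exI[of _ "\<lambda>n. blinfun_inner_right (x n)"]) (simp add: that)
  show ?thesis
  proof (rule subspaceI)
    show "0 \<in> (completion_set :: ('a \<Rightarrow>\<^sub>L real) set)"
      by (rule lim[of "\<lambda>_. 0"]) (simp add: zero)
    fix f g :: "'a \<Rightarrow>\<^sub>L real" assume f: "f \<in> completion_set" and g: "g \<in> completion_set"
    obtain x where x: "(\<lambda>n. blinfun_inner_right (x n)) \<longlonglongrightarrow> f"
      using completion_set_seq[OF f] .
    obtain y where y: "(\<lambda>n. blinfun_inner_right (y n)) \<longlonglongrightarrow> g"
      using completion_set_seq[OF g] .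
    show "f + g \<in> completion_set"
      by (rule lim[of "\<lambda>n. x n + y n"]) (unfold add, intro tendsto_intros x y)
    show "c *\<^sub>R f \<in> completion_set" for c
      by (rule lim[of "\<lambda>n. c *\<^sub>R x n"]) (unfold scaleR, intro tendsto_intros x)
  qed
qed

lemma polarization_add:
  fixes f g h :: "'a::real_inner \<Rightarrow>\<^sub>L real"
  assumes f: "f \<in> completion_set" and g: "g \<in> completion_set" and h: "h \<in> completion_set"
  shows "((norm (f + g + h))\<^sup>2 - (norm (f + g - h))\<^sup>2) / 4 =
    ((norm (f + h))\<^sup>2 - (norm (f - h))\<^sup>2) / 4 + ((norm (g + h))\<^sup>2 - (norm (g - h))\<^sup>2) / 4"
proof -
  interpret bounded_linear "blinfun_inner_right :: 'a \<Rightarrow> _"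
    by (rule bounded_linear_blinfun_inner_right)
  obtain u where u: "(\<lambda>n. blinfun_inner_right (u n)) \<longlonglongrightarrow> f" using completion_set_seq[OF f] .
  obtain v where v: "(\<lambda>n. blinfun_inner_right (v n)) \<longlonglongrightarrow> g" using completion_set_seq[OF g] .
  obtain w where w: "(\<lambda>n. blinfun_inner_right (w n)) \<longlonglongrightarrow> h" using completion_set_seq[OF h] .
  have uv: "(\<lambda>n. blinfun_inner_right (u n + v n)) \<longlonglongrightarrow> f + g"
    unfolding add by (intro tendsto_add u v)
  have "(\<lambda>n. (u n + v n) \<bullet> w n) \<longlonglongrightarrow>
    ((norm (f + h))\<^sup>2 - (norm (f - h))\<^sup>2) / 4 + ((norm (g + h))\<^sup>2 - (norm (g - h))\<^sup>2) / 4"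
    unfolding inner_add_left by (intro tendsto_add polarization_limit u v w)
  then show ?thesis by (rule LIMSEQ_unique[OF polarization_limit[OF uv w]])
qed

lemma polarization_scaleR:
  fixes f g :: "'a::real_inner \<Rightarrow>\<^sub>L real"
  assumes f: "f \<in> completion_set" and g: "g \<in> completion_set"
  shows "((norm (r *\<^sub>R f + g))\<^sup>2 - (norm (r *\<^sub>R f - g))\<^sup>2) / 4 =
    r * (((norm (f + g))\<^sup>2 - (norm (f - g))\<^sup>2) / 4)"
proof -
  interpret bounded_linear "blinfun_inner_right :: 'a \<Rightarrow> _"
    by (rule bounded_linear_blinfun_inner_right)
  obtain u where u: "(\<lambda>n. blinfun_inner_right (u n)) \<longlonglongrightarrow> f" using completion_set_seq[OF f] .
  obtain v where v: "(\<lambda>n. blinfun_inner_right (v n)) \<longlonglongrightarrow> g" using completion_set_seq[OF g] .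
  have ru: "(\<lambda>n. blinfun_inner_right (r *\<^sub>R u n)) \<longlonglongrightarrow> r *\<^sub>R f"
    unfolding scaleR by (intro tendsto_scaleR tendsto_const u)
  have "(\<lambda>n. (r *\<^sub>R u n) \<bullet> v n) \<longlonglongrightarrow> r * (((norm (f + g))\<^sup>2 - (norm (f - g))\<^sup>2) / 4)"
    unfolding inner_scaleR_left by (intro tendsto_mult_left polarization_limit u v)
  then show ?thesis by (rule LIMSEQ_unique[OF polarization_limit[OF ru v]])
qed

typedef (overloaded) 'a completion = "completion_set :: ('a::real_inner \<Rightarrow>\<^sub>L real) set"
  using subspace_0[OF subspace_completion_set] by blast

setup_lifting type_definition_completion

lift_definition to_completion :: "'a::real_inner \<Rightarrow> 'a completion" is blinfun_inner_right
  using closure_subset unfolding completion_set_def by fast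

instantiation completion :: (real_inner) real_inner
begin

lift_definition zero_completion :: "'a completion" is 0
  by (rule subspace_0[OF subspace_completion_set])
lift_definition plus_completion :: "'a completion \<Rightarrow> 'a completion \<Rightarrow> 'a completion" is "(+)"
  by (rule subspace_add[OF subspace_completion_set])
lift_definition minus_completion :: "'a completion \<Rightarrow> 'a completion \<Rightarrow> 'a completion" is "(-)"
  by (rule subspace_diff[OF subspace_completion_set])
lift_definition uminus_completion :: "'a completion \<Rightarrow> 'a completion" is uminus
  by (rule subspace_neg[OF subspace_completion_set])
lift_definition scaleR_completion :: "real \<Rightarrow> 'a completion \<Rightarrow> 'a completion" is "(*\<^sub>R)"
  by (rule subspace_scale[OF subspace_completion_set])
lift_definition norm_completion :: "'a completion \<Rightarrow> real" is norm .
text \<open>The polarization identity; on the image of the original space it returns the original inner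
  product, of which it is the continuous extension.\<close>
lift_definition inner_completion :: "'a completion \<Rightarrow> 'a completion \<Rightarrow> real"
  is "\<lambda>f g. ((norm (f + g))\<^sup>2 - (norm (f - g))\<^sup>2) / 4" .
definition sgn_completion :: "'a completion \<Rightarrow> 'a completion" where
  "sgn_completion x = inverse (norm x) *\<^sub>R x"
definition dist_completion :: "'a completion \<Rightarrow> 'a completion \<Rightarrow> real" where
  "dist_completion x y = norm (x - y)"
definition uniformity_completion :: "('a completion \<times> 'a completion) filter" where
  "uniformity_completion = (INF e\<in>{0<..}. principal {(x, y). dist x y < e})"
definition open_completion :: "'a completion set \<Rightarrow> bool" where
  "open_completion U = (\<forall>x\<in>U. \<forall>\<^sub>F (x', y) in uniformity. x' = x \<longrightarrow> y \<in> U)"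

instance
proof
  fix x y z :: "'a completion" and r s :: real
  show "x + y + z = x + (y + z)" by transfer simp
  show "x + y = y + x" by transfer simp
  show "0 + x = x" by transfer simp
  show "- x + x = 0" by transfer simp
  show "x - y = x + - y" by transfer simp
  show "r *\<^sub>R (x + y) = r *\<^sub>R x + r *\<^sub>R y" by transfer (simp add: scaleR_right_distrib)
  show "(r + s) *\<^sub>R x = r *\<^sub>R x + s *\<^sub>R x" by transfer (simp add: scaleR_left_distrib)
  show "r *\<^sub>R s *\<^sub>R x = (r * s) *\<^sub>R x" by transfer simp
  show "1 *\<^sub>R x = x" by transfer simp
  show "sgn x = inverse (norm x) *\<^sub>R x" by (rule sgn_completion_def)
  show "dist x y = norm (x - y)" by (rule dist_completion_def)
  show "uniformity = (INF e\<in>{0<..}. principal {(x::'a completion, y). dist x y < e})"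
    by (rule uniformity_completion_def)
  show "open U = (\<forall>x\<in>U. \<forall>\<^sub>F (x', y) in uniformity. x' = x \<longrightarrow> y \<in> U)" for U :: "'a completion set"
    by (rule open_completion_def)
  show "x \<bullet> y = y \<bullet> x" by transfer (simp add: add.commute norm_minus_commute)
  show "(x + y) \<bullet> z = x \<bullet> z + y \<bullet> z" by transfer (rule polarization_add)
  show "(r *\<^sub>R x) \<bullet> y = r * (x \<bullet> y)" by transfer (rule polarization_scaleR)
  have sq: "x \<bullet> x = (norm x)\<^sup>2"
    by transfer (simp add: power_mult_distrib flip: scaleR_2)
  show "0 \<le> x \<bullet> x" by (simp add: sq)
  have "norm x = 0 \<longleftrightarrow> x = 0" by transfer simp
  then show "x \<bullet> x = 0 \<longleftrightarrow> x = 0" by (simp add: sq)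
  have "0 \<le> norm x" by transfer simp
  then show "norm x = sqrt (x \<bullet> x)" by (simp add: sq)
qed

end

instance completion :: (real_inner) banach
proof
  fix X :: "nat \<Rightarrow> 'a completion"
  assume X: "Cauchy X"
  have d: "dist (Rep_completion x) (Rep_completion y) = dist x y" for x y :: "'a completion"
    by (simp add: dist_norm norm_completion.rep_eq minus_completion.rep_eq)
  have "Cauchy (\<lambda>n. Rep_completion (X n))" using X by (simp add: Cauchy_def d)
  then obtain l where l: "(\<lambda>n. Rep_completion (X n)) \<longlonglongrightarrow> l"
    using Cauchy_convergent_iff convergent_def by blast
  have "l \<in> completion_set"
    by (rule closed_sequentially[OF _ _ l])
       (use Rep_completion in \<open>auto simp: completion_set_def\<close>)
  then have "Rep_completion (Abs_completion l) = l" by (rule Abs_completion_inverse)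
  then have "X \<longlonglongrightarrow> Abs_completion l" using l by (simp add: tendsto_iff flip: d)
  then show "convergent X" by (rule convergentI)
qed

lemma inner_to_completion [simp]: "to_completion x \<bullet> to_completion y = x \<bullet> y"
  by transfer (rule LIMSEQ_unique[OF polarization_limit tendsto_const]; rule tendsto_const)

lemma linear_to_completion: "linear to_completion"
proof -
  interpret bounded_linear blinfun_inner_right by (rule bounded_linear_blinfun_inner_right)
  show ?thesis by (rule linearI; transfer) (simp_all add: add scaleR)
qed

lemma norm_to_completion [simp]: "norm (to_completion x) = norm x"
  by (simp add: norm_eq_sqrt_inner)

lemma closure_range_to_completion: "closure (range to_completion) = UNIV"
proof -
  have "\<exists>x. (\<lambda>n. to_completion (x n)) \<longlonglongrightarrow> (f :: 'a completion)" for f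
  proof -
    obtain x where x: "(\<lambda>n. blinfun_inner_right (x n)) \<longlonglongrightarrow> Rep_completion f"
      using completion_set_seq[OF Rep_completion] .
    have "dist (to_completion (x n)) f = dist (blinfun_inner_right (x n)) (Rep_completion f)" for n
      by (simp add: dist_norm norm_completion.rep_eq minus_completion.rep_eq to_completion.rep_eq)
    then have "(\<lambda>n. to_completion (x n)) \<longlonglongrightarrow> f" using x unfolding tendsto_iff by simp
    then show ?thesis by (rule exI[of _ x])
  qed
  then have "f \<in> closure (range to_completion)" for f :: "'a completion"
    unfolding closure_sequential by (metis rangeI)
  then show ?thesis by blast
qed


section \<open>The Hilbert tensor product\<close>

text \<open>
  The algebraic tensor product of two real inner product spaces is realized inside the bilinear
  forms: \<open>x \<otimes> y\<close> is the form \<open>(u, v) \<mapsto> \<langle>x, u\<rangle> \<langle>y, v\<rangle>\<close>, and a list \<open>[(x\<^sub>1, y\<^sub>1), \<dots>, (x\<^sub>m, y\<^sub>m)]\<close> stands for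
  \<open>\<Sum>\<^sub>i x\<^sub>i \<otimes> y\<^sub>i\<close> (scalars being absorbed into a factor). As the forms \<open>\<langle>x, \<cdot>\<rangle>\<close> separate points, two lists
  give the same form exactly if they give the same element of the algebraic tensor product.
\<close>

definition tform :: "('a::real_inner \<times> 'b::real_inner) list \<Rightarrow> 'a \<Rightarrow> 'b \<Rightarrow> real" where
  "tform ps = (\<lambda>u v. \<Sum>(x, y)\<leftarrow>ps. (x \<bullet> u) * (y \<bullet> v))"

lemma tform_Nil [simp]: "tform [] u v = 0"
  and tform_Cons [simp]: "tform ((x, y) # ps) u v = (x \<bullet> u) * (y \<bullet> v) + tform ps u v"
  and tform_append [simp]: "tform (ps @ qs) u v = tform ps u v + tform qs u v"
  by (simp_all add: tform_def)

lemma tform_scaleR [simp]: "tform (map (\<lambda>(x, y). (r *\<^sub>R x, y)) ps) u v = r * tform ps u v"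
  by (induction ps) (auto simp: algebra_simps)

lemma tform_swap: "(\<Sum>(x, y)\<leftarrow>ps. tform qs x y) = (\<Sum>(x, y)\<leftarrow>qs. tform ps x y)"
proof (induction ps)
  case Nil
  show ?case by (induction qs) auto
next
  case (Cons p ps)
  obtain x y where p: "p = (x, y)" by force
  have "tform qs x y + (\<Sum>(x, y)\<leftarrow>qs. tform ps x y)
      = (\<Sum>(u, v)\<leftarrow>qs. (x \<bullet> u) * (y \<bullet> v) + tform ps u v)"
    by (induction qs) (auto simp: inner_commute)
  with Cons show ?case by (simp add: p)
qed

text \<open>Gram-Schmidt in the second factor. The operator \<open>B\<close> is used for the boundedness of tensor
  products of operators; \<open>B = id\<close> gives positive definiteness of the inner product.\<close>

definition orthonormal_rep ::
    "('a::real_inner \<times> 'b::real_inner) list \<Rightarrow> 'b set \<Rightarrow> ('b \<Rightarrow> 'a) \<Rightarrow> bool" where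
  "orthonormal_rep ps S z \<longleftrightarrow> finite S \<and>
     (\<forall>e\<in>S. \<forall>e'\<in>S. e \<bullet> e' = (if e = e' then 1 else 0)) \<and>
     (\<forall>B u v. linear B \<longrightarrow>
       tform (map (\<lambda>(x, y). (B x :: 'a, y)) ps) u v = (\<Sum>e\<in>S. (B (z e) \<bullet> u) * (e \<bullet> v)))"

lemma orthonormal_repD:
  fixes z :: "'b::real_inner \<Rightarrow> 'a::real_inner"
  assumes "orthonormal_rep ps S z"
  shows "finite S" "\<And>e e'. e \<in> S \<Longrightarrow> e' \<in> S \<Longrightarrow> e \<bullet> e' = (if e = e' then 1 else 0)"
    "\<And>B u v. linear B \<Longrightarrow>
      tform (map (\<lambda>(x, y). (B x :: 'a, y)) ps) u v = (\<Sum>e\<in>S. (B (z e) \<bullet> u) * (e \<bullet> v))"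
    "\<And>u v. tform ps u v = (\<Sum>e\<in>S. (z e \<bullet> u) * (e \<bullet> v))"
proof -
  show "finite S" "\<And>e e'. e \<in> S \<Longrightarrow> e' \<in> S \<Longrightarrow> e \<bullet> e' = (if e = e' then 1 else 0)"
    using assms by (simp_all add: orthonormal_rep_def)
  show B: "linear B \<Longrightarrow>
      tform (map (\<lambda>(x, y). (B x, y)) ps) u v = (\<Sum>e\<in>S. (B (z e) \<bullet> u) * (e \<bullet> v))"
    for B :: "'a \<Rightarrow> 'a" and u v
    using assms by (simp add: orthonormal_rep_def)
  show "tform ps u v = (\<Sum>e\<in>S. (z e \<bullet> u) * (e \<bullet> v))" for u v
    using B[of "\<lambda>x. x" u v] by (simp add: linear_id[unfolded id_def])
qed

lemma orthonormal_rep_exists: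
  fixes ps :: "('a::real_inner \<times> 'b::real_inner) list"
  shows "\<exists>S z. orthonormal_rep ps S z"
proof (induction ps)
  case Nil
  show ?case by (intro exI[of _ "{}"]) (simp add: orthonormal_rep_def)
next
  case (Cons p ps)
  obtain x y where p: "p = (x, y)" by force
  obtain S z where "orthonormal_rep ps S z" using Cons.IH by blast
  note fin = orthonormal_repD(1)[OF this] and on = orthonormal_repD(2)[OF this]
    and z = orthonormal_repD(3)[OF this]
  define r where "r = y - (\<Sum>e\<in>S. (y \<bullet> e) *\<^sub>R e)"
  define z' where "z' = (\<lambda>e. z e + (y \<bullet> e) *\<^sub>R x)"
  have y: "y = (\<Sum>e\<in>S. (y \<bullet> e) *\<^sub>R e) + r" by (simp add: r_def)
  have yv: "y \<bullet> v = (\<Sum>e\<in>S. (y \<bullet> e) * (e \<bullet> v)) + r \<bullet> v" for v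
    by (subst y) (simp add: inner_add_left inner_sum_left)
  have re: "r \<bullet> e = 0" if e: "e \<in> S" for e
  proof -
    have "(\<Sum>e'\<in>S. (y \<bullet> e') * (e' \<bullet> e)) = (\<Sum>e'\<in>S. if e' = e then y \<bullet> e' else 0)"
      using e by (intro sum.cong) (auto simp: on)
    also have "\<dots> = y \<bullet> e" using e fin by simp
    finally show ?thesis using yv[of e] by simp
  qed
  have z': "tform (map (\<lambda>(x, y). (B x, y)) (p # ps)) u v
      = (\<Sum>e\<in>S. (B (z' e) \<bullet> u) * (e \<bullet> v)) + (B x \<bullet> u) * (r \<bullet> v)"
    if B: "linear B" for B :: "'a \<Rightarrow> 'a" and u v
  proof -
    have "(B x \<bullet> u) * (y \<bullet> v) = (\<Sum>e\<in>S. (B ((y \<bullet> e) *\<^sub>R x) \<bullet> u) * (e \<bullet> v)) + (B x \<bullet> u) * (r \<bullet> v)"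
      unfolding yv[of v] by (simp add: linear_scale[OF B] sum_distrib_left algebra_simps)
    then show ?thesis
      by (simp add: p z[OF B] z'_def linear_add[OF B] inner_add_left sum.distrib distrib_right)
  qed
  show ?case
  proof (cases "r = 0")
    case True
    have "orthonormal_rep (p # ps) S z'"
      unfolding orthonormal_rep_def
      by (intro conjI ballI allI impI fin on)
        (simp_all only: z' True inner_zero_left mult_zero_right add_0_right)
    then show ?thesis by blast
  next
    case False
    define e0 where "e0 = r /\<^sub>R norm r"
    have e0: "e0 \<bullet> e0 = 1" "\<And>e. e \<in> S \<Longrightarrow> e0 \<bullet> e = 0" "\<And>e. e \<in> S \<Longrightarrow> e \<bullet> e0 = 0"
      using False re by (auto simp: e0_def dot_square_norm power2_eq_square inner_commute[of _ r])
    then have notin: "e0 \<notin> S" by fastforce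
    have r: "r = norm r *\<^sub>R e0" using False by (simp add: e0_def)
    have "orthonormal_rep (p # ps) (insert e0 S) (z'(e0 := norm r *\<^sub>R x))"
      unfolding orthonormal_rep_def
    proof (intro conjI ballI allI impI)
      show "finite (insert e0 S)" using fin by simp
      show "e \<bullet> e' = (if e = e' then 1 else 0)" if "e \<in> insert e0 S" "e' \<in> insert e0 S" for e e'
        using that e0 on notin by auto
      fix B :: "'a \<Rightarrow> 'a" and u v assume B: "linear B"
      have "(\<Sum>e\<in>S. (B ((z'(e0 := norm r *\<^sub>R x)) e) \<bullet> u) * (e \<bullet> v))
          = (\<Sum>e\<in>S. (B (z' e) \<bullet> u) * (e \<bullet> v))"
        using notin by (intro sum.cong) auto
      moreover have "(B x \<bullet> u) * (r \<bullet> v) = (B (norm r *\<^sub>R x) \<bullet> u) * (e0 \<bullet> v)"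
        by (subst r) (simp add: linear_scale[OF B])
      ultimately show "tform (map (\<lambda>(x, y). (B x, y)) (p # ps)) u v
          = (\<Sum>e\<in>insert e0 S. (B ((z'(e0 := norm r *\<^sub>R x)) e) \<bullet> u) * (e \<bullet> v))"
        by (subst z'[OF B], subst sum.insert[OF fin notin]) (simp only: fun_upd_same add.commute)
    qed
    then show ?thesis by blast
  qed
qed

lemma tform_square:
  assumes rep: "orthonormal_rep ps S z"
  shows "(\<Sum>(x, y)\<leftarrow>ps. tform ps x y) = (\<Sum>e\<in>S. (norm (z e))\<^sup>2)"
proof -
  note fin = orthonormal_repD(1)[OF rep] and on = orthonormal_repD(2)[OF rep]
    and z = orthonormal_repD(4)[OF rep]
  have "(\<Sum>(x, y)\<leftarrow>qs. \<Sum>e\<in>S. (z e \<bullet> x) * (e \<bullet> y)) = (\<Sum>e\<in>S. tform qs (z e) e)" for qs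
    by (induction qs) (auto simp: sum.distrib inner_commute)
  then have "(\<Sum>(x, y)\<leftarrow>ps. tform ps x y) = (\<Sum>e\<in>S. tform ps (z e) e)" by (simp add: z)
  also have "\<dots> = (\<Sum>e\<in>S. \<Sum>e'\<in>S. if e' = e then z e \<bullet> z e else 0)"
    unfolding z by (intro sum.cong) (auto simp: on)
  also have "\<dots> = (\<Sum>e\<in>S. (norm (z e))\<^sup>2)" using fin by (simp add: power2_norm_eq_inner)
  finally show ?thesis .
qed

typedef (overloaded) ('a, 'b) alg_tensor =
  "range tform :: ('a::real_inner \<Rightarrow> 'b::real_inner \<Rightarrow> real) set"
  by blast

setup_lifting type_definition_alg_tensor

instantiation alg_tensor :: (real_inner, real_inner) real_inner
begin

lift_definition zero_alg_tensor :: "('a, 'b) alg_tensor" is "\<lambda>u v. 0"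
  by (rule range_eqI[of _ _ "[]"]) (auto simp: fun_eq_iff)
lift_definition plus_alg_tensor ::
    "('a, 'b) alg_tensor \<Rightarrow> ('a, 'b) alg_tensor \<Rightarrow> ('a, 'b) alg_tensor"
  is "\<lambda>f g u v. f u v + g u v"
proof -
  fix f g :: "'a \<Rightarrow> 'b \<Rightarrow> real" assume "f \<in> range tform" "g \<in> range tform"
  then obtain ps qs where "f = tform ps" "g = tform qs" by blast
  then show "(\<lambda>u v. f u v + g u v) \<in> range tform" by (intro range_eqI[of _ _ "ps @ qs"]) (auto simp: fun_eq_iff)
qed
lift_definition scaleR_alg_tensor :: "real \<Rightarrow> ('a, 'b) alg_tensor \<Rightarrow> ('a, 'b) alg_tensor"
  is "\<lambda>r f u v. r * f u v"
proof -
  fix r and f :: "'a \<Rightarrow> 'b \<Rightarrow> real" assume "f \<in> range tform"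
  then obtain ps where "f = tform ps" by blast
  then show "(\<lambda>u v. r * f u v) \<in> range tform"
    by (intro range_eqI[of _ _ "map (\<lambda>(x, y). (r *\<^sub>R x, y)) ps"]) (auto simp: fun_eq_iff)
qed
definition uminus_alg_tensor :: "('a, 'b) alg_tensor \<Rightarrow> ('a, 'b) alg_tensor" where
  "uminus_alg_tensor f = (-1) *\<^sub>R f"
definition minus_alg_tensor ::
    "('a, 'b) alg_tensor \<Rightarrow> ('a, 'b) alg_tensor \<Rightarrow> ('a, 'b) alg_tensor" where
  "minus_alg_tensor f g = f + - g"
text \<open>\<open>\<langle>\<Sum>\<^sub>i x\<^sub>i \<otimes> y\<^sub>i, g\<rangle> = \<Sum>\<^sub>i g(x\<^sub>i, y\<^sub>i)\<close>, that is, \<open>\<langle>x \<otimes> y, u \<otimes> v\<rangle> = \<langle>x, u\<rangle> \<langle>y, v\<rangle>\<close> extended bilinearly.\<close>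
lift_definition inner_alg_tensor :: "('a, 'b) alg_tensor \<Rightarrow> ('a, 'b) alg_tensor \<Rightarrow> real"
  is "\<lambda>f g. \<Sum>(x, y)\<leftarrow>(SOME ps. f = tform ps). g x y" .
definition norm_alg_tensor :: "('a, 'b) alg_tensor \<Rightarrow> real" where
  "norm_alg_tensor f = sqrt (f \<bullet> f)"
definition sgn_alg_tensor :: "('a, 'b) alg_tensor \<Rightarrow> ('a, 'b) alg_tensor" where
  "sgn_alg_tensor f = inverse (norm f) *\<^sub>R f"
definition dist_alg_tensor :: "('a, 'b) alg_tensor \<Rightarrow> ('a, 'b) alg_tensor \<Rightarrow> real" where
  "dist_alg_tensor f g = norm (f - g)"
definition uniformity_alg_tensor :: "(('a, 'b) alg_tensor \<times> ('a, 'b) alg_tensor) filter" where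
  "uniformity_alg_tensor = (INF e\<in>{0<..}. principal {(x, y). dist x y < e})"
definition open_alg_tensor :: "('a, 'b) alg_tensor set \<Rightarrow> bool" where
  "open_alg_tensor U = (\<forall>x\<in>U. \<forall>\<^sub>F (x', y) in uniformity. x' = x \<longrightarrow> y \<in> U)"

lemma tform_some:
  fixes f g :: "'a \<Rightarrow> 'b \<Rightarrow> real"
  assumes f: "f = tform ps" and g: "g \<in> range tform"
  shows "(\<Sum>(x, y)\<leftarrow>(SOME ps. f = tform ps). g x y) = (\<Sum>(x, y)\<leftarrow>ps. g x y)"
proof -
  obtain qs where qs: "g = tform qs" using g by blast
  define rs where "rs = (SOME ps. f = tform ps)"
  have "f = tform rs" unfolding rs_def using f by (rule someI)
  with f have "tform rs = tform ps" by simp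
  then show ?thesis using tform_swap[of rs qs] tform_swap[of ps qs] by (simp add: qs rs_def)
qed

instance
proof
  fix f g h :: "('a, 'b) alg_tensor" and r s :: real
  show "f + g + h = f + (g + h)" by transfer (simp add: algebra_simps)
  show "f + g = g + f" by transfer (simp add: algebra_simps)
  show "0 + f = f" by transfer simp
  show "- f + f = 0" unfolding uminus_alg_tensor_def by transfer simp
  show "f - g = f + - g" by (rule minus_alg_tensor_def)
  show "r *\<^sub>R (f + g) = r *\<^sub>R f + r *\<^sub>R g" by transfer (simp add: algebra_simps)
  show "(r + s) *\<^sub>R f = r *\<^sub>R f + s *\<^sub>R f" by transfer (simp add: algebra_simps)
  show "r *\<^sub>R s *\<^sub>R f = (r * s) *\<^sub>R f" by transfer (simp add: algebra_simps)
  show "1 *\<^sub>R f = f" by transfer simp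
  show "sgn f = inverse (norm f) *\<^sub>R f" by (rule sgn_alg_tensor_def)
  show "dist f g = norm (f - g)" by (rule dist_alg_tensor_def)
  show "uniformity = (INF e\<in>{0<..}. principal {(x::('a, 'b) alg_tensor, y). dist x y < e})"
    by (rule uniformity_alg_tensor_def)
  show "open U = (\<forall>x\<in>U. \<forall>\<^sub>F (x', y) in uniformity. x' = x \<longrightarrow> y \<in> U)"
    for U :: "('a, 'b) alg_tensor set"
    by (rule open_alg_tensor_def)
  show comm: "f \<bullet> g = g \<bullet> f" for f g :: "('a, 'b) alg_tensor"
  proof transfer
    fix f g :: "'a \<Rightarrow> 'b \<Rightarrow> real" assume fg: "f \<in> range tform" "g \<in> range tform"
    then obtain ps qs where "f = tform ps" "g = tform qs" by blast
    then show "(\<Sum>(x, y)\<leftarrow>(SOME ps. f = tform ps). g x y) = (\<Sum>(x, y)\<leftarrow>(SOME ps. g = tform ps). f x y)"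
      using tform_some[of f ps g] tform_some[of g qs f] fg tform_swap[of ps qs] by simp
  qed
  have "h \<bullet> (f + g) = h \<bullet> f + h \<bullet> g"
    by transfer (simp add: split_def sum_list_addf)
  then show "(f + g) \<bullet> h = f \<bullet> h + g \<bullet> h" by (simp only: comm[of _ h])
  have "g \<bullet> (r *\<^sub>R f) = r * (g \<bullet> f)"
    by transfer (simp add: split_def sum_list_const_mult)
  then show "(r *\<^sub>R f) \<bullet> g = r * (f \<bullet> g)" by (simp only: comm[of _ g])
  have "0 \<le> f \<bullet> f \<and> (f \<bullet> f = 0 \<longrightarrow> f = 0)"
  proof transfer
    fix f :: "'a \<Rightarrow> 'b \<Rightarrow> real" assume f: "f \<in> range tform"
    then obtain ps where ps: "f = tform ps" by blast
    obtain S z where S: "orthonormal_rep ps S z" using orthonormal_rep_exists by blast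
    have sq: "(\<Sum>(x, y)\<leftarrow>(SOME ps. f = tform ps). f x y) = (\<Sum>e\<in>S. (norm (z e))\<^sup>2)"
      using tform_some[OF ps f] tform_square[OF S] ps by simp
    have "f = (\<lambda>u v. 0)" if "(\<Sum>e\<in>S. (norm (z e))\<^sup>2) = 0"
    proof -
      have "\<forall>e\<in>S. z e = 0"
        using that orthonormal_repD(1)[OF S] by (simp add: sum_nonneg_eq_0_iff)
      then show ?thesis unfolding ps by (auto simp: orthonormal_repD(4)[OF S] fun_eq_iff)
    qed
    then show "0 \<le> (\<Sum>(x, y)\<leftarrow>(SOME ps. f = tform ps). f x y) \<and>
      ((\<Sum>(x, y)\<leftarrow>(SOME ps. f = tform ps). f x y) = 0 \<longrightarrow> f = (\<lambda>u v. 0))"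
      unfolding sq by (auto intro: sum_nonneg)
  qed
  moreover have "0 \<bullet> (0::('a, 'b) alg_tensor) = 0"
    by transfer (simp add: split_def)
  ultimately show "0 \<le> f \<bullet> f" "f \<bullet> f = 0 \<longleftrightarrow> f = 0" by auto
  show "norm f = sqrt (f \<bullet> f)" by (rule norm_alg_tensor_def)
qed

end


text \<open>The Hilbert tensor product is the completion of the algebraic one.\<close>

type_synonym ('a, 'b) htensor = "('a, 'b) alg_tensor completion"

lift_definition alg_tensor_of :: "'a::real_inner \<Rightarrow> 'b::real_inner \<Rightarrow> ('a, 'b) alg_tensor"
  is "\<lambda>x y u v. (x \<bullet> u) * (y \<bullet> v)"
  by (rule range_eqI[of _ _ "[(_, _)]"]) (auto simp: fun_eq_iff)

definition tensor :: "'a::real_inner \<Rightarrow> 'b::real_inner \<Rightarrow> ('a, 'b) htensor"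
    (infixr \<open>\<otimes>\<^sub>H\<close> 70) where
  "x \<otimes>\<^sub>H y = to_completion (alg_tensor_of x y)"

text \<open>\<open>B \<otimes> C\<close> is the bounded operator with \<open>(B \<otimes> C) (x \<otimes> y) = B x \<otimes> C y\<close>; existence and
  uniqueness are shown below.\<close>

definition tensor_op :: "('a::real_inner \<Rightarrow>\<^sub>L 'a) \<Rightarrow> ('b::real_inner \<Rightarrow>\<^sub>L 'b) \<Rightarrow>
    (('a, 'b) htensor \<Rightarrow>\<^sub>L ('a, 'b) htensor)" (infixr \<open>\<otimes>\<^sub>o\<^sub>p\<close> 70) where
  "B \<otimes>\<^sub>o\<^sub>p C = (THE T. \<forall>x y. blinfun_apply T (x \<otimes>\<^sub>H y) = B x \<otimes>\<^sub>H C y)"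

definition alg_of_list :: "('a::real_inner \<times> 'b::real_inner) list \<Rightarrow> ('a, 'b) alg_tensor" where
  "alg_of_list ps = (\<Sum>(x, y)\<leftarrow>ps. alg_tensor_of x y)"

lemma Rep_alg_of_list: "Rep_alg_tensor (alg_of_list ps) = tform ps"
  by (induction ps)
    (auto simp: alg_of_list_def fun_eq_iff zero_alg_tensor.rep_eq plus_alg_tensor.rep_eq
      alg_tensor_of.rep_eq)

lemma alg_of_list_eq_iff: "alg_of_list ps = alg_of_list qs \<longleftrightarrow> tform ps = tform qs"
  by (metis Rep_alg_of_list Rep_alg_tensor_inject)

lemma alg_of_list_surj: "\<exists>ps. alg_of_list ps = f"
proof -
  obtain ps where "Rep_alg_tensor f = tform ps" using Rep_alg_tensor by blast
  then show ?thesis by (metis Rep_alg_of_list Rep_alg_tensor_inject)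
qed

lemma inner_alg_of_list: "alg_of_list ps \<bullet> f = (\<Sum>(x, y)\<leftarrow>ps. Rep_alg_tensor f x y)"
  unfolding inner_alg_tensor.rep_eq
  by (rule tform_some) (simp_all add: Rep_alg_of_list Rep_alg_tensor)

lemma inner_tensor: "(x \<otimes>\<^sub>H y) \<bullet> (u \<otimes>\<^sub>H v) = (x \<bullet> u) * (y \<bullet> v)"
  using inner_alg_of_list[of "[(x, y)]" "alg_tensor_of u v"]
  by (simp add: tensor_def alg_of_list_def alg_tensor_of.rep_eq inner_commute)

lemma bilinear_tensor: "bilinear (\<otimes>\<^sub>H)"
proof -
  have "alg_tensor_of (a + b) y = alg_tensor_of a y + alg_tensor_of b y"
    "alg_tensor_of x (c + d) = alg_tensor_of x c + alg_tensor_of x d"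
    "alg_tensor_of (r *\<^sub>R x) y = r *\<^sub>R alg_tensor_of x y"
    "alg_tensor_of x (r *\<^sub>R y) = r *\<^sub>R alg_tensor_of x y"
    for a b x :: 'a and c d y :: 'b and r
    by (transfer; simp add: fun_eq_iff inner_add_left algebra_simps)+
  then show ?thesis
    unfolding bilinear_def tensor_def
    by (intro conjI allI linearI)
      (simp_all add: linear_add[OF linear_to_completion] linear_scale[OF linear_to_completion])
qed

lemma closure_span_tensor: "closure (span (range (\<lambda>(x, y). x \<otimes>\<^sub>H y))) = UNIV"
proof -
  have "to_completion (alg_of_list ps) \<in> span (range (\<lambda>(x, y). x \<otimes>\<^sub>H y))" for ps :: "('a \<times> 'b) list"
  proof (induction ps)
    case Nil
    show ?case by (simp add: alg_of_list_def linear_0[OF linear_to_completion] span_zero)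
  next
    case (Cons p ps)
    obtain x y where p: "p = (x, y)" by force
    have "to_completion (alg_of_list (p # ps)) = x \<otimes>\<^sub>H y + to_completion (alg_of_list ps)"
      by (simp add: p alg_of_list_def tensor_def linear_add[OF linear_to_completion])
    moreover have "x \<otimes>\<^sub>H y \<in> span (range (\<lambda>(x, y). x \<otimes>\<^sub>H y))"
      by (intro span_base range_eqI[of _ _ "(x, y)"]) simp
    ultimately show ?case using Cons.IH by (simp add: span_add)
  qed
  then have "range to_completion \<subseteq> span (range (\<lambda>(x, y). (x::'a) \<otimes>\<^sub>H (y::'b)))"
    using alg_of_list_surj by (metis image_subset_iff)
  from closure_mono[OF this] show ?thesis
    by (simp add: closure_range_to_completion top.extremum_unique)
qed

lemma blinfun_eq_on_tensor:
  fixes T U :: "('a::real_inner, 'b::real_inner) htensor \<Rightarrow>\<^sub>L 'c::real_normed_vector"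
  assumes eq: "\<And>x y. T (x \<otimes>\<^sub>H y) = U (x \<otimes>\<^sub>H y)"
  shows "T = U"
proof (rule blinfun_eqI)
  fix w :: "('a, 'b) htensor"
  have sub: "span (range (\<lambda>(x, y). (x::'a) \<otimes>\<^sub>H (y::'b))) \<subseteq> {w. (T - U) w = 0}"
    by (rule span_minimal) (auto simp: eq blinfun.diff_left subspace_def blinfun.bilinear_simps)
  have "closed {w. (T - U) w = 0}"
    by (intro closed_Collect_eq continuous_intros)
  with sub have "closure (span (range (\<lambda>(x, y). (x::'a) \<otimes>\<^sub>H (y::'b)))) \<subseteq> {w. (T - U) w = 0}"
    by (rule closure_minimal)
  then show "T w = U w" by (auto simp: closure_span_tensor blinfun.diff_left)
qed

lemma norm_alg_of_list: "(norm (alg_of_list ps))\<^sup>2 = (\<Sum>(x, y)\<leftarrow>ps. tform ps x y)"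
  by (simp add: power2_norm_eq_inner inner_alg_of_list Rep_alg_of_list)

lemma norm_alg_of_list_left:
  fixes ps :: "('a::real_inner \<times> 'b::real_inner) list" and B :: "'a \<Rightarrow>\<^sub>L 'a"
  shows "norm (alg_of_list (map (\<lambda>(x, y). (B x, y)) ps)) \<le> norm B * norm (alg_of_list ps)"
proof -
  obtain S z where S: "orthonormal_rep ps S z" using orthonormal_rep_exists by blast
  have B: "orthonormal_rep (map (\<lambda>(x, y). (B x, y)) ps) S (\<lambda>e. B (z e))"
    unfolding orthonormal_rep_def
  proof (intro conjI ballI allI impI)
    fix B' :: "'a \<Rightarrow> 'a" and u v assume "linear B'"
    then have "linear (\<lambda>x. B' (B x))"
      using linear_compose[OF bounded_linear.linear[OF blinfun.bounded_linear_right], of B' B]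
      by (simp add: o_def)
    from orthonormal_repD(3)[OF S this]
    show "tform (map (\<lambda>(x, y). (B' x, y)) (map (\<lambda>(x, y). (B x, y)) ps)) u v
        = (\<Sum>e\<in>S. (B' (B (z e)) \<bullet> u) * (e \<bullet> v))"
      by (simp add: o_def split_def)
  qed (use orthonormal_repD(1,2)[OF S] in auto)
  have "(norm (alg_of_list (map (\<lambda>(x, y). (B x, y)) ps)))\<^sup>2 = (\<Sum>e\<in>S. (norm (B (z e)))\<^sup>2)"
    unfolding norm_alg_of_list by (rule tform_square[OF B])
  also have "\<dots> \<le> (\<Sum>e\<in>S. (norm B * norm (z e))\<^sup>2)"
    by (intro sum_mono power_mono norm_blinfun) auto
  also have "\<dots> = (norm B * norm (alg_of_list ps))\<^sup>2"
    by (simp add: norm_alg_of_list tform_square[OF S] power_mult_distrib sum_distrib_left)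
  finally show ?thesis by (rule power2_le_imp_le) simp
qed

lemma norm_alg_of_list_swap:
  fixes ps :: "('a::real_inner \<times> 'b::real_inner) list"
  shows "norm (alg_of_list (map (\<lambda>(x, y). (y, x)) ps)) = norm (alg_of_list ps)"
proof -
  have "tform (map (\<lambda>(x, y). (y, x)) ps) v u = tform ps u v" for ps :: "('a \<times> 'b) list" and u v
    by (induction ps) auto
  then have "(norm (alg_of_list (map (\<lambda>(x, y). (y, x)) ps)))\<^sup>2 = (norm (alg_of_list ps))\<^sup>2"
    by (simp add: norm_alg_of_list o_def split_def)
  then show ?thesis by (rule power2_eq_imp_eq) auto
qed

lemma norm_alg_of_list_map:
  fixes ps :: "('a::real_inner \<times> 'b::real_inner) list" and B :: "'a \<Rightarrow>\<^sub>L 'a" and C :: "'b \<Rightarrow>\<^sub>L 'b"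
  shows "norm (alg_of_list (map (\<lambda>(x, y). (B x, C y)) ps))
    \<le> norm B * norm C * norm (alg_of_list ps)"
proof -
  have "norm (alg_of_list (map (\<lambda>(x, y). (B x, C y)) ps))
      \<le> norm B * norm (alg_of_list (map (\<lambda>(x, y). (x, C y)) ps))"
    using norm_alg_of_list_left[of B "map (\<lambda>(x, y). (x, C y)) ps"] by (simp add: o_def split_def)
  also have "norm (alg_of_list (map (\<lambda>(x, y). (x, C y)) ps))
      = norm (alg_of_list (map (\<lambda>(y, x). (C y, x)) (map (\<lambda>(x, y). (y, x)) ps)))"
    using norm_alg_of_list_swap[of "map (\<lambda>(x, y). (x, C y)) ps"] by (simp add: o_def split_def)
  also have "\<dots> \<le> norm C * norm (alg_of_list ps)"
    using norm_alg_of_list_left[of C "map (\<lambda>(x, y). (y, x)) ps"]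
    by (simp add: norm_alg_of_list_swap)
  finally show ?thesis by (simp add: mult_left_mono mult.assoc)
qed

lemma extend_to_completion:
  fixes F :: "'a::real_inner \<Rightarrow> 'b::banach"
  assumes "bounded_linear F"
  obtains T where "\<And>x. blinfun_apply T (to_completion x) = F x"
proof -
  interpret F: bounded_linear F by fact
  interpret c: linear "to_completion :: 'a \<Rightarrow> _" by (rule linear_to_completion)
  obtain K where K: "\<And>x. norm (F x) \<le> norm x * K" "K > 0" using F.pos_bounded by blast
  define G where "G = F \<circ> inv to_completion"
  have "inj (to_completion :: 'a \<Rightarrow> _)"
    by (rule injI) (metis c.diff eq_iff_diff_eq_0 norm_eq_zero norm_to_completion)
  then have G: "G (to_completion x) = F x" for x by (simp add: G_def)
  have "K-lipschitz_on (range to_completion) G"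
  proof (rule lipschitz_onI)
    fix p q :: "'a completion" assume "p \<in> range to_completion" "q \<in> range to_completion"
    then obtain x y where xy: "p = to_completion x" "q = to_completion y" by blast
    have "dist (F x) (F y) \<le> K * dist x y"
      using K(1)[of "x - y"] by (simp add: dist_norm F.diff mult.commute)
    then show "dist (G p) (G q) \<le> K * dist p q" by (simp add: xy G dist_norm flip: c.diff)
  qed (use K in simp)
  then have uc: "uniformly_continuous_on (range to_completion) G"
    by (rule lipschitz_on_uniformly_continuous)
  obtain g where g: "uniformly_continuous_on UNIV g" and gG: "\<And>p. p \<in> range to_completion \<Longrightarrow> G p = g p"
    using uniformly_continuous_on_extension_on_closure[OF uc, unfolded closure_range_to_completion]
    by metis
  have cont: "continuous_on UNIV g" using g by (rule uniformly_continuous_imp_continuous)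
  have gF: "g (to_completion x) = F x" for x using gG[of "to_completion x"] by (simp add: G)
  have seq: "\<exists>x. (\<lambda>n. to_completion (x n)) \<longlonglongrightarrow> p" for p :: "'a completion"
  proof -
    have "p \<in> closure (range to_completion)" by (simp add: closure_range_to_completion)
    then obtain f where f: "\<forall>n. f n \<in> range to_completion" "f \<longlonglongrightarrow> p"
      unfolding closure_sequential by (elim exE conjE)
    from f(1) have "\<forall>n. \<exists>y. f n = to_completion y" by blast
    then obtain x where "\<And>n. f n = to_completion (x n)" by metis
    then have "f = (\<lambda>n. to_completion (x n))" by auto
    with f(2) show ?thesis by (intro exI[of _ x]) simp
  qed
  have lim: "(\<lambda>n. F (x n)) \<longlonglongrightarrow> g p" if "(\<lambda>n. to_completion (x n)) \<longlonglongrightarrow> p" for x p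
    using continuous_on_tendsto_compose[OF cont that] by (simp add: gF)
  have "bounded_linear g"
  proof (rule bounded_linear_intro)
    fix p q :: "'a completion" and r
    obtain x where x: "(\<lambda>n. to_completion (x n)) \<longlonglongrightarrow> p" using seq by blast
    obtain y where y: "(\<lambda>n. to_completion (y n)) \<longlonglongrightarrow> q" using seq by blast
    have "(\<lambda>n. to_completion (x n + y n)) \<longlonglongrightarrow> p + q" unfolding c.add by (intro tendsto_add x y)
    from lim[OF this] have "(\<lambda>n. F (x n) + F (y n)) \<longlonglongrightarrow> g (p + q)" by (simp add: F.add)
    then show "g (p + q) = g p + g q"
      by (rule LIMSEQ_unique) (intro tendsto_add lim x y)
    have "(\<lambda>n. to_completion (r *\<^sub>R x n)) \<longlonglongrightarrow> r *\<^sub>R p"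
      unfolding c.scale by (intro tendsto_scaleR tendsto_const x)
    from lim[OF this] have "(\<lambda>n. r *\<^sub>R F (x n)) \<longlonglongrightarrow> g (r *\<^sub>R p)" by (simp add: F.scaleR)
    then show "g (r *\<^sub>R p) = r *\<^sub>R g p"
      by (rule LIMSEQ_unique) (intro tendsto_scaleR tendsto_const lim x)
    show "norm (g p) \<le> norm p * K"
    proof (rule LIMSEQ_le)
      show "(\<lambda>n. norm (F (x n))) \<longlonglongrightarrow> norm (g p)" by (intro tendsto_norm lim x)
      show "(\<lambda>n. norm (to_completion (x n)) * K) \<longlonglongrightarrow> norm p * K"
        by (intro tendsto_mult_right tendsto_norm x)
      show "\<exists>N. \<forall>n\<ge>N. norm (F (x n)) \<le> norm (to_completion (x n)) * K" using K(1) by simp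
    qed
  qed
  then show ?thesis using gF by (intro that[of "Blinfun g"]) (simp add: bounded_linear_Blinfun_apply)
qed

lemma tensor_op_exists:
  fixes B :: "'a::real_inner \<Rightarrow>\<^sub>L 'a" and C :: "'b::real_inner \<Rightarrow>\<^sub>L 'b"
  shows "\<exists>!T. \<forall>x y. blinfun_apply T (x \<otimes>\<^sub>H y) = B x \<otimes>\<^sub>H C y"
proof -
  define m where "m = map (\<lambda>(x, y). (B x, C y))"
  define F where "F f = alg_of_list (m (SOME ps. alg_of_list ps = f))" for f :: "('a, 'b) alg_tensor"
  have append: "alg_of_list (ps @ qs) = alg_of_list ps + alg_of_list qs"
    for ps qs :: "('a \<times> 'b) list" by (simp add: alg_of_list_def)
  have scale: "alg_of_list (map (\<lambda>(x, y). (r *\<^sub>R x, y)) ps) = r *\<^sub>R alg_of_list ps"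
    for r and ps :: "('a \<times> 'b) list"
    by (simp add: Rep_alg_tensor_inject[symmetric] Rep_alg_of_list scaleR_alg_tensor.rep_eq fun_eq_iff)
  have m_scale: "m (map (\<lambda>(x, y). (r *\<^sub>R x, y)) ps) = map (\<lambda>(x, y). (r *\<^sub>R x, y)) (m ps)" for r ps
    by (simp add: m_def o_def split_def blinfun.scaleR_right)
  have m_append: "m (ps @ qs) = m ps @ m qs" for ps qs by (simp add: m_def)
  have bound: "norm (alg_of_list (m ps)) \<le> norm B * norm C * norm (alg_of_list ps)" for ps
    unfolding m_def by (rule norm_alg_of_list_map)
  have wd: "alg_of_list (m ps) = alg_of_list (m qs)" if "alg_of_list ps = alg_of_list qs" for ps qs
  proof -
    have "alg_of_list (ps @ map (\<lambda>(x, y). ((-1) *\<^sub>R x, y)) qs) = 0"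
      unfolding append scale using that by simp
    with bound[of "ps @ map (\<lambda>(x, y). ((-1) *\<^sub>R x, y)) qs"]
    have "alg_of_list (m ps) + (-1) *\<^sub>R alg_of_list (m qs) = 0"
      unfolding m_append m_scale append scale by simp
    then show ?thesis by simp
  qed
  have F: "F (alg_of_list ps) = alg_of_list (m ps)" for ps
    unfolding F_def by (rule wd) (rule someI, rule refl)
  have "bounded_linear F"
  proof (rule bounded_linear_intro)
    fix f g :: "('a, 'b) alg_tensor" and r
    obtain ps where ps: "f = alg_of_list ps" using alg_of_list_surj by metis
    obtain qs where qs: "g = alg_of_list qs" using alg_of_list_surj by metis
    show "F (f + g) = F f + F g"
      unfolding ps qs by (simp only: F m_append append flip: append)
    show "F (r *\<^sub>R f) = r *\<^sub>R F f"
      unfolding ps by (simp only: F m_scale scale flip: scale)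
    show "norm (F f) \<le> norm f * (norm B * norm C)"
      using bound[of ps] unfolding ps F by (simp add: mult.commute)
  qed
  moreover have "bounded_linear (to_completion :: ('a, 'b) alg_tensor \<Rightarrow> _)"
    using linear_to_completion by (auto simp: bounded_linear_def bounded_linear_axioms_def intro!: exI[of _ 1])
  ultimately have "bounded_linear (\<lambda>f. to_completion (F f))"
    using bounded_linear_compose by blast
  then obtain T where T: "\<And>f. blinfun_apply T (to_completion f) = to_completion (F f)"
    using extend_to_completion[of "\<lambda>f. to_completion (F f)"] by metis
  have "T (x \<otimes>\<^sub>H y) = B x \<otimes>\<^sub>H C y" for x y
    using F[of "[(x, y)]"] by (simp add: tensor_def T m_def alg_of_list_def)
  then show ?thesis by (intro ex1I[of _ T]) (auto intro!: blinfun_eq_on_tensor)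
qed

lemma tensor_op_apply [simp]: "(B \<otimes>\<^sub>o\<^sub>p C) (x \<otimes>\<^sub>H y) = B x \<otimes>\<^sub>H C y"
  using theI'[OF tensor_op_exists[of B C]] unfolding tensor_op_def by blast


abbreviation tensor_sq :: "'a::real_inner \<Rightarrow> ('a, 'a) htensor" where
  "tensor_sq x \<equiv> x \<otimes>\<^sub>H x"

abbreviation tensor_op_sq ::
    "('a::real_inner \<Rightarrow>\<^sub>L 'a) \<Rightarrow> (('a, 'a) htensor \<Rightarrow>\<^sub>L ('a, 'a) htensor)" where
  "tensor_op_sq B \<equiv> B \<otimes>\<^sub>o\<^sub>p B"


section \<open>Normal distributions\<close>

text \<open>Unlike a density with respect to Lebesgue measure, this includes the degenerate case of
  variance \<open>0\<close>. The variance \<open>v\<close> is meant to be nonnegative.\<close>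

definition normal_law :: "real \<Rightarrow> real \<Rightarrow> real measure" where
  "normal_law \<mu> v =
     (if v = 0 then return borel \<mu> else density lborel (\<lambda>x. ennreal (normal_density \<mu> (sqrt v) x)))"

end

theory Submission
  imports Defs "HOL-Real_Asymp.Real_Asymp"
begin

text \<open>
  Let \<open>B\<close> be the mean of \<open>A\<close>, \<open>D\<^sub>k = A\<^sub>k - B\<close>, \<open>W\<^sub>k = e\<^bsup>A\<^sub>1/n\<^esup> \<dots> e\<^bsup>A\<^sub>k/n\<^esup>\<close> and \<open>E\<^sub>k = e\<^bsup>kB/n\<^esup>\<close>. Telescoping along \<open>W\<^sub>k E\<^sub>n\<^sub>-\<^sub>k\<close> gives
  \<open>W\<^sub>n - E\<^sub>n = (1/n) \<Sum>\<^sub>k W\<^sub>k\<^sub>-\<^sub>1 D\<^sub>k E\<^sub>n\<^sub>-\<^sub>k + O(1/n)\<close>, and applying the same formula to \<open>W\<^sub>k\<^sub>-\<^sub>1\<close> splits the right-hand side into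
  a sum of independent terms \<open>(1/n) \<Sum>\<^sub>k E\<^sub>k\<^sub>-\<^sub>1 D\<^sub>k E\<^sub>n\<^sub>-\<^sub>k\<close>, a double sum with prefactor \<open>1/n\<^sup>2\<close> whose matrix elements are
  pairwise orthogonal in \<open>L\<^sup>2\<close> and hence of order \<open>1/n\<close>, and a deterministic error of order \<open>1/n\<close>. After
  multiplication by \<open>\<surd>n\<close> only the first sum survives; its characteristic function converges to the
  Gaussian one, the variances being Riemann sums of the integral that defines \<open>\<Sigma>\<close>.
\<close>

subsection \<open>Exponentials of operators\<close>

text \<open>The one-step formula alone leaves summands with the random prefix
  \<open>W\<^sub>k\<^sub>-\<^sub>1\<close>, which are martingale differences but not independent.
  The second expansion trades the prefix for \<open>E\<^sub>k\<^sub>-\<^sub>1\<close>, so that the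
  limit argument only meets independent bounded real variables. Pairing with fixed \<open>x\<close>
  and \<open>y\<close> makes the double sum accessible to second moments; this is where the weak
  operator topology enters.

  The main obstacle is measurability. The operator norm topology is in general not separable, so
  sums and products of Borel maps need not be Borel, and Borel coordinates need not form a Borel map
  into the sequence space. Hence the random quantities are treated as continuous functions of the
  whole sequence and approximated by rounding each coordinate to finitely many values. For rounded
  sequences independence of the single coordinates suffices to factor expectations, and completeness
  of the measure carries measurability to almost sure limits. The norm estimates are stated for
  deterministic sequences and used path by path.\<close>

lemma norm_op_pow:
  fixes B :: "'a::real_normed_vector \<Rightarrow>\<^sub>L 'a"
  shows "norm (((o\<^sub>L) B ^^ k) id_blinfun) \<le> norm B ^ k"
  by (induction k)
    (auto simp: norm_blinfun_id_le intro!: order_trans[OF norm_blinfun_compose] mult_left_mono)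

lemma op_pow_scaleR:
  fixes B :: "'a::real_normed_vector \<Rightarrow>\<^sub>L 'a"
  shows "((o\<^sub>L) (s *\<^sub>R B) ^^ k) id_blinfun = s ^ k *\<^sub>R (((o\<^sub>L) B ^^ k) id_blinfun)"
  by (induction k)
    (simp_all add: bounded_bilinear.scaleR_left[OF bounded_bilinear_blinfun_compose]
      bounded_bilinear.scaleR_right[OF bounded_bilinear_blinfun_compose])

text \<open>The scalar stays outside the powers of \<open>B\<close>, so exponentials of different
  multiples of \<open>B\<close> are series in the same operators and can be subtracted
  coefficientwise.\<close>

lemma op_exp_scaleR_sums:
  fixes B :: "'a::banach \<Rightarrow>\<^sub>L 'a"
  shows "(\<lambda>k. (s ^ k / fact k) *\<^sub>R (((o\<^sub>L) B ^^ k) id_blinfun)) sums op_exp (s *\<^sub>R B)"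
proof -
  have "summable (\<lambda>k. norm ((s ^ k / fact k) *\<^sub>R (((o\<^sub>L) B ^^ k) id_blinfun)))"
  proof (rule summable_comparison_test'[where N=0])
    show "summable (\<lambda>k. inverse (fact k) * (\<bar>s\<bar> * norm B) ^ k)"
      by (rule summable_exp)
    show "norm (norm ((s ^ k / fact k) *\<^sub>R (((o\<^sub>L) B ^^ k) id_blinfun)))
        \<le> inverse (fact k) * (\<bar>s\<bar> * norm B) ^ k" for k
      using norm_op_pow[of k B]
      by (auto simp: power_mult_distrib power_abs abs_mult divide_inverse_commute mult.assoc
          intro!: mult_left_mono)
  qed
  then have "summable (\<lambda>k. (s ^ k / fact k) *\<^sub>R (((o\<^sub>L) B ^^ k) id_blinfun))"
    by (rule summable_norm_cancel)
  from summable_sums[OF this] show ?thesis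
    by (simp add: op_exp_def op_pow_scaleR)
qed

lemma op_exp_0 [simp]: "op_exp (0 :: 'a::banach \<Rightarrow>\<^sub>L 'a) = id_blinfun"
proof -
  have "(\<lambda>k. (0 ^ k / fact k) *\<^sub>R (((o\<^sub>L) 0 ^^ k) (id_blinfun :: 'a \<Rightarrow>\<^sub>L 'a)))
    = (\<lambda>k. if k = 0 then id_blinfun else 0)"
    by (auto simp: fun_eq_iff)
  then show ?thesis
    using op_exp_scaleR_sums[of 0 "0 :: 'a \<Rightarrow>\<^sub>L 'a"] sums_unique2[OF _ sums_single[of 0 "\<lambda>_. id_blinfun :: 'a \<Rightarrow>\<^sub>L 'a"]]
    by (simp add: fun_eq_iff)
qed

lemma norm_op_exp_le:
  fixes B :: "'a::banach \<Rightarrow>\<^sub>L 'a"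
  shows "norm (op_exp B) \<le> exp (norm B)"
proof -
  have e: "(\<lambda>k. norm B ^ k /\<^sub>R fact k) sums exp (norm B)" by (rule exp_converges)
  have "norm (\<Sum>k. (1 ^ k / fact k) *\<^sub>R (((o\<^sub>L) B ^^ k) id_blinfun)) \<le> (\<Sum>k. norm B ^ k /\<^sub>R fact k)"
    using norm_op_pow[of _ B] by (intro norm_suminf_le sums_summable[OF e]) (auto simp: field_simps)
  then show ?thesis
    using sums_unique[OF op_exp_scaleR_sums[of 1 B]] sums_unique[OF e] by simp
qed

text \<open>The bound \<open>exp x - 1 \<le> x * exp x\<close>, which is
  \<open>1 - x \<le> exp (- x)\<close> multiplied by \<open>exp x\<close>, is applied twice.\<close>

lemma exp_minus_one_minus_le:
  fixes x :: real
  assumes "0 \<le> x"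
  shows "exp x - 1 - x \<le> x\<^sup>2 * exp x"
proof -
  have "1 - x \<le> exp (- x)" using exp_ge_add_one_self[of "- x"] by simp
  then have "(1 - x) * exp x \<le> exp (- x) * exp x" by (intro mult_right_mono) auto
  then have *: "exp x - 1 \<le> x * exp x" by (simp add: algebra_simps flip: exp_add)
  have "exp x - 1 - x \<le> x * (exp x - 1)" using * by (simp add: algebra_simps)
  also have "\<dots> \<le> x * (x * exp x)" using * assms by (intro mult_left_mono)
  finally show ?thesis by (simp add: power2_eq_square mult.assoc)
qed

text \<open>These are the first two binomial terms, the others being nonnegative. The inequality
  makes the coefficients of the Taylor remainder nonnegative.\<close>

lemma power_add_ge_linear:
  fixes s h :: real
  assumes "0 \<le> s" "0 \<le> h"
  shows "s ^ Suc j + real (Suc j) * h * s ^ j \<le> (s + h) ^ Suc j"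
proof (induction j)
  case (Suc j)
  have "s ^ Suc (Suc j) + real (Suc (Suc j)) * h * s ^ Suc j
      \<le> (s + h) * (s ^ Suc j + real (Suc j) * h * s ^ j)"
    using assms by (simp add: algebra_simps)
  also have "\<dots> \<le> (s + h) * (s + h) ^ Suc j"
    using assms Suc by (intro mult_left_mono) auto
  finally show ?case by simp
qed simp

text \<open>The Taylor coefficients of the remainder are nonnegative, so the series is dominated termwise
  by the one for \<open>norm B\<close>.\<close>

lemma op_exp_taylor:
  fixes B :: "'a::banach \<Rightarrow>\<^sub>L 'a"
  assumes "0 \<le> s" "0 \<le> h"
  shows "norm (op_exp ((s + h) *\<^sub>R B) - op_exp (s *\<^sub>R B) - h *\<^sub>R (B o\<^sub>L op_exp (s *\<^sub>R B)))
    \<le> h\<^sup>2 * (norm B)\<^sup>2 * exp ((s + h) * norm B)"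
proof -
  let ?p = "\<lambda>k. ((o\<^sub>L) B ^^ k) id_blinfun"
  let ?b = "norm B"
  \<comment> \<open>The coefficient of the \<open>k\<close>-th power of \<open>B\<close> in the
    remainder. The index shift in the \<open>Suc j\<close> case comes from the extra factor
    \<open>B\<close> in front of \<open>op_exp (s *\<^sub>R B)\<close>.\<close>
  define c where "c k = (s + h) ^ k / fact k - s ^ k / fact k
    - (case k of 0 \<Rightarrow> 0 | Suc j \<Rightarrow> h * (s ^ j / fact j))" for k
  have c_nonneg: "0 \<le> c k" for k
  proof (cases k)
    case (Suc j)
    have "s ^ k / fact k + h * (s ^ j / fact j) = (s ^ Suc j + real (Suc j) * h * s ^ j) / fact (Suc j)"
      by (simp add: Suc divide_simps)
    also have "\<dots> \<le> (s + h) ^ k / fact k"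
      unfolding Suc using assms by (intro divide_right_mono power_add_ge_linear) auto
    finally show ?thesis by (simp add: c_def Suc)
  qed (simp add: c_def)
  have "(\<lambda>j. h *\<^sub>R (B o\<^sub>L ((s ^ j / fact j) *\<^sub>R ?p j))) sums (h *\<^sub>R (B o\<^sub>L op_exp (s *\<^sub>R B)))"
    by (intro sums_scaleR_right bounded_linear.sums[OF bounded_bilinear.bounded_linear_right[OF bounded_bilinear_blinfun_compose]]
        op_exp_scaleR_sums)
  then have "(\<lambda>k. (case k of 0 \<Rightarrow> 0 | Suc j \<Rightarrow> h * (s ^ j / fact j)) *\<^sub>R ?p k)
      sums (h *\<^sub>R (B o\<^sub>L op_exp (s *\<^sub>R B)))"
    by - (rule sums_Suc_imp,
      simp_all add: bounded_bilinear.scaleR_right[OF bounded_bilinear_blinfun_compose])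
  from sums_diff[OF sums_diff[OF op_exp_scaleR_sums[of "s + h" B] op_exp_scaleR_sums[of s B]] this]
  have A: "(\<lambda>k. c k *\<^sub>R ?p k) sums
      (op_exp ((s + h) *\<^sub>R B) - op_exp (s *\<^sub>R B) - h *\<^sub>R (B o\<^sub>L op_exp (s *\<^sub>R B)))"
    by (simp only: c_def scaleR_diff_left)
  have e: "(\<lambda>k. (t ^ k / fact k) * ?b ^ k) sums exp (t * ?b)" for t
    using exp_converges[of "t * ?b"] by (simp add: power_mult_distrib divide_inverse_commute mult.assoc)
  have "(\<lambda>j. h * ?b * ((s ^ j / fact j) * ?b ^ j)) sums (h * ?b * exp (s * ?b))"
    by (intro sums_mult e)
  then have "(\<lambda>k. (case k of 0 \<Rightarrow> 0 | Suc j \<Rightarrow> h * (s ^ j / fact j)) * ?b ^ k)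
      sums (h * ?b * exp (s * ?b))"
    by - (rule sums_Suc_imp, simp_all add: algebra_simps)
  from sums_diff[OF sums_diff[OF e[of "s + h"] e[of s]] this]
  have R: "(\<lambda>k. c k * ?b ^ k) sums (exp ((s + h) * ?b) - exp (s * ?b) - h * ?b * exp (s * ?b))"
    by (simp only: c_def left_diff_distrib)
  have "norm (\<Sum>k. c k *\<^sub>R ?p k) \<le> (\<Sum>k. c k * ?b ^ k)"
    using norm_op_pow[of _ B] c_nonneg
    by (intro norm_suminf_le sums_summable[OF R]) (auto intro!: mult_left_mono)
  \<comment> \<open>Factoring out \<open>exp (s * ?b)\<close> leaves the scalar remainder at
    0.\<close>
  also have "\<dots> = exp (s * ?b) * (exp (h * ?b) - 1 - h * ?b)"
    unfolding sums_unique[OF R, symmetric] by (simp add: algebra_simps flip: exp_add)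
  also have "\<dots> \<le> exp (s * ?b) * ((h * ?b)\<^sup>2 * exp (h * ?b))"
    using assms by (intro mult_left_mono exp_minus_one_minus_le) auto
  also have "\<dots> = h\<^sup>2 * ?b\<^sup>2 * exp ((s + h) * ?b)"
    by (simp add: power_mult_distrib algebra_simps flip: exp_add)
  finally show ?thesis unfolding sums_unique[OF A, symmetric] .
qed

lemma continuous_on_op_pow:
  fixes S :: "('a::real_normed_vector \<Rightarrow>\<^sub>L 'a) set"
  shows "continuous_on S (\<lambda>B. ((o\<^sub>L) B ^^ k) id_blinfun)"
  by (induction k) (auto intro!: bounded_bilinear.continuous_on[OF bounded_bilinear_blinfun_compose] continuous_intros)

text \<open>The Weierstrass test gives uniform convergence on closed balls; the gluing is done over
  open balls, since continuity passes to unions of open sets.\<close>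

lemma continuous_on_op_exp: "continuous_on UNIV (op_exp :: ('a::banach \<Rightarrow>\<^sub>L 'a) \<Rightarrow> _)"
proof -
  have "continuous_on (cball 0 r) (op_exp :: ('a \<Rightarrow>\<^sub>L 'a) \<Rightarrow> _)" for r
  proof -
    have "uniform_limit (cball 0 r) (\<lambda>n (B :: 'a \<Rightarrow>\<^sub>L 'a). \<Sum>k<n. (1 / fact k) *\<^sub>R (((o\<^sub>L) B ^^ k) (id_blinfun :: 'a \<Rightarrow>\<^sub>L 'a)))
        (\<lambda>B :: 'a \<Rightarrow>\<^sub>L 'a. \<Sum>k. (1 / fact k) *\<^sub>R (((o\<^sub>L) B ^^ k) id_blinfun)) sequentially"
    proof (rule Weierstrass_m_test)
      show "summable (\<lambda>k. inverse (fact k) * r ^ k)" by (rule summable_exp)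
      fix k and B :: "'a \<Rightarrow>\<^sub>L 'a" assume "B \<in> cball 0 r"
      then have "norm B ^ k \<le> r ^ k" by (intro power_mono) auto
      with norm_op_pow[of k B] show "norm ((1 / fact k) *\<^sub>R (((o\<^sub>L) B ^^ k) id_blinfun)) \<le> inverse (fact k) * r ^ k"
        by (auto simp: divide_inverse intro!: mult_left_mono)
    qed
    then have "continuous_on (cball 0 r) (\<lambda>B :: 'a \<Rightarrow>\<^sub>L 'a. \<Sum>k. (1 / fact k) *\<^sub>R (((o\<^sub>L) B ^^ k) (id_blinfun :: 'a \<Rightarrow>\<^sub>L 'a)))"
      by (rule uniform_limit_theorem[rotated])
        (auto intro!: always_eventually continuous_intros continuous_on_op_pow)
    then show ?thesis by (simp add: op_exp_def[abs_def])
  qed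
  then have "continuous_on (\<Union>r. ball 0 r) (op_exp :: ('a \<Rightarrow>\<^sub>L 'a) \<Rightarrow> _)"
    by (intro continuous_on_open_UN) (auto intro: continuous_on_subset[OF _ ball_subset_cball])
  moreover have "(\<Union>r. ball 0 r) = (UNIV :: ('a \<Rightarrow>\<^sub>L 'a) set)"
    using gt_ex by auto
  ultimately show ?thesis by simp
qed

section \<open>Products of exponentials and their second-order expansion\<close>

definition exp_prod :: "nat \<Rightarrow> (nat \<Rightarrow> 'a::real_normed_vector \<Rightarrow>\<^sub>L 'a) \<Rightarrow> nat \<Rightarrow> ('a \<Rightarrow>\<^sub>L 'a)" where
  "exp_prod n a k = op_prod (\<lambda>i. op_exp ((1 / real n) *\<^sub>R a i)) k"

text \<open>\<open>exp_prod\<close> is \<open>W\<^sub>k\<close> and \<open>exp_step\<close> is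
  \<open>E\<^sub>k\<close> of the overview. Taking a single exponential with exponent
  \<open>k / n\<close> lets \<open>op_exp_taylor\<close> compare consecutive members with step
  \<open>1 / n\<close>.\<close>

definition exp_step :: "nat \<Rightarrow> ('a::real_normed_vector \<Rightarrow>\<^sub>L 'a) \<Rightarrow> nat \<Rightarrow> ('a \<Rightarrow>\<^sub>L 'a)" where
  "exp_step n B k = op_exp ((real k / real n) *\<^sub>R B)"

lemma norm_op_prod_le:
  assumes "\<And>i. norm (F i) \<le> c"
  shows "norm (op_prod F k) \<le> c ^ k"
proof (induction k)
  case (Suc k)
  have "0 \<le> c" using order_trans[OF norm_ge_zero assms] .
  then have "norm (op_prod F k o\<^sub>L F (Suc k)) \<le> c ^ k * c"
    by (intro order_trans[OF norm_blinfun_compose] mult_mono Suc assms) auto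
  then show ?case by (simp add: mult.commute)
qed (simp add: norm_blinfun_id_le)

text \<open>Each of the at most \<open>n\<close> factors has norm at most
  \<open>exp (r / n)\<close>. The resulting bound depends on neither \<open>k\<close> nor
  \<open>n\<close>, which keeps the later constants uniform.\<close>

lemma norm_exp_prod_le:
  fixes a :: "nat \<Rightarrow> 'a::banach \<Rightarrow>\<^sub>L 'a"
  assumes a: "\<And>i. norm (a i) \<le> r" and "0 < n" "k \<le> n"
  shows "norm (exp_prod n a k) \<le> exp r"
proof -
  have "norm (op_exp ((1 / real n) *\<^sub>R a i)) \<le> exp (r / n)" for i
    using a[of i] \<open>0 < n\<close> by (intro order_trans[OF norm_op_exp_le]) (auto simp: field_simps)
  then have "norm (exp_prod n a k) \<le> exp (r / n) ^ k"
    unfolding exp_prod_def by (rule norm_op_prod_le)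
  also have "\<dots> = exp (k * (r / n))" by (rule exp_of_nat_mult[symmetric])
  also have "\<dots> \<le> exp r"
    using assms order_trans[OF norm_ge_zero a] by (auto simp: field_simps mult_right_mono mult_left_mono)
  finally show ?thesis .
qed

lemma norm_exp_step_le:
  fixes B :: "'a::banach \<Rightarrow>\<^sub>L 'a"
  assumes "norm B \<le> r" "0 < n" "k \<le> n"
  shows "norm (exp_step n B k) \<le> exp r"
proof -
  have "real k * norm B \<le> real n * r" using assms by (intro mult_mono) auto
  then show ?thesis
    unfolding exp_step_def using assms
    by (intro order_trans[OF norm_op_exp_le]) (auto simp: field_simps)
qed

lemmas blinfun_compose_simps =
  bounded_bilinear.add_left[OF bounded_bilinear_blinfun_compose]
  bounded_bilinear.add_right[OF bounded_bilinear_blinfun_compose]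
  bounded_bilinear.diff_left[OF bounded_bilinear_blinfun_compose]
  bounded_bilinear.diff_right[OF bounded_bilinear_blinfun_compose]
  bounded_bilinear.scaleR_left[OF bounded_bilinear_blinfun_compose]
  bounded_bilinear.scaleR_right[OF bounded_bilinear_blinfun_compose]

lemma blinfun_compose_assoc: "(f o\<^sub>L g) o\<^sub>L h = f o\<^sub>L (g o\<^sub>L h)"
  by (rule blinfun_eqI) simp

lemma id_blinfun_compose [simp]: "id_blinfun o\<^sub>L f = f" "f o\<^sub>L id_blinfun = f"
  by (auto intro: blinfun_eqI)

text \<open>With \<open>P\<^sub>j\<close> for the partial products the summand is
  \<open>P\<^sub>j\<^sub>+\<^sub>1 E (m - j - 1) - P\<^sub>j E (m - j)\<close>. The upper limit
  \<open>l\<close> is separate from \<open>m\<close> so that the induction leaves the arguments of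
  \<open>E\<close> alone.\<close>

lemma op_prod_telescope:
  assumes "l \<le> m"
  shows "(\<Sum>j<l. op_prod K j o\<^sub>L ((K (Suc j) o\<^sub>L E (m - Suc j)) - E (m - j)))
    = (op_prod K l o\<^sub>L E (m - l)) - E m"
  using assms
  by (induction l) (simp_all add: blinfun_compose_simps blinfun_compose_assoc)

lemma norm_blinfun_compose_le:
  "norm f \<le> c \<Longrightarrow> norm g \<le> d \<Longrightarrow> norm (f o\<^sub>L g) \<le> c * d"
  by (rule order_trans[OF norm_blinfun_compose])
    (auto intro!: mult_mono intro: order_trans[OF norm_ge_zero])

text \<open>Each telescoping difference compares one factor of the product with one step of the mean
  exponential. Their identity parts cancel, the first-order parts leave
  \<open>(a (Suc j) - B) / n\<close>, and two remainders of order \<open>1 / n\<^sup>2\<close> are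
  summed at most \<open>n\<close> times. Arbitrary \<open>m \<le> n\<close> is allowed because
  prefixes are expanded again below.\<close>

lemma exp_prod_expansion1:
  fixes B :: "'a::banach \<Rightarrow>\<^sub>L 'a"
  assumes B: "norm B \<le> r" and a: "\<And>i. norm (a i) \<le> r" and n: "0 < n" and m: "m \<le> n"
  shows "norm (exp_prod n a m - exp_step n B m
      - (1 / real n) *\<^sub>R (\<Sum>j<m. exp_prod n a j o\<^sub>L (a (Suc j) - B) o\<^sub>L exp_step n B (m - Suc j)))
    \<le> 2 * r\<^sup>2 * exp r ^ 3 / n"
proof -
  let ?K = "\<lambda>i. op_exp ((1 / real n) *\<^sub>R a i)" and ?E = "exp_step n B" and ?W = "exp_prod n a"
  have r: "0 \<le> r" using order_trans[OF norm_ge_zero B] .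
  \<comment> \<open>Second-order remainders: \<open>q\<close> of a factor around the identity,
    \<open>q'\<close> of the mean exponential over one step of length \<open>1 / n\<close>.\<close>
  define q where "q j = ?K (Suc j) - id_blinfun - (1 / n) *\<^sub>R a (Suc j)" for j
  define q' where "q' j = ?E (m - j) - ?E (m - Suc j) - (1 / n) *\<^sub>R (B o\<^sub>L ?E (m - Suc j))" for j
  have q: "norm (q j) \<le> r\<^sup>2 * exp r / n\<^sup>2" for j
  proof -
    have "norm (q j) \<le> (1 / n)\<^sup>2 * (norm (a (Suc j)))\<^sup>2 * exp ((0 + 1 / n) * norm (a (Suc j)))"
      using op_exp_taylor[of 0 "1 / n" "a (Suc j)"] by (simp add: q_def)
    also have "\<dots> \<le> (1 / n)\<^sup>2 * r\<^sup>2 * exp (1 * r)"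
      using a[of "Suc j"] n r mult_left_mono[of 1 "real n" r]
      by (intro mult_mono power_mono) (auto simp: divide_le_eq)
    finally show ?thesis by (simp add: power_divide)
  qed
  have q': "norm (q' j) \<le> r\<^sup>2 * exp r / n\<^sup>2" if "j < m" for j
  proof -
    have j: "real (m - Suc j) / n + 1 / n = real (m - j) / n"
      using that by (simp add: of_nat_diff add_divide_distrib[symmetric])
    have "norm (q' j) \<le> (1 / n)\<^sup>2 * (norm B)\<^sup>2 * exp ((real (m - Suc j) / n + 1 / n) * norm B)"
      using op_exp_taylor[of "real (m - Suc j) / n" "1 / n" B] unfolding q'_def exp_step_def j by simp
    also have "\<dots> \<le> (1 / n)\<^sup>2 * r\<^sup>2 * exp (1 * r)"
      unfolding j using B n r m
      by (intro mult_mono power_mono iffD2[OF exp_le_cancel_iff]) auto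
    finally show ?thesis by (simp add: power_divide)
  qed
  have t: "(?K (Suc j) o\<^sub>L ?E (m - Suc j)) - ?E (m - j)
      = (1 / n) *\<^sub>R ((a (Suc j) - B) o\<^sub>L ?E (m - Suc j)) + ((q j o\<^sub>L ?E (m - Suc j)) - q' j)" for j
    by (simp add: q_def q'_def blinfun_compose_simps scaleR_diff_right)
  have E: "norm (?E (m - Suc j)) \<le> exp r" for j using B n m by (intro norm_exp_step_le) auto
  have W: "norm (?W j) \<le> exp r" if "j < m" for j
    using a n m that by (intro norm_exp_prod_le) auto
  have "?W m - ?E m = (\<Sum>j<m. ?W j o\<^sub>L ((?K (Suc j) o\<^sub>L ?E (m - Suc j)) - ?E (m - j)))"
    using op_prod_telescope[of m m ?K ?E] by (simp add: exp_prod_def exp_step_def)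
  also have "\<dots> = (1 / n) *\<^sub>R (\<Sum>j<m. ?W j o\<^sub>L (a (Suc j) - B) o\<^sub>L ?E (m - Suc j))
      + (\<Sum>j<m. ?W j o\<^sub>L ((q j o\<^sub>L ?E (m - Suc j)) - q' j))"
    unfolding t by (simp add: blinfun_compose_simps(2,6) sum.distrib scaleR_sum_right blinfun_compose_assoc)
  finally have "norm (?W m - ?E m - (1 / n) *\<^sub>R (\<Sum>j<m. ?W j o\<^sub>L (a (Suc j) - B) o\<^sub>L ?E (m - Suc j)))
      = norm (\<Sum>j<m. ?W j o\<^sub>L ((q j o\<^sub>L ?E (m - Suc j)) - q' j))" by simp
  also have "\<dots> \<le> (\<Sum>j<m. exp r * (2 * r\<^sup>2 * exp r ^ 2 / n\<^sup>2))"
  proof (intro order_trans[OF norm_sum] sum_mono norm_blinfun_compose_le W)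
    fix j assume j: "j \<in> {..<m}"
    have "norm ((q j o\<^sub>L ?E (m - Suc j)) - q' j) \<le> r\<^sup>2 * exp r / n\<^sup>2 * exp r + r\<^sup>2 * exp r / n\<^sup>2 * 1"
      using j by (intro order_trans[OF norm_triangle_ineq4] add_mono norm_blinfun_compose_le q E)
        (use q'[of j] in auto)
    \<comment> \<open>By \<open>1 \<le> exp r\<close> both remainders get the same bound; the third
      power of \<open>exp r\<close> in the final constant is the bound on
      \<open>?W j\<close>.\<close>
    also have "\<dots> \<le> r\<^sup>2 * exp r / n\<^sup>2 * exp r + r\<^sup>2 * exp r / n\<^sup>2 * exp r"
      using r by (intro add_mono mult_left_mono) auto
    finally show "norm ((q j o\<^sub>L ?E (m - Suc j)) - q' j) \<le> 2 * r\<^sup>2 * exp r ^ 2 / n\<^sup>2"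
      by (simp add: power2_eq_square)
  qed auto
  also have "\<dots> = (2 * r\<^sup>2 * exp r ^ 3 / n) * (m / n)"
    by (simp add: power2_eq_square power3_eq_cube)
  also have "\<dots> \<le> 2 * r\<^sup>2 * exp r ^ 3 / n * 1"
    using m n by (intro mult_left_mono) auto
  finally show ?thesis by simp
qed

text \<open>The first-order formula is substituted for the prefix \<open>?W k\<close> in itself. Its
  error \<open>z k\<close> is multiplied by \<open>u k\<close>, of norm at most
  \<open>2 * r * exp r\<close>, and averaged over \<open>k\<close>; together with the error of the
  outer formula this gives the factor \<open>1 + 2 * r * exp r\<close>.\<close>

lemma exp_prod_expansion2:
  fixes B :: "'a::banach \<Rightarrow>\<^sub>L 'a"
  assumes B: "norm B \<le> r" and a: "\<And>i. norm (a i) \<le> r" and n: "0 < n"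
  shows "norm (exp_prod n a n - exp_step n B n
      - (1 / real n) *\<^sub>R (\<Sum>k<n. exp_step n B k o\<^sub>L (a (Suc k) - B) o\<^sub>L exp_step n B (n - Suc k))
      - (1 / (real n)\<^sup>2) *\<^sub>R (\<Sum>k<n. \<Sum>j<k. exp_prod n a j o\<^sub>L (a (Suc j) - B) o\<^sub>L exp_step n B (k - Suc j)
            o\<^sub>L (a (Suc k) - B) o\<^sub>L exp_step n B (n - Suc k)))
    \<le> 2 * r\<^sup>2 * exp r ^ 3 * (1 + 2 * r * exp r) / n"
proof -
  let ?E = "exp_step n B" and ?W = "exp_prod n a" and ?d = "\<lambda>i. a i - B"
  let ?C = "2 * r\<^sup>2 * exp r ^ 3 / n"
  define z where "z k = ?W k - ?E k - (1 / n) *\<^sub>R (\<Sum>j<k. ?W j o\<^sub>L ?d (Suc j) o\<^sub>L ?E (k - Suc j))" for k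
  define u where "u k = ?d (Suc k) o\<^sub>L ?E (n - Suc k)" for k
  have r: "0 \<le> r" using order_trans[OF norm_ge_zero B] .
  have z: "norm (z k) \<le> ?C" if "k \<le> n" for k
    unfolding z_def using exp_prod_expansion1[OF B a n that] .
  have u: "norm (u k) \<le> 2 * r * exp r" for k
    unfolding u_def using B n a[of "Suc k"]
    by (intro norm_blinfun_compose_le norm_exp_step_le order_trans[OF norm_triangle_ineq4]) auto
  have W: "?W k = ?E k + (1 / n) *\<^sub>R (\<Sum>j<k. ?W j o\<^sub>L ?d (Suc j) o\<^sub>L ?E (k - Suc j)) + z k" for k
    by (simp add: z_def)
  have "(\<Sum>k<n. ?W k o\<^sub>L ?d (Suc k) o\<^sub>L ?E (n - Suc k)) = (\<Sum>k<n. ?W k o\<^sub>L u k)"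
    by (simp add: u_def blinfun_compose_assoc)
  also have "\<dots> = (\<Sum>k<n. (?E k o\<^sub>L u k)
      + (1 / n) *\<^sub>R (\<Sum>j<k. (?W j o\<^sub>L ?d (Suc j) o\<^sub>L ?E (k - Suc j)) o\<^sub>L u k) + (z k o\<^sub>L u k))"
    by (subst (1) W)
      (simp add: blinfun_compose_simps(1,5) bounded_bilinear.sum_left[OF bounded_bilinear_blinfun_compose])
  also have "\<dots> = (\<Sum>k<n. ?E k o\<^sub>L u k)
      + (1 / n) *\<^sub>R (\<Sum>k<n. \<Sum>j<k. (?W j o\<^sub>L ?d (Suc j) o\<^sub>L ?E (k - Suc j)) o\<^sub>L u k) + (\<Sum>k<n. z k o\<^sub>L u k)"
    by (simp add: sum.distrib scaleR_sum_right)
  finally have eq: "?W n - ?E n - (1 / n) *\<^sub>R (\<Sum>k<n. ?E k o\<^sub>L ?d (Suc k) o\<^sub>L ?E (n - Suc k))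
      - (1 / (real n)\<^sup>2) *\<^sub>R (\<Sum>k<n. \<Sum>j<k. ?W j o\<^sub>L ?d (Suc j) o\<^sub>L ?E (k - Suc j) o\<^sub>L ?d (Suc k) o\<^sub>L ?E (n - Suc k))
      = z n + (1 / n) *\<^sub>R (\<Sum>k<n. z k o\<^sub>L u k)"
    by (subst (1) W)
      (simp add: algebra_simps u_def blinfun_compose_assoc power2_eq_square)
  have "norm (\<Sum>k<n. z k o\<^sub>L u k) \<le> (\<Sum>k<n. ?C * (2 * r * exp r))"
    by (intro order_trans[OF norm_sum] sum_mono norm_blinfun_compose_le z u) auto
  then have "(1 / n) * norm (\<Sum>k<n. z k o\<^sub>L u k) \<le> (1 / n) * (\<Sum>k<n. ?C * (2 * r * exp r))"
    by (rule mult_left_mono) simp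
  then have "norm (z n + (1 / n) *\<^sub>R (\<Sum>k<n. z k o\<^sub>L u k)) \<le> ?C + (1 / n) * (\<Sum>k<n. ?C * (2 * r * exp r))"
    using z[of n] by (intro order_trans[OF norm_triangle_ineq] add_mono) auto
  also have "\<dots> = 2 * r\<^sup>2 * exp r ^ 3 * (1 + 2 * r * exp r) / n"
    using n by (simp add: field_simps)
  finally show ?thesis unfolding eq by simp
qed

subsection \<open>Bochner integrals and tensor products of operators\<close>

text \<open>Preimages under the two functions differ only inside a null set, all of whose subsets
  are measurable by completeness.\<close>

lemma (in complete_measure) borel_measurable_AE_eq:
  assumes g: "g \<in> borel_measurable M" and eq: "AE \<omega> in M. f \<omega> = g \<omega>"
  shows "f \<in> borel_measurable M"
proof (rule measurableI)
  fix B :: "'b set" assume B: "B \<in> sets borel"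
  obtain N where N: "\<And>\<omega>. \<omega> \<in> space M - N \<Longrightarrow> f \<omega> = g \<omega>" "N \<in> null_sets M"
    using AE_E3[OF eq] by blast
  have "f -` B \<inter> space M = ((g -` B \<inter> space M) - N) \<union> (f -` B \<inter> space M \<inter> N)"
    using N(1) by auto
  moreover have "f -` B \<inter> space M \<inter> N \<in> sets M"
    using N(2) by (intro complete[of _ N]) auto
  ultimately show "f -` B \<inter> space M \<in> sets M"
    using measurable_sets[OF g B] N(2) by (metis sets.Diff sets.Un null_setsD2)
qed simp

lemma (in complete_measure) borel_measurable_AE_LIMSEQ:
  fixes f :: "'a \<Rightarrow> 'b::metric_space"
  assumes s: "\<And>i. s i \<in> borel_measurable M" and lim: "AE \<omega> in M. (\<lambda>i. s i \<omega>) \<longlonglongrightarrow> f \<omega>"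
  shows "f \<in> borel_measurable M"
proof -
  obtain N where N: "\<And>\<omega>. \<omega> \<in> space M - N \<Longrightarrow> (\<lambda>i. s i \<omega>) \<longlonglongrightarrow> f \<omega>" "N \<in> null_sets M"
    using AE_E3[OF lim] by blast
  \<comment> \<open>On \<open>N\<close> all functions get the same constant value, so that
    convergence holds at every point.\<close>
  define g where "g \<omega> = (if \<omega> \<in> N then undefined else f \<omega>)" for \<omega>
  have "g \<in> borel_measurable M"
  proof (rule borel_measurable_LIMSEQ_metric)
    show "(\<lambda>\<omega>. if \<omega> \<in> N then undefined else s i \<omega>) \<in> borel_measurable M" for i
      using N(2) by (intro measurable_If_set s) auto
    show "(\<lambda>i. if \<omega> \<in> N then undefined else s i \<omega>) \<longlonglongrightarrow> g \<omega>" if "\<omega> \<in> space M" for \<omega>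
      using N(1)[of \<omega>] that by (simp add: g_def)
  qed
  moreover have "AE \<omega> in M. f \<omega> = g \<omega>"
    using AE_not_in[OF N(2)] by eventually_elim (simp add: g_def)
  ultimately show ?thesis by (rule borel_measurable_AE_eq)
qed

lemma bochner_measurable_borel:
  assumes "complete_measure M" "bochner_measurable M f"
  shows "f \<in> borel_measurable M"
  using assms complete_measure.borel_measurable_AE_LIMSEQ borel_measurable_simple_function
  unfolding bochner_measurable_def by blast

lemma bochner_measurable_compose:
  assumes g: "continuous_on UNIV g" and f: "bochner_measurable M f"
  shows "bochner_measurable M (\<lambda>\<omega>. g (f \<omega>))"
proof -
  obtain s where s: "\<And>i. simple_function M (s i)" "AE \<omega> in M. (\<lambda>i. s i \<omega>) \<longlonglongrightarrow> f \<omega>"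
    using f unfolding bochner_measurable_def by blast
  have "AE \<omega> in M. (\<lambda>i. g (s i \<omega>)) \<longlonglongrightarrow> g (f \<omega>)"
    using s(2) by eventually_elim (rule continuous_on_tendsto_compose[OF g], auto)
  then show ?thesis
    unfolding bochner_measurable_def using simple_function_compose1[OF s(1), of g]
    by (intro exI[of _ "\<lambda>i \<omega>. g (s i \<omega>)"]) auto
qed

lemma bochner_measurable_borel_real:
  assumes "f \<in> borel_measurable M"
  shows "bochner_measurable M (f :: _ \<Rightarrow> real)"
  using borel_measurable_implies_sequence_metric[OF assms, of 0]
  unfolding bochner_measurable_def by blast

text \<open>Without separability a difference of two Borel maps may fail to be Borel. Here one of
  them takes finitely many values, and for each value only a continuous function of \<open>f\<close>
  remains.\<close>

lemma borel_measurable_norm_diff_simple: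
  fixes f :: "'w \<Rightarrow> 'b::real_normed_vector"
  assumes f: "f \<in> borel_measurable M" and s: "simple_function M s"
  shows "(\<lambda>\<omega>. norm (f \<omega> - s \<omega>)) \<in> borel_measurable M"
proof (rule measurable_compose_countable'[where f="\<lambda>c \<omega>. norm (f \<omega> - c)" and I="s ` space M"])
  show "(\<lambda>\<omega>. norm (f \<omega> - c)) \<in> borel_measurable M" for c
    by (rule measurable_compose[OF f]) (intro borel_measurable_continuous_onI continuous_intros)
  show "s \<in> measurable M (count_space (s ` space M))"
    using measurable_simple_function[OF s] by (auto simp: measurable_def)
  show "countable (s ` space M)" using simple_functionD(1)[OF s] by (rule countable_finite)
qed

lemma has_bochner_int_bounded:
  fixes f :: "'w \<Rightarrow> 'b::banach"
  assumes "finite_measure M" "complete_measure M" and f: "bochner_measurable M f"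
    and bound: "AE \<omega> in M. norm (f \<omega>) \<le> C"
  shows "has_bochner_int M f (bochner_integral M f)"
proof -
  interpret finite_measure M by fact
  have fm: "f \<in> borel_measurable M" using assms(2) f by (rule bochner_measurable_borel)
  obtain s where s: "\<And>i. simple_function M (s i)" and lim: "AE \<omega> in M. (\<lambda>i. s i \<omega>) \<longlonglongrightarrow> f \<omega>"
    using f unfolding bochner_measurable_def by blast
  \<comment> \<open>Truncation supplies a dominating constant. The level \<open>C + 1\<close> lies
    strictly above the norm of the limit, so almost surely the truncation is eventually
    inactive.\<close>
  define t where "t i \<omega> = (if norm (s i \<omega>) \<le> C + 1 then s i \<omega> else 0)" for i \<omega>
  have t: "simple_function M (t i)" for i
    unfolding t_def by (rule simple_function_compose1[OF s, of "\<lambda>v. if norm v \<le> C + 1 then v else 0"])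
  have ti: "Bochner_Integration.simple_bochner_integrable M (t i)" for i
    by (intro simple_bochner_integrable.intros t) (auto simp: emeasure_eq_measure)
  have tb: "norm (t i \<omega>) \<le> \<bar>C\<bar> + 1" for i \<omega> by (auto simp: t_def)
  have tlim: "AE \<omega> in M. (\<lambda>i. t i \<omega>) \<longlonglongrightarrow> f \<omega>"
    using lim bound
  proof eventually_elim
    case (elim \<omega>)
    have "\<forall>\<^sub>F i in sequentially. norm (s i \<omega>) < C + 1"
      using elim by (intro order_tendstoD(2)[OF tendsto_norm[OF elim(1)]]) auto
    then have "\<forall>\<^sub>F i in sequentially. s i \<omega> = t i \<omega>"
      by eventually_elim (simp add: t_def)
    from Lim_transform_eventually[OF elim(1) this] show ?case .
  qed
  define U where "U i = (\<integral>\<^sup>+ \<omega>. ennreal (norm (f \<omega> - t i \<omega>)) \<partial>M)" for i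
  have U: "U \<longlonglongrightarrow> 0"
  proof -
    have "(\<lambda>i. \<integral>\<^sup>+ \<omega>. ennreal (norm (f \<omega> - t i \<omega>)) \<partial>M) \<longlonglongrightarrow> (\<integral>\<^sup>+ \<omega>. 0 \<partial>M)"
    proof (rule nn_integral_dominated_convergence[where w="\<lambda>_. ennreal (C + (\<bar>C\<bar> + 1))"])
      show "AE \<omega> in M. ennreal (norm (f \<omega> - t j \<omega>)) \<le> ennreal (C + (\<bar>C\<bar> + 1))" for j
        using bound
        by eventually_elim (auto intro!: ennreal_leI order_trans[OF norm_triangle_ineq4] add_mono tb)
      show "(\<integral>\<^sup>+ \<omega>. ennreal (C + (\<bar>C\<bar> + 1)) \<partial>M) < \<infinity>"
        by (simp add: emeasure_eq_measure ennreal_mult_less_top)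
      show "AE \<omega> in M. (\<lambda>i. ennreal (norm (f \<omega> - t i \<omega>))) \<longlonglongrightarrow> 0"
        using tlim
      proof eventually_elim
        case (elim \<omega>)
        have "(\<lambda>i. ennreal (norm (f \<omega> - t i \<omega>))) \<longlonglongrightarrow> ennreal (norm (f \<omega> - f \<omega>))"
          by (intro tendsto_ennrealI tendsto_intros elim)
        then show ?case by simp
      qed
    qed (use borel_measurable_norm_diff_simple[OF fm t] in auto)
    then show ?thesis by (simp add: U_def[abs_def])
  qed
  let ?I = "\<lambda>i. Bochner_Integration.simple_bochner_integral M (t i)"
  \<comment> \<open>Comparison through \<open>f\<close> makes the integrals of the simple functions
    a Cauchy sequence; completeness of the codomain then yields the integral.\<close>
  have bd: "ennreal (norm (?I i - ?I j)) \<le> U i + U j" for i j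
  proof -
    have "ennreal (norm (?I i - ?I j))
        = norm (Bochner_Integration.simple_bochner_integral M (\<lambda>\<omega>. t i \<omega> - t j \<omega>))"
      using ti by (subst simple_bochner_integral_diff) auto
    also have "\<dots> \<le> Bochner_Integration.simple_bochner_integral M (\<lambda>\<omega>. norm (t i \<omega> - t j \<omega>))"
      using simple_bochner_integrable_compose2[of "(-)" M "t i" "t j"] ti
      by (auto intro!: simple_bochner_integral_norm_bound)
    also have "\<dots> = (\<integral>\<^sup>+\<omega>. norm (t i \<omega> - t j \<omega>) \<partial>M)"
      using simple_bochner_integrable_compose2[of "\<lambda>x y. norm (x - y)" M "t i" "t j"] ti
      by (auto intro!: simple_bochner_integral_eq_nn_integral)
    also have "\<dots> \<le> (\<integral>\<^sup>+\<omega>. ennreal (norm (f \<omega> - t i \<omega>)) + ennreal (norm (f \<omega> - t j \<omega>)) \<partial>M)"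
    proof (rule nn_integral_mono)
      fix \<omega>
      have "norm (t i \<omega> - t j \<omega>) \<le> norm (f \<omega> - t i \<omega>) + norm (f \<omega> - t j \<omega>)"
        using norm_triangle_ineq4[of "f \<omega> - t j \<omega>" "f \<omega> - t i \<omega>"] by simp
      then show "ennreal (norm (t i \<omega> - t j \<omega>))
          \<le> ennreal (norm (f \<omega> - t i \<omega>)) + ennreal (norm (f \<omega> - t j \<omega>))"
        by (simp flip: ennreal_plus)
    qed
    also have "\<dots> = U i + U j"
      unfolding U_def using borel_measurable_norm_diff_simple[OF fm t] by (intro nn_integral_add) auto
    finally show ?thesis .
  qed
  have "Cauchy ?I"
  proof (rule metric_CauchyI)
    fix e :: real assume e: "0 < e"
    have "\<forall>\<^sub>F i in sequentially. U i < ennreal (e / 2)"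
      using e by (intro order_tendstoD(2)[OF U]) (simp add: ennreal_zero_less_divide)
    then obtain n where n: "\<And>i. n \<le> i \<Longrightarrow> U i < ennreal (e / 2)"
      unfolding eventually_sequentially by blast
    have "dist (?I i) (?I j) < e" if ij: "n \<le> i" "n \<le> j" for i j
    proof -
      have "ennreal (norm (?I i - ?I j)) < ennreal (e / 2) + ennreal (e / 2)"
        using bd[of i j] by (rule le_less_trans) (intro add_strict_mono n ij)
      also have "\<dots> = ennreal e" using e by (simp flip: ennreal_plus)
      finally show ?thesis using e by (simp add: dist_norm ennreal_less_iff)
    qed
    then show "\<exists>n. \<forall>i\<ge>n. \<forall>j\<ge>n. dist (?I i) (?I j) < e" by blast
  qed
  then obtain I where "?I \<longlonglongrightarrow> I" using Cauchy_convergent_iff convergent_def by blast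
  then have "has_bochner_int M f I"
    unfolding has_bochner_int_def using fm ti U by (auto simp: U_def[abs_def])
  then show ?thesis by (simp add: bochner_integral_eqI)
qed

text \<open>Reduces computations with operator-valued integrals to real ones. It is applied to the
  mean, to the covariance and to the integral over \<open>s\<close>.\<close>

lemma has_bochner_integral_functional:
  fixes T :: "'b::real_normed_vector \<Rightarrow> real"
  assumes T: "bounded_linear T" and f: "has_bochner_int M f I"
  shows "has_bochner_integral M (\<lambda>\<omega>. T (f \<omega>)) (T I)"
proof -
  interpret T: bounded_linear T by fact
  obtain K where K: "0 < K" "\<And>x. norm (T x) \<le> norm x * K" using T.pos_bounded by blast
  from f obtain s where fm: "f \<in> borel_measurable M"
    and s: "\<And>i. Bochner_Integration.simple_bochner_integrable M (s i)"
    and S: "(\<lambda>i. \<integral>\<^sup>+ \<omega>. ennreal (norm (f \<omega> - s i \<omega>)) \<partial>M) \<longlonglongrightarrow> 0"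
    and I: "(\<lambda>i. Bochner_Integration.simple_bochner_integral M (s i)) \<longlonglongrightarrow> I"
    unfolding has_bochner_int_def by blast
  show ?thesis
  proof (rule has_bochner_integral.intros[where s="\<lambda>i \<omega>. T (s i \<omega>)"])
    show "(\<lambda>\<omega>. T (f \<omega>)) \<in> borel_measurable M"
      by (rule measurable_compose[OF fm])
        (intro borel_measurable_continuous_onI T.continuous_on continuous_on_id)
    show "Bochner_Integration.simple_bochner_integrable M (\<lambda>\<omega>. T (s i \<omega>))" for i
      by (rule simple_bochner_integrable_compose2[of "\<lambda>x y. T x", OF _ s s]) (simp add: T.zero)
    show "(\<lambda>i. Bochner_Integration.simple_bochner_integral M (\<lambda>\<omega>. T (s i \<omega>))) \<longlonglongrightarrow> T I"
      unfolding simple_bochner_integral_linear[OF T.linear_axioms s] by (intro T.tendsto I)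
    show "(\<lambda>i. \<integral>\<^sup>+ \<omega>. ennreal (norm (T (f \<omega>) - T (s i \<omega>))) \<partial>M) \<longlonglongrightarrow> 0"
    proof (rule tendsto_sandwich[where f="\<lambda>_. 0"])
      have "(\<integral>\<^sup>+ \<omega>. ennreal (norm (T (f \<omega>) - T (s i \<omega>))) \<partial>M)
          \<le> ennreal K * (\<integral>\<^sup>+ \<omega>. ennreal (norm (f \<omega> - s i \<omega>)) \<partial>M)" for i
      proof -
        have "(\<integral>\<^sup>+ \<omega>. ennreal (norm (T (f \<omega>) - T (s i \<omega>))) \<partial>M)
            \<le> (\<integral>\<^sup>+ \<omega>. ennreal K * ennreal (norm (f \<omega> - s i \<omega>)) \<partial>M)"
          using K by (intro nn_integral_mono) (auto simp: mult.commute simp flip: ennreal_mult T.diff)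
        also have "\<dots> = ennreal K * (\<integral>\<^sup>+ \<omega>. ennreal (norm (f \<omega> - s i \<omega>)) \<partial>M)"
          using s by (intro nn_integral_cmult measurable_compose[OF borel_measurable_norm_diff_simple[OF fm]])
            (auto elim: simple_bochner_integrable.cases)
        finally show ?thesis .
      qed
      then show "\<forall>\<^sub>F i in sequentially. (\<integral>\<^sup>+ \<omega>. ennreal (norm (T (f \<omega>) - T (s i \<omega>))) \<partial>M)
          \<le> ennreal K * (\<integral>\<^sup>+ \<omega>. ennreal (norm (f \<omega> - s i \<omega>)) \<partial>M)"
        by simp
      show "(\<lambda>i. ennreal K * (\<integral>\<^sup>+ \<omega>. ennreal (norm (f \<omega> - s i \<omega>)) \<partial>M)) \<longlonglongrightarrow> 0"
        using ennreal_tendsto_cmult[OF _ S, of "ennreal K"] by simp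
    qed auto
  qed
qed

text \<open>Opens \<open>has_bochner_int_bounded\<close> to the integral over \<open>s\<close> that
  defines the covariance of the limit.\<close>

lemma complete_measure_lebesgue_on:
  assumes "S \<in> sets lebesgue"
  shows "complete_measure (lebesgue_on S)"
proof
  fix A B assume "B \<subseteq> A" "A \<in> null_sets (lebesgue_on S)"
  then have A: "A \<subseteq> S" "A \<in> null_sets lebesgue" by (auto simp: null_sets_restrict_space[OF assms])
  then have "B \<in> sets lebesgue" using \<open>B \<subseteq> A\<close> completion.complete by blast
  then show "B \<in> sets (lebesgue_on S)"
    using A \<open>B \<subseteq> A\<close> assms by (auto simp: sets_restrict_space)
qed

section \<open>Norm and continuity of tensor products of operators\<close>

lemma tensor_op_alg_of_list:
  "(B \<otimes>\<^sub>o\<^sub>p C) (to_completion (alg_of_list ps))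
    = to_completion (alg_of_list (map (\<lambda>(x, y). (B x, C y)) ps))"
proof (induction ps)
  case Nil
  show ?case by (simp add: alg_of_list_def linear_0[OF linear_to_completion])
next
  case (Cons p ps)
  obtain x y where p: "p = (x, y)" by force
  have *: "to_completion (alg_of_list ((x, y) # qs)) = x \<otimes>\<^sub>H y + to_completion (alg_of_list qs)"
    for x :: 'a and y :: 'b and qs
    by (simp add: alg_of_list_def tensor_def linear_add[OF linear_to_completion])
  show ?case using Cons.IH by (simp add: p * blinfun.add_right)
qed

text \<open>On the image of the algebraic tensor product this is
  \<open>norm_alg_of_list_map\<close>. The set where the inequality holds is closed and that image
  is dense.\<close>

lemma norm_tensor_op_le: "norm (B \<otimes>\<^sub>o\<^sub>p C) \<le> norm B * norm C"
proof (rule norm_blinfun_bound)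
  fix w
  have "closed {w. norm ((B \<otimes>\<^sub>o\<^sub>p C) w) \<le> norm B * norm C * norm w}"
    by (intro closed_Collect_le continuous_intros)
  moreover have "range to_completion \<subseteq> {w. norm ((B \<otimes>\<^sub>o\<^sub>p C) w) \<le> norm B * norm C * norm w}"
  proof (clarsimp)
    fix f :: "('a, 'b) alg_tensor"
    obtain ps where "f = alg_of_list ps" using alg_of_list_surj by metis
    then show "norm ((B \<otimes>\<^sub>o\<^sub>p C) (to_completion f)) \<le> norm B * norm C * norm f"
      using norm_alg_of_list_map[of B C ps] by (simp add: tensor_op_alg_of_list)
  qed
  ultimately have "closure (range to_completion) \<subseteq> {w. norm ((B \<otimes>\<^sub>o\<^sub>p C) w) \<le> norm B * norm C * norm w}"
    by (intro closure_minimal)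
  then show "norm ((B \<otimes>\<^sub>o\<^sub>p C) w) \<le> norm B * norm C * norm w"
    by (auto simp: closure_range_to_completion)
qed simp

text \<open>Bilinearity is checked on elementary tensors, which determine a bounded operator. The
  purpose is norm continuity of \<open>tensor_op_sq\<close>, hence Bochner measurability of both
  integrands in the covariance.\<close>

lemma bounded_bilinear_tensor_op: "bounded_bilinear (\<otimes>\<^sub>o\<^sub>p)"
proof
  show "\<exists>K. \<forall>B C. norm (B \<otimes>\<^sub>o\<^sub>p C) \<le> norm B * norm C * K"
    by (intro exI[of _ 1]) (simp add: norm_tensor_op_le)
qed (auto intro!: blinfun_eq_on_tensor simp: blinfun.add_left blinfun.scaleR_left
    bilinear_ladd[OF bilinear_tensor] bilinear_radd[OF bilinear_tensor]
    bilinear_lmul[OF bilinear_tensor] bilinear_rmul[OF bilinear_tensor])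

subsection \<open>Sequences of independent Banach space valued variables\<close>

text \<open>A closest point to \<open>x\<close> among \<open>d 0\<close> to \<open>d m\<close>; the
  strict inequality gives ties to the earliest index.\<close>

primrec nearest :: "(nat \<Rightarrow> 'b::metric_space) \<Rightarrow> nat \<Rightarrow> 'b \<Rightarrow> 'b" where
  "nearest d 0 x = d 0"
| "nearest d (Suc m) x =
    (if dist x (d (Suc m)) < dist x (nearest d m x) then d (Suc m) else nearest d m x)"

lemma dist_nearest_le: "l \<le> m \<Longrightarrow> dist x (nearest d m x) \<le> dist x (d l)"
proof (induction m)
  case (Suc m)
  then show ?case by (cases "l = Suc m") auto
qed simp

lemma nearest_tendsto:
  assumes "x \<in> closure (range d)"
  shows "(\<lambda>m. nearest d m x) \<longlonglongrightarrow> x"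
proof (rule tendstoI)
  fix e :: real assume "0 < e"
  then obtain l where l: "dist (d l) x < e"
    using assms by (force simp: closure_approachable)
  have "dist (nearest d m x) x < e" if "l \<le> m" for m
    using dist_nearest_le[OF that, of x d] l by (simp add: dist_commute)
  then show "\<forall>\<^sub>F m in sequentially. dist (nearest d m x) x < e"
    by (auto intro: eventually_sequentiallyI)
qed

text \<open>Each recursion step tests an inequality between two distances. The distance to
  \<open>nearest d m x\<close> is measurable because that map is simple by induction.\<close>

lemma simple_function_nearest:
  fixes d :: "nat \<Rightarrow> 'b::real_normed_vector"
  shows "simple_function borel (nearest d m)"
proof (induction m)
  case (Suc m)
  have [measurable]: "(\<lambda>x. dist x (nearest d m x)) \<in> borel_measurable borel"
    unfolding dist_norm by (intro borel_measurable_norm_diff_simple Suc) simp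
  have [measurable]: "(\<lambda>x. dist x (d (Suc m))) \<in> borel_measurable borel"
    unfolding dist_norm by (intro borel_measurable_norm_diff_simple) simp_all
  have "{x \<in> space borel. dist x (d (Suc m)) < dist x (nearest d m x)} \<in> sets borel"
    by measurable
  then show ?case unfolding nearest.simps by (intro simple_function_If Suc) auto
qed simp

lemma tendsto_fun_componentwise:
  fixes f :: "nat \<Rightarrow> 'i \<Rightarrow> 'b::topological_space"
  assumes "\<And>i. (\<lambda>m. f m i) \<longlonglongrightarrow> l i"
  shows "f \<longlonglongrightarrow> l"
proof -
  have "limitin (product_topology (\<lambda>i. euclidean) UNIV) f l sequentially"
    unfolding limitin_componentwise using assms by auto
  then show ?thesis by (simp add: euclidean_product_topology)
qed

lemma simple_function_finite_update:
  assumes "finite I" "\<And>i. i \<in> I \<Longrightarrow> simple_function M (f i)"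
  shows "simple_function M (\<lambda>\<omega> i. if i \<in> I then f i \<omega> else c)"
  using assms
proof (induction I)
  case (insert j I)
  have "(\<lambda>\<omega> i. if i \<in> insert j I then f i \<omega> else c)
    = (\<lambda>\<omega>. (\<lambda>i. if i \<in> I then f i \<omega> else c)(j := f j \<omega>))"
    by (auto simp: fun_eq_iff)
  moreover have "simple_function M (\<lambda>\<omega>. (\<lambda>i. if i \<in> I then f i \<omega> else c)(j := f j \<omega>))"
    using insert by (intro simple_function_compose2[where h="\<lambda>g v. g(j := v)"]) auto
  ultimately show ?case by simp
qed simp

text \<open>Index 0 is the reference variable, the indices from 1 on will be the factors of the
  product. The norm bound is pointwise for index 0 and reaches the others almost surely through the
  common law.\<close>

locale iid_bochner = prob_space M + complete_measure M for M :: "'w measure" +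
  fixes X :: "nat \<Rightarrow> 'w \<Rightarrow> 'b::banach" and r :: real
  assumes bochner_measurable: "bochner_measurable M (X i)"
    and indep: "indep_vars (\<lambda>_. borel) X UNIV"
    and ident: "distr M borel (X i) = distr M borel (X 0)"
    and norm_X0: "\<omega> \<in> space M \<Longrightarrow> norm (X 0 \<omega>) \<le> r"
begin

definition mean :: 'b where "mean = bochner_integral M (X 0)"

lemma measurable_X [measurable]: "X i \<in> borel_measurable M"
  using complete_measure_axioms bochner_measurable by (rule bochner_measurable_borel)

text \<open>Whether a variable lies almost surely in a Borel set depends on its law only, and
  countably many null sets can be joined. Both the norm bound and the separable support are
  transferred in this way.\<close>

lemma AE_ident:
  assumes "closed S" "AE \<omega> in M. X 0 \<omega> \<in> S"
  shows "AE \<omega> in M. \<forall>i. X i \<omega> \<in> S"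
proof -
  have S: "{x \<in> space borel. x \<in> S} \<in> sets borel" using assms(1) by simp
  have "AE \<omega> in M. X i \<omega> \<in> S" for i
    using AE_distr_iff[OF measurable_X S, of i, unfolded ident[of i]]
      AE_distr_iff[OF measurable_X S, of 0] assms(2) by blast
  then show ?thesis by (simp add: AE_all_countable)
qed

lemma AE_norm_X: "AE \<omega> in M. \<forall>i. norm (X i \<omega>) \<le> r"
  using AE_ident[of "cball 0 r"] norm_X0 by simp

lemma r_nonneg: "0 \<le> r"
  using not_empty norm_X0 by (meson all_not_in_conv norm_ge_zero order_trans)

lemma has_bochner_int_X0: "has_bochner_int M (X 0) mean"
  unfolding mean_def using norm_X0
  by (intro has_bochner_int_bounded[where C=r] finite_measure_axioms complete_measure_axioms
      bochner_measurable) auto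

text \<open>\<open>mean\<close> is an integral of \<open>X 0\<close>. Composing with a functional
  turns it into a real integral, which equality of laws moves to any index.\<close>

lemma
  fixes T :: "'b \<Rightarrow> real"
  assumes T: "bounded_linear T"
  shows integrable_functional: "integrable M (\<lambda>\<omega>. T (X k \<omega>))"
    and expectation_functional: "expectation (\<lambda>\<omega>. T (X k \<omega>)) = T mean"
proof -
  have Tm: "T \<in> borel_measurable borel"
    by (intro borel_measurable_continuous_onI linear_continuous_on T)
  have *: "has_bochner_integral M (\<lambda>\<omega>. T (X 0 \<omega>)) (T mean)"
    using T has_bochner_int_X0 by (rule has_bochner_integral_functional)
  show "integrable M (\<lambda>\<omega>. T (X k \<omega>))"
    using integrable_distr_eq[OF measurable_X Tm, of k, unfolded ident[of k]]
      integrable_distr_eq[OF measurable_X Tm, of 0] integrable.intros[OF *] by blast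
  show "expectation (\<lambda>\<omega>. T (X k \<omega>)) = T mean"
    using integral_distr[OF measurable_X Tm, of k, unfolded ident[of k]]
      integral_distr[OF measurable_X Tm, of 0] has_bochner_integral_integral_eq[OF *] by simp
qed

text \<open>Bochner measurability makes the common law live on a separable set, where rounding to the
  nearest point of a dense sequence approximates all \<open>X i\<close> by the same functions.\<close>

lemma discretisation:
  obtains \<phi> :: "nat \<Rightarrow> 'b \<Rightarrow> 'b" where
    "\<And>m. simple_function borel (\<phi> m)" "\<And>m x. norm (\<phi> m x) \<le> 2 * norm x"
    "AE \<omega> in M. \<forall>i. (\<lambda>m. \<phi> m (X i \<omega>)) \<longlonglongrightarrow> X i \<omega>"
proof -
  obtain s where s: "\<And>i. simple_function M (s i)" and lim: "AE \<omega> in M. (\<lambda>i. s i \<omega>) \<longlonglongrightarrow> X 0 \<omega>"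
    using bochner_measurable[of 0] unfolding bochner_measurable_def by blast
  define D where "D = insert 0 (\<Union>i. s i ` space M)"
  have D: "countable D"
    unfolding D_def using simple_functionD(1)[OF s]
    by (intro countable_insert countable_UN) (auto intro: countable_finite)
  \<comment> \<open>The point 0 comes first on purpose: since it always competes, \<open>x\<close>
    moves by at most \<open>norm x\<close> under rounding, which gives the bound
    \<open>2 * norm x\<close>.\<close>
  define d where "d m = (case m of 0 \<Rightarrow> 0 | Suc j \<Rightarrow> from_nat_into D j)" for m
  have d: "D \<subseteq> range d"
  proof
    fix x assume "x \<in> D"
    then have "x = d (Suc (to_nat_on D x))" by (simp add: d_def D)
    then show "x \<in> range d" by blast
  qed
  have "AE \<omega> in M. X 0 \<omega> \<in> closure (range d)"
    using lim AE_space
  proof eventually_elim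
    case (elim \<omega>)
    then have "s i \<omega> \<in> range d" for i using d by (auto simp: D_def)
    with elim(1) show ?case unfolding closure_sequential by (intro exI[of _ "\<lambda>i. s i \<omega>"]) auto
  qed
  then have "AE \<omega> in M. \<forall>i. X i \<omega> \<in> closure (range d)" by (rule AE_ident[OF closed_closure])
  then have "AE \<omega> in M. \<forall>i. (\<lambda>m. nearest d m (X i \<omega>)) \<longlonglongrightarrow> X i \<omega>"
    by eventually_elim (simp add: nearest_tendsto)
  moreover have "norm (nearest d m x) \<le> 2 * norm x" for m x
  proof -
    have "dist x (nearest d m x) \<le> norm x"
      using dist_nearest_le[of 0 m x d] by (simp add: d_def)
    then show ?thesis
      using norm_triangle_ineq2[of "nearest d m x" x] by (simp add: dist_norm norm_minus_commute)
  qed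
  ultimately show ?thesis using simple_function_nearest[of d] by (intro that) auto
qed

text \<open>Measurability of the coordinates does not directly make the sequence Borel in the
  product topology. For rounded, finitely supported sequences the composition with \<open>F\<close>
  is simple, and completeness admits the almost sure limit.\<close>

lemma borel_measurable_continuous_sequence:
  fixes F :: "(nat \<Rightarrow> 'b) \<Rightarrow> 'c::metric_space"
  assumes F: "continuous_on UNIV F"
  shows "(\<lambda>\<omega>. F (\<lambda>i. X i \<omega>)) \<in> borel_measurable M"
proof -
  obtain \<phi> where \<phi>: "\<And>m. simple_function borel (\<phi> m :: 'b \<Rightarrow> 'b)" "\<And>m x. norm (\<phi> m x) \<le> 2 * norm x"
    and lim: "AE \<omega> in M. \<forall>i. (\<lambda>m. \<phi> m (X i \<omega>)) \<longlonglongrightarrow> X i \<omega>"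
    using discretisation by blast
  \<comment> \<open>The cut-off at \<open>m\<close> leaves finitely many possible sequences;
    coordinate \<open>i\<close> is affected only for \<open>m < i\<close>.\<close>
  define a where "a m \<omega> = (\<lambda>i. if i \<in> {..m} then \<phi> m (X i \<omega>) else 0)" for m \<omega>
  have "simple_function M (a m)" for m
    unfolding a_def by (intro simple_function_finite_update simple_function_comp[OF measurable_X \<phi>(1)]) simp
  then have "(\<lambda>\<omega>. F (a m \<omega>)) \<in> borel_measurable M" for m
    by (intro borel_measurable_simple_function simple_function_compose1[of _ "a m" F])
  moreover have "AE \<omega> in M. (\<lambda>m. F (a m \<omega>)) \<longlonglongrightarrow> F (\<lambda>i. X i \<omega>)"
    using lim
  proof eventually_elim
    case (elim \<omega>)
    have "(\<lambda>m. a m \<omega>) \<longlonglongrightarrow> (\<lambda>i. X i \<omega>)"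
    proof (rule tendsto_fun_componentwise)
      fix i
      have "\<forall>\<^sub>F m in sequentially. \<phi> m (X i \<omega>) = a m \<omega> i"
        using eventually_ge_at_top[of i] by eventually_elim (simp add: a_def)
      then show "(\<lambda>m. a m \<omega> i) \<longlonglongrightarrow> X i \<omega>"
        using elim by (blast intro: Lim_transform_eventually)
    qed
    then show ?case using F by (intro continuous_on_tendsto_compose[OF F]) auto
  qed
  ultimately show ?thesis by (rule borel_measurable_AE_LIMSEQ)
qed

lemma integrable_continuous_sequence:
  fixes F :: "(nat \<Rightarrow> 'b) \<Rightarrow> real"
  assumes F: "continuous_on UNIV F" and bound: "\<And>a. (\<And>i. norm (a i) \<le> r) \<Longrightarrow> \<bar>F a\<bar> \<le> C"
  shows "integrable M (\<lambda>\<omega>. F (\<lambda>i. X i \<omega>))"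
proof (rule integrable_const_bound)
  show "AE \<omega> in M. norm (F (\<lambda>i. X i \<omega>)) \<le> C"
    using AE_norm_X by eventually_elim (simp add: bound)
qed (rule borel_measurable_continuous_sequence[OF F])

text \<open>The rounded sequence takes finitely many values \<open>v\<close>, and where it equals
  \<open>v\<close> the functional \<open>H v\<close> is fixed. The expectation is thus a sum over
  \<open>v\<close> of expectations of products of functions of single, distinct coordinates; each
  product factors, and the factor of \<open>X k\<close> has mean 0.\<close>

lemma expectation_independent_simple:
  fixes H :: "(nat \<Rightarrow> 'b) \<Rightarrow> 'b \<Rightarrow> real" and \<phi> :: "'b \<Rightarrow> 'b"
  assumes \<phi>: "simple_function borel \<phi>" and H: "\<And>a. bounded_linear (H a)"
    and I: "finite I" "k \<notin> I"
  shows "expectation (\<lambda>\<omega>. H (\<lambda>i. if i \<in> I then \<phi> (X i \<omega>) else 0) (X k \<omega> - mean)) = 0"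
proof -
  define a where "a \<omega> = (\<lambda>i. if i \<in> I then \<phi> (X i \<omega>) else 0)" for \<omega>
  have a: "simple_function M a"
    unfolding a_def by (intro simple_function_finite_update I simple_function_comp[OF measurable_X \<phi>])
  \<comment> \<open>For \<open>i = k\<close> the functional itself, for the other indices the
    indicator of rounding to \<open>v i\<close>.\<close>
  define Y where "Y v i x = (if i = k then H v (x - mean) else indicator {x. \<phi> x = v i} x)" for v i x
  have Hm: "H v \<in> borel_measurable borel" for v
    by (intro borel_measurable_continuous_onI linear_continuous_on H)
  have Ym: "Y v i \<in> borel_measurable borel" for v i
  proof (cases "i = k")
    case True
    then have "Y v i = (\<lambda>x. H v (x - mean))" by (auto simp: Y_def)
    then show ?thesis
      by (auto intro!: borel_measurable_continuous_onI bounded_linear.continuous_on[OF H] continuous_intros)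
  next
    case False
    then have "Y v i = indicator (\<phi> -` {v i} \<inter> space borel)"
      by (auto simp: Y_def fun_eq_iff indicator_def)
    then show ?thesis using simple_functionD(2)[OF \<phi>, of "{v i}"] by simp
  qed
  have indepY: "indep_vars (\<lambda>_. borel) (\<lambda>i \<omega>. Y v i (X i \<omega>)) (insert k I)" for v
    using indep_vars_subset[OF indep subset_UNIV] by (rule indep_vars_compose2) (rule Ym)
  have Yk: "integrable M (\<lambda>\<omega>. Y v k (X k \<omega>))" "expectation (\<lambda>\<omega>. Y v k (X k \<omega>)) = 0" for v
  proof -
    interpret bounded_linear "H v" by (rule H)
    show "integrable M (\<lambda>\<omega>. Y v k (X k \<omega>))" "expectation (\<lambda>\<omega>. Y v k (X k \<omega>)) = 0"
      using integrable_functional[OF H, of v k] expectation_functional[OF H, of v k]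
      by (simp_all add: Y_def diff prob_space)
  qed
  have Yi: "integrable M (\<lambda>\<omega>. Y v i (X i \<omega>))" for v i
  proof (cases "i = k")
    case False
    then show ?thesis
      by (intro integrable_const_bound[of _ 1] measurable_compose[OF measurable_X Ym])
        (auto simp: Y_def indicator_def)
  qed (simp add: Yk)
  define P where "P v \<omega> = (\<Prod>i\<in>insert k I. Y v i (X i \<omega>))" for v \<omega>
  have P: "integrable M (P v)" "expectation (P v) = 0" for v
  proof -
    have fin: "finite (insert k I)" using I by simp
    show "integrable M (P v)"
      unfolding P_def by (rule indep_vars_integrable[OF fin indepY Yi])
    have "expectation (P v) = (\<Prod>i\<in>insert k I. expectation (\<lambda>\<omega>. Y v i (X i \<omega>)))"
      unfolding P_def by (rule indep_vars_lebesgue_integral[OF fin indepY Yi])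
    then show "expectation (P v) = 0" using I Yk(2)[of v] by simp
  qed
  have "H (a \<omega>) (X k \<omega> - mean) = (\<Sum>v\<in>a ` space M. P v \<omega>)" if \<omega>: "\<omega> \<in> space M" for \<omega>
  proof -
    have "P v \<omega> = (if v = a \<omega> then H (a \<omega>) (X k \<omega> - mean) else 0)" if v: "v \<in> a ` space M" for v
    proof (cases "v = a \<omega>")
      case True
      have "(\<Prod>i\<in>I. Y v i (X i \<omega>)) = 1"
        using I True by (intro prod.neutral) (auto simp: Y_def a_def)
      then show ?thesis using I True by (simp add: P_def) (simp add: Y_def)
    next
      case False
      then obtain i where i: "v i \<noteq> a \<omega> i" by auto
      \<comment> \<open>Outside \<open>I\<close> both sequences are 0, so one of the indicators sees
        the disagreement.\<close>
      then have "i \<in> I" using v by (auto simp: a_def split: if_splits)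
      moreover from this have "Y v i (X i \<omega>) = 0" using i I by (auto simp: Y_def a_def)
      ultimately show ?thesis using False I by (auto simp: P_def)
    qed
    then show ?thesis using \<omega> simple_functionD(1)[OF a] by simp
  qed
  then have "expectation (\<lambda>\<omega>. H (a \<omega>) (X k \<omega> - mean)) = expectation (\<lambda>\<omega>. \<Sum>v\<in>a ` space M. P v \<omega>)"
    by (intro Bochner_Integration.integral_cong) auto
  also have "\<dots> = 0" using P by (subst Bochner_Integration.integral_sum) auto
  finally show ?thesis by (simp add: a_def)
qed

text \<open>Passes from rounded to actual sequences by dominated convergence. Assumption
  \<open>k\<close> says that \<open>H\<close> does not look at coordinate \<open>k\<close>; the
  bound is required up to \<open>2 * r\<close> because rounding may double norms.\<close>

lemma expectation_independent_factor:
  fixes H :: "(nat \<Rightarrow> 'b) \<Rightarrow> 'b \<Rightarrow> real"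
  assumes cont: "\<And>c. continuous_on UNIV (\<lambda>a. H a c)" and lin: "\<And>a. bounded_linear (H a)"
    and k: "\<And>a c. H (a(k := 0)) c = H a c"
    and bound: "\<And>a c. (\<And>i. norm (a i) \<le> 2 * r) \<Longrightarrow> norm c \<le> r + norm mean \<Longrightarrow> \<bar>H a c\<bar> \<le> C"
  shows "expectation (\<lambda>\<omega>. H (\<lambda>i. X i \<omega>) (X k \<omega> - mean)) = 0"
proof -
  obtain \<phi> where \<phi>: "\<And>m. simple_function borel (\<phi> m :: 'b \<Rightarrow> 'b)" "\<And>m x. norm (\<phi> m x) \<le> 2 * norm x"
    and lim: "AE \<omega> in M. \<forall>i. (\<lambda>m. \<phi> m (X i \<omega>)) \<longlonglongrightarrow> X i \<omega>"
    using discretisation by blast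
  \<comment> \<open>Coordinate \<open>k\<close> is suppressed to stay independent of
    \<open>X k\<close>; the limit therefore carries 0 there, which \<open>H\<close> ignores.\<close>
  define a where "a m \<omega> = (\<lambda>i. if i \<in> {..m} - {k} then \<phi> m (X i \<omega>) else 0)" for m \<omega>
  have a: "simple_function M (a m)" for m
    unfolding a_def by (intro simple_function_finite_update simple_function_comp[OF measurable_X \<phi>(1)]) simp
  have meas: "(\<lambda>\<omega>. H (a m \<omega>) (X k \<omega> - mean)) \<in> borel_measurable M" for m
  proof (rule measurable_compose_countable'[where f="\<lambda>v \<omega>. H v (X k \<omega> - mean)" and I="a m ` space M"])
    show "(\<lambda>\<omega>. H v (X k \<omega> - mean)) \<in> borel_measurable M" for v
      by (rule measurable_compose[OF measurable_X])
        (intro borel_measurable_continuous_onI bounded_linear.continuous_on[OF lin] continuous_intros)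
    show "a m \<in> measurable M (count_space (a m ` space M))"
      using measurable_simple_function[OF a] by (auto simp: measurable_def)
    show "countable (a m ` space M)" using simple_functionD(1)[OF a] by (rule countable_finite)
  qed
  have lim': "AE \<omega> in M. (\<lambda>m. H (a m \<omega>) (X k \<omega> - mean)) \<longlonglongrightarrow> H (\<lambda>i. X i \<omega>) (X k \<omega> - mean)"
    using lim
  proof eventually_elim
    case (elim \<omega>)
    have "(\<lambda>m. a m \<omega>) \<longlonglongrightarrow> (\<lambda>i. X i \<omega>)(k := 0)"
    proof (rule tendsto_fun_componentwise)
      fix i
      show "(\<lambda>m. a m \<omega> i) \<longlonglongrightarrow> ((\<lambda>i. X i \<omega>)(k := 0)) i"
      proof (cases "i = k")
        case False
        have "\<forall>\<^sub>F m in sequentially. \<phi> m (X i \<omega>) = a m \<omega> i"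
          using eventually_ge_at_top[of i] by eventually_elim (simp add: a_def False)
        then have "(\<lambda>m. a m \<omega> i) \<longlonglongrightarrow> X i \<omega>"
          using elim by (blast intro: Lim_transform_eventually)
        then show ?thesis using False by simp
      qed (simp add: a_def)
    qed
    from continuous_on_tendsto_compose[OF cont this] show ?case by (simp add: k)
  qed
  have "(\<lambda>m. expectation (\<lambda>\<omega>. H (a m \<omega>) (X k \<omega> - mean)))
      \<longlonglongrightarrow> expectation (\<lambda>\<omega>. H (\<lambda>i. X i \<omega>) (X k \<omega> - mean))"
  proof (rule integral_dominated_convergence[where w="\<lambda>_. C"])
    show "AE \<omega> in M. norm (H (a m \<omega>) (X k \<omega> - mean)) \<le> C" for m
      using AE_norm_X
    proof eventually_elim
      case (elim \<omega>)
      have "norm (a m \<omega> i) \<le> 2 * r" for i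
        using \<phi>(2)[of m "X i \<omega>"] elim[rule_format, of i] r_nonneg by (auto simp: a_def)
      moreover have "norm (X k \<omega> - mean) \<le> r + norm mean"
        using elim by (intro order_trans[OF norm_triangle_ineq4] add_right_mono) auto
      ultimately show ?case by (simp add: bound)
    qed
    show "(\<lambda>\<omega>. H (\<lambda>i. X i \<omega>) (X k \<omega> - mean)) \<in> borel_measurable M"
      using meas lim' by (rule borel_measurable_AE_LIMSEQ)
  qed (use meas lim' in auto)
  moreover have "expectation (\<lambda>\<omega>. H (a m \<omega>) (X k \<omega> - mean)) = 0" for m
    unfolding a_def by (rule expectation_independent_simple[OF \<phi>(1) lin]) auto
  ultimately show ?thesis by (simp add: LIMSEQ_const_iff)
qed

end

subsection \<open>Characteristic functions and Riemann sums\<close>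

lemma normal_law_eq_distr:
  assumes "0 < v"
  shows "normal_law 0 v = distr std_normal_distribution borel (\<lambda>x. sqrt v * x)"
proof -
  interpret prob_space std_normal_distribution by (rule prob_space_normal_density) simp
  have "distributed std_normal_distribution lborel (\<lambda>x. x) (normal_density 0 1)"
    unfolding distributed_def by (simp add: distr_id2)
  from normal_density_affine[OF this, of "sqrt v" 0] assms
  have "distr std_normal_distribution lborel (\<lambda>x. sqrt v * x) = density lborel (normal_density 0 (sqrt v))"
    by (auto dest!: distributed_distr_eq_density)
  moreover have "distr std_normal_distribution borel (\<lambda>x. sqrt v * x)
      = distr std_normal_distribution lborel (\<lambda>x. sqrt v * x)"
    by (rule distr_cong) auto
  ultimately show ?thesis using assms by (simp add: normal_law_def)
qed

lemma real_distribution_normal_law: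
  assumes "0 \<le> v"
  shows "real_distribution (normal_law 0 v)"
proof (cases "v = 0")
  case True
  then show ?thesis
    by (auto simp: normal_law_def real_distribution_def real_distribution_axioms_def prob_space_return)
next
  case False
  interpret prob_space std_normal_distribution by (rule prob_space_normal_density) simp
  show ?thesis using False assms by (subst normal_law_eq_distr) auto
qed

lemma char_normal_law:
  assumes "0 \<le> v"
  shows "char (normal_law 0 v) t = of_real (exp (- (t\<^sup>2 * v / 2)))"
proof (cases "v = 0")
  case True
  then show ?thesis by (simp add: normal_law_def char_def integral_return)
next
  case False
  have "char (normal_law 0 v) t = char std_normal_distribution (t * sqrt v)"
    using False assms by (simp add: normal_law_eq_distr char_def integral_distr mult.assoc)
  then show ?thesis using assms by (simp add: char_std_normal_distribution power_mult_distrib)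
qed

lemma exp_minus_approx:
  fixes x :: real
  assumes "0 \<le> x"
  shows "\<bar>exp (- x) - (1 - x)\<bar> \<le> x\<^sup>2"
proof -
  have "1 - x \<le> exp (- x)" using exp_ge_add_one_self[of "- x"] by simp
  moreover have "exp (- x) \<le> 1 - x + x\<^sup>2"
  proof -
    have "exp (- x) * (1 + x) \<le> exp (- x) * exp x"
      by (intro mult_left_mono) (simp_all add: exp_ge_add_one_self)
    \<comment> \<open>The product on the right is \<open>1 + x ^ 3\<close>.\<close>
    also have "\<dots> \<le> (1 - x + x\<^sup>2) * (1 + x)"
      using assms by (simp add: algebra_simps power2_eq_square flip: exp_add)
    finally show ?thesis using assms by simp
  qed
  ultimately show ?thesis by simp
qed

text \<open>Both functions are compared with \<open>1 - t\<^sup>2 * ?s / 2\<close>: the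
  characteristic function with a third-order error, the Gaussian one by
  \<open>exp_minus_approx\<close>.\<close>

lemma (in prob_space) char_approx_bounded:
  fixes X :: "'a \<Rightarrow> real"
  assumes X: "random_variable borel X" and bound: "AE \<omega> in M. \<bar>X \<omega>\<bar> \<le> c" and mean: "expectation X = 0"
    and c: "0 \<le> c"
  shows "norm (char (distr M borel X) t - of_real (exp (- (t\<^sup>2 * expectation (\<lambda>\<omega>. (X \<omega>)\<^sup>2) / 2))))
    \<le> \<bar>t\<bar> ^ 3 * c ^ 3 / 6 + t ^ 4 * c ^ 4 / 4"
proof -
  let ?s = "expectation (\<lambda>\<omega>. (X \<omega>)\<^sup>2)"
  have iX: "integrable M X" using bound X by (intro integrable_const_bound[of _ c]) auto
  have sq: "AE \<omega> in M. (X \<omega>)\<^sup>2 \<le> c\<^sup>2"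
    using bound by eventually_elim (metis abs_ge_zero power2_abs power_mono)
  then have iX2: "integrable M (\<lambda>\<omega>. (X \<omega>)\<^sup>2)"
    using X by (intro integrable_const_bound[of _ "c\<^sup>2"]) auto
  have s: "0 \<le> ?s" "?s \<le> c\<^sup>2"
    using sq integral_mono_AE[OF iX2 integrable_const sq] by (auto simp: prob_space)
  have "norm (char (distr M borel X) t - (1 - t\<^sup>2 * ?s / 2))
      \<le> (t\<^sup>2 / 6) * expectation (\<lambda>\<omega>. min (6 * (X \<omega>)\<^sup>2) (\<bar>t\<bar> * \<bar>X \<omega>\<bar> ^ 3))"
    by (rule char_approx3'[OF X iX iX2 mean]) (simp_all add: mean)
  also have "\<dots> \<le> (t\<^sup>2 / 6) * (\<bar>t\<bar> * c ^ 3)"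
  proof (intro mult_left_mono)
    have *: "AE \<omega> in M. min (6 * (X \<omega>)\<^sup>2) (\<bar>t\<bar> * \<bar>X \<omega>\<bar> ^ 3) \<le> \<bar>t\<bar> * c ^ 3"
      using bound by eventually_elim (auto intro!: min.coboundedI2 mult_left_mono power_mono)
    have "AE \<omega> in M. norm (min (6 * (X \<omega>)\<^sup>2) (\<bar>t\<bar> * \<bar>X \<omega>\<bar> ^ 3)) \<le> \<bar>t\<bar> * c ^ 3"
      using * by eventually_elim simp
    then have "integrable M (\<lambda>\<omega>. min (6 * (X \<omega>)\<^sup>2) (\<bar>t\<bar> * \<bar>X \<omega>\<bar> ^ 3))"
      using X by (intro integrable_const_bound) auto
    from integral_mono_AE[OF this integrable_const *]
    show "expectation (\<lambda>\<omega>. min (6 * (X \<omega>)\<^sup>2) (\<bar>t\<bar> * \<bar>X \<omega>\<bar> ^ 3)) \<le> \<bar>t\<bar> * c ^ 3"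
      by (simp add: prob_space)
  qed simp
  also have "\<dots> = \<bar>t\<bar> ^ 3 * c ^ 3 / 6"
    by (simp add: power2_eq_square power3_eq_cube abs_mult_self_eq[symmetric, of t] del: abs_mult_self_eq)
  finally have 1: "norm (char (distr M borel X) t - (1 - t\<^sup>2 * ?s / 2)) \<le> \<bar>t\<bar> ^ 3 * c ^ 3 / 6" .
  have "norm (complex_of_real (exp (- (t\<^sup>2 * ?s / 2)) - (1 - t\<^sup>2 * ?s / 2))) \<le> (t\<^sup>2 * ?s / 2)\<^sup>2"
    unfolding norm_of_real using s by (intro exp_minus_approx) auto
  also have "\<dots> \<le> (t\<^sup>2 * c\<^sup>2 / 2)\<^sup>2"
    using s by (intro power_mono divide_right_mono mult_left_mono) auto
  also have "\<dots> = t ^ 4 * c ^ 4 / 4" by (simp add: power_mult_distrib power_divide flip: power_mult)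
  finally have 2: "norm (complex_of_real (exp (- (t\<^sup>2 * ?s / 2))) - (1 - t\<^sup>2 * ?s / 2)) \<le> t ^ 4 * c ^ 4 / 4"
    by simp
  show ?thesis
    using norm_triangle_le_diff[OF add_mono[OF 1 2]] by simp
qed

text \<open>Factors of norm at most 1 let the difference of products be bounded by the sum of the
  differences. With summands of size \<open>C / sqrt n\<close> each difference is of order
  \<open>n\<close> to the power -3/2, so the total is of order \<open>1 / sqrt n\<close>. The
  Gaussian factors multiply to one Gaussian factor with the total variance of the row.\<close>

lemma (in prob_space) char_bounded_array_tendsto:
  fixes X :: "nat \<Rightarrow> nat \<Rightarrow> 'a \<Rightarrow> real"
  assumes indep: "\<And>n. indep_vars (\<lambda>_. borel) (X n) {..<n}"
    and bound: "\<And>n k. k < n \<Longrightarrow> AE \<omega> in M. \<bar>X n k \<omega>\<bar> \<le> C / sqrt (real n)"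
    and mean: "\<And>n k. k < n \<Longrightarrow> expectation (X n k) = 0"
    and var: "(\<lambda>n. \<Sum>k<n. expectation (\<lambda>\<omega>. (X n k \<omega>)\<^sup>2)) \<longlonglongrightarrow> v"
    and C: "0 \<le> C"
  shows "(\<lambda>n. char (distr M borel (\<lambda>\<omega>. \<Sum>k<n. X n k \<omega>)) t) \<longlonglongrightarrow> of_real (exp (- (t\<^sup>2 * v / 2)))"
proof -
  let ?s = "\<lambda>n k. expectation (\<lambda>\<omega>. (X n k \<omega>)\<^sup>2)"
  let ?e = "\<lambda>n k. complex_of_real (exp (- (t\<^sup>2 * ?s n k / 2)))"
  have rv: "random_variable borel (X n k)" if "k < n" for n k
    using indep[of n] that by (auto simp: indep_vars_def)
  have prod_e: "(\<Prod>k<n. ?e n k) = of_real (exp (- (t\<^sup>2 * (\<Sum>k<n. ?s n k) / 2)))" for n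
    unfolding of_real_prod[symmetric] exp_sum[OF finite_lessThan, symmetric]
    by (simp add: sum_negf sum_distrib_left sum_divide_distrib)
  have le: "norm (char (distr M borel (\<lambda>\<omega>. \<Sum>k<n. X n k \<omega>)) t - (\<Prod>k<n. ?e n k))
      \<le> \<bar>t\<bar> ^ 3 * C ^ 3 / 6 * (1 / sqrt n) + t ^ 4 * C ^ 4 / 4 * (1 / n)" for n
  proof (cases "n = 0")
    case False
    have "norm (char (distr M borel (\<lambda>\<omega>. \<Sum>k<n. X n k \<omega>)) t - (\<Prod>k<n. ?e n k))
        = norm ((\<Prod>k<n. char (distr M borel (X n k)) t) - (\<Prod>k<n. ?e n k))"
      using char_distr_sum[OF indep] by simp
    also have "\<dots> \<le> (\<Sum>k<n. norm (char (distr M borel (X n k)) t - ?e n k))"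
    proof (rule norm_prod_diff)
      fix k assume "k \<in> {..<n}"
      then show "norm (char (distr M borel (X n k)) t) \<le> 1"
        by (intro real_distribution.cmod_char_le_1 real_distribution_distr rv) auto
      have "0 \<le> ?s n k" by simp
      then have "0 \<le> t\<^sup>2 * ?s n k" by (intro mult_nonneg_nonneg) auto
      then show "norm (?e n k) \<le> 1" by simp
    qed
    also have "\<dots> \<le> (\<Sum>k<n. \<bar>t\<bar> ^ 3 * (C / sqrt n) ^ 3 / 6 + t ^ 4 * (C / sqrt n) ^ 4 / 4)"
      using C by (intro sum_mono char_approx_bounded rv bound mean) auto
    also have "\<dots> = n * (\<bar>t\<bar> ^ 3 * (C / sqrt n) ^ 3 / 6 + t ^ 4 * (C / sqrt n) ^ 4 / 4)" by simp
    also have "\<dots> = \<bar>t\<bar> ^ 3 * C ^ 3 / 6 * (n / sqrt n ^ 3) + t ^ 4 * C ^ 4 / 4 * (n / sqrt n ^ 4)"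
      by (simp add: power_divide algebra_simps)
    also have "n / sqrt n ^ 3 = 1 / sqrt n"
      using False by (simp add: power3_eq_cube field_simps)
    also have "n / sqrt n ^ 4 = 1 / n"
      using False by (simp add: power4_eq_xxxx field_simps)
    finally show ?thesis .
  qed (simp add: char_def integral_return)
  have "(\<lambda>n. \<bar>t\<bar> ^ 3 * C ^ 3 / 6 * (1 / sqrt (real n)) + t ^ 4 * C ^ 4 / 4 * (1 / real n)) \<longlonglongrightarrow> 0"
    by real_asymp
  then have "(\<lambda>n. char (distr M borel (\<lambda>\<omega>. \<Sum>k<n. X n k \<omega>)) t - (\<Prod>k<n. ?e n k)) \<longlonglongrightarrow> 0"
    by (rule Lim_null_comparison[OF always_eventually[OF allI[OF le]]])
  moreover have "(\<lambda>n. \<Prod>k<n. ?e n k) \<longlonglongrightarrow> of_real (exp (- (t\<^sup>2 * v / 2)))"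
    unfolding prod_e
    by (intro tendsto_of_real tendsto_exp tendsto_minus tendsto_divide tendsto_mult tendsto_const var) simp
  ultimately show ?thesis by (rule Lim_transform[rotated])
qed

text \<open>Plays the part of Slutsky's lemma: variables whose difference tends to 0 in mean have
  the same limiting characteristic function. The reason is that \<open>iexp\<close> is
  1-Lipschitz.\<close>

lemma (in prob_space) char_distr_diff_le:
  fixes X Y :: "'a \<Rightarrow> real"
  assumes [measurable]: "random_variable borel X" "random_variable borel Y"
    and int: "integrable M (\<lambda>\<omega>. X \<omega> - Y \<omega>)"
  shows "norm (char (distr M borel X) t - char (distr M borel Y) t) \<le> \<bar>t\<bar> * expectation (\<lambda>\<omega>. \<bar>X \<omega> - Y \<omega>\<bar>)"
proof -
  have iX: "integrable M (\<lambda>\<omega>. iexp (t * X \<omega>))" and iY: "integrable M (\<lambda>\<omega>. iexp (t * Y \<omega>))"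
    by (intro integrable_const_bound[of _ 1]; simp)+
  have "char (distr M borel X) t - char (distr M borel Y) t
      = expectation (\<lambda>\<omega>. iexp (t * X \<omega>) - iexp (t * Y \<omega>))"
    using iX iY by (simp add: char_def integral_distr)
  also have "norm \<dots> \<le> expectation (\<lambda>\<omega>. norm (iexp (t * X \<omega>) - iexp (t * Y \<omega>)))"
    by (rule integral_norm_bound)
  also have "\<dots> \<le> expectation (\<lambda>\<omega>. \<bar>t\<bar> * \<bar>X \<omega> - Y \<omega>\<bar>)"
  proof (rule integral_mono)
    show "integrable M (\<lambda>\<omega>. norm (iexp (t * X \<omega>) - iexp (t * Y \<omega>)))" using iX iY by auto
    show "integrable M (\<lambda>\<omega>. \<bar>t\<bar> * \<bar>X \<omega> - Y \<omega>\<bar>)" using int by auto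
    fix \<omega>
    have "iexp (t * X \<omega>) - iexp (t * Y \<omega>) = iexp (t * Y \<omega>) * (iexp (t * (X \<omega> - Y \<omega>)) - 1)"
      by (simp add: algebra_simps flip: exp_add)
    moreover have "norm (iexp (t * (X \<omega> - Y \<omega>)) - 1) \<le> \<bar>t * (X \<omega> - Y \<omega>)\<bar>"
      using iexp_approx1[of "t * (X \<omega> - Y \<omega>)" 0] by simp
    ultimately show "norm (iexp (t * X \<omega>) - iexp (t * Y \<omega>)) \<le> \<bar>t\<bar> * \<bar>X \<omega> - Y \<omega>\<bar>"
      by (simp add: norm_mult abs_mult)
  qed
  finally show ?thesis by simp
qed

text \<open>The sample \<open>c n k\<close> need not be a value of \<open>g\<close>. In the
  application it is a two-parameter function at \<open>k / n\<close> and
  \<open>(n - k - 1) / n\<close>, which add up to \<open>1 - 1 / n\<close>, slightly off the line on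
  which \<open>g\<close> lives.\<close>

lemma riemann_sum_approx:
  fixes g :: "real \<Rightarrow> real"
  assumes g: "continuous_on {0..1} g"
    and approx: "\<And>n k s. k < n \<Longrightarrow> real k / n \<le> s \<Longrightarrow> s \<le> real (Suc k) / n \<Longrightarrow> \<bar>g s - c n k\<bar> \<le> L / n"
  shows "(\<lambda>n. (\<Sum>k<n. c n k) / n) \<longlonglongrightarrow> integral {0..1} g"
proof -
  have main: "\<bar>(\<Sum>j<k. c n j) / n - integral {0..real k / n} g\<bar> \<le> k * (L / (real n)\<^sup>2)" if "k \<le> n" "0 < n" for n k
    using that(1)
  proof (induction k)
    case (Suc k)
    let ?a = "real k / n" and ?b = "real (Suc k) / n"
    have ab: "0 \<le> ?a" "?a \<le> ?b" "?b \<le> 1" "?b - ?a = 1 / n"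
      using Suc.prems that(2) by (auto simp: field_simps)
    have int: "g integrable_on {x..y}" if "0 \<le> x" "y \<le> 1" for x y
      using that by (intro integrable_continuous_real continuous_on_subset[OF g]) auto
    have sub: "{?a..?b} \<subseteq> {0..1}" using ab by (intro atLeastatMost_subset_iff[THEN iffD2]) auto
    have "norm (integral {?a..?b} (\<lambda>s. g s - c n k)) \<le> L / n * (?b - ?a)"
      using Suc.prems ab
      by (intro integral_bound continuous_on_diff continuous_on_const continuous_on_subset[OF g sub])
        (auto intro!: approx)
    moreover have "integral {?a..?b} (\<lambda>s. g s - c n k) = integral {?a..?b} g - c n k / n"
      using ab int by (subst integral_diff) (auto simp: algebra_simps)
    moreover have "L / n * (?b - ?a) = L / (real n)\<^sup>2" using ab(4) by (simp add: power2_eq_square)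
    ultimately have step: "\<bar>c n k / n - integral {?a..?b} g\<bar> \<le> L / (real n)\<^sup>2"
      by (simp only: real_norm_def abs_minus_commute)
    have IH: "\<bar>(\<Sum>j<k. c n j) / n - integral {0..?a} g\<bar> \<le> k * (L / (real n)\<^sup>2)"
      using Suc by simp
    have I: "integral {0..?b} g = integral {0..?a} g + integral {?a..?b} g"
      using ab int by (intro Henstock_Kurzweil_Integration.integral_combine[symmetric]) auto
    have S: "(\<Sum>j<Suc k. c n j) / n = (\<Sum>j<k. c n j) / n + c n k / n"
      by (simp add: add_divide_distrib)
    have L: "real (Suc k) * (L / (real n)\<^sup>2) = k * (L / (real n)\<^sup>2) + L / (real n)\<^sup>2"
      by (simp add: algebra_simps add_divide_distrib)
    show ?case unfolding I S L using step IH by linarith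
  qed simp
  have "(\<lambda>n. (\<Sum>k<n. c n k) / n - integral {0..1} g) \<longlonglongrightarrow> 0"
  proof (rule Lim_null_comparison)
    show "\<forall>\<^sub>F n in sequentially. norm ((\<Sum>k<n. c n k) / n - integral {0..1} g) \<le> L / real n"
      using eventually_gt_at_top[of 0]
    proof eventually_elim
      case (elim n)
      then show ?case using main[of n n] by (simp add: power2_eq_square)
    qed
    show "(\<lambda>n. L / real n) \<longlonglongrightarrow> 0" by real_asymp
  qed
  then show ?thesis by (simp add: LIM_zero_iff)
qed

section \<open>Independence, second moments and auxiliary estimates\<close>

lemma (in prob_space) indep_vars_reindex:
  assumes f: "inj_on f I" and X: "indep_vars M' X (f ` I)"
  shows "indep_vars (\<lambda>i. M' (f i)) (\<lambda>i. X (f i)) I"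
  unfolding indep_vars_def2
proof (intro conjI ballI indep_setsI)
  fix i assume i: "i \<in> I"
  show "random_variable (M' (f i)) (X (f i))" using X i by (auto simp: indep_vars_def)
  show "{X (f i) -` A \<inter> space M |A. A \<in> sets (M' (f i))} \<subseteq> events"
    using X i by (auto simp: indep_vars_def)
next
  fix A J assume J: "J \<noteq> {}" "J \<subseteq> I" "finite J"
    and A: "\<forall>j\<in>J. A j \<in> {X (f j) -` A \<inter> space M |A. A \<in> sets (M' (f j))}"
  define g where "g = the_inv_into I f"
  have g: "g (f j) = j" if "j \<in> J" for j using J that f by (auto simp: g_def the_inv_into_f_f)
  have "prob (\<Inter>j\<in>f ` J. A (g j)) = (\<Prod>j\<in>f ` J. prob (A (g j)))"
    using X J A g unfolding indep_vars_def2 by (intro indep_setsD) auto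
  then show "prob (\<Inter>j\<in>J. A j) = (\<Prod>j\<in>J. prob (A j))"
    using g inj_on_subset[OF f J(2)] by (simp add: prod.reindex)
qed

text \<open>Only the diagonal survives, so the bound is linear in \<open>card I\<close>. For about
  \<open>n\<^sup>2\<close> terms this gains a factor \<open>n\<close> in the norm over the triangle
  inequality.\<close>

lemma (in prob_space) second_moment_orthogonal_sum:
  fixes f :: "'i \<Rightarrow> 'a \<Rightarrow> real" and c :: real
  assumes I: "finite I" and int: "\<And>p q. p \<in> I \<Longrightarrow> q \<in> I \<Longrightarrow> integrable M (\<lambda>\<omega>. f p \<omega> * f q \<omega>)"
    and orth: "\<And>p q. p \<in> I \<Longrightarrow> q \<in> I \<Longrightarrow> p \<noteq> q \<Longrightarrow> expectation (\<lambda>\<omega>. f p \<omega> * f q \<omega>) = 0"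
    and bound: "\<And>p. p \<in> I \<Longrightarrow> expectation (\<lambda>\<omega>. f p \<omega> * f p \<omega>) \<le> c"
  shows "integrable M (\<lambda>\<omega>. (\<Sum>p\<in>I. f p \<omega>)\<^sup>2)" "expectation (\<lambda>\<omega>. (\<Sum>p\<in>I. f p \<omega>)\<^sup>2) \<le> card I * c"
proof -
  have sq: "(\<Sum>p\<in>I. f p \<omega>)\<^sup>2 = (\<Sum>p\<in>I. \<Sum>q\<in>I. f p \<omega> * f q \<omega>)" for \<omega>
    by (simp add: power2_eq_square sum_product)
  show "integrable M (\<lambda>\<omega>. (\<Sum>p\<in>I. f p \<omega>)\<^sup>2)"
    unfolding sq by (intro Bochner_Integration.integrable_sum int)
  have "expectation (\<lambda>\<omega>. (\<Sum>p\<in>I. f p \<omega>)\<^sup>2) = (\<Sum>p\<in>I. \<Sum>q\<in>I. expectation (\<lambda>\<omega>. f p \<omega> * f q \<omega>))"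
    unfolding sq using int by (subst Bochner_Integration.integral_sum, auto)+
  also have "\<dots> = (\<Sum>p\<in>I. \<Sum>q\<in>I. if q = p then expectation (\<lambda>\<omega>. f p \<omega> * f p \<omega>) else 0)"
    using orth by (intro sum.cong refl) auto
  also have "\<dots> \<le> (\<Sum>p\<in>I. c)" using I bound by (simp add: sum_mono del: sum_constant)
  finally show "expectation (\<lambda>\<omega>. (\<Sum>p\<in>I. f p \<omega>)\<^sup>2) \<le> card I * c" by simp
qed

lemma (in prob_space) expectation_abs_le_sqrt:
  fixes X :: "'a \<Rightarrow> real"
  assumes X: "random_variable borel X" and int: "integrable M (\<lambda>\<omega>. (X \<omega>)\<^sup>2)"
  shows "integrable M X" "expectation (\<lambda>\<omega>. \<bar>X \<omega>\<bar>) \<le> sqrt (expectation (\<lambda>\<omega>. (X \<omega>)\<^sup>2))"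
proof -
  show iX: "integrable M X" by (rule square_integrable_imp_integrable[OF X int])
  have "0 \<le> variance (\<lambda>\<omega>. \<bar>X \<omega>\<bar>)" by (rule variance_positive)
  also have "\<dots> = expectation (\<lambda>\<omega>. \<bar>X \<omega>\<bar>\<^sup>2) - (expectation (\<lambda>\<omega>. \<bar>X \<omega>\<bar>))\<^sup>2"
    using iX int by (intro variance_eq) auto
  finally show "expectation (\<lambda>\<omega>. \<bar>X \<omega>\<bar>) \<le> sqrt (expectation (\<lambda>\<omega>. (X \<omega>)\<^sup>2))"
    by (intro real_le_rsqrt) simp
qed

lemma bounded_linear_sandwich:
  fixes U :: "'b::real_normed_vector \<Rightarrow>\<^sub>L 'c::real_inner"
  shows "bounded_linear (\<lambda>c. k * (y \<bullet> U (blinfun_apply c w)))"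
  by (intro bounded_linear_const_mult bounded_linear_inner_right_comp
      bounded_linear_compose[OF blinfun.bounded_linear_right blinfun.bounded_linear_left])

lemma continuous_on_exp_prod:
  "continuous_on UNIV (\<lambda>a :: nat \<Rightarrow> 'a::banach \<Rightarrow>\<^sub>L 'a. exp_prod n a k)"
proof (induction k)
  case (Suc k)
  have "continuous_on UNIV (\<lambda>a :: nat \<Rightarrow> 'a \<Rightarrow>\<^sub>L 'a. op_exp ((1 / real n) *\<^sub>R a (Suc k)))"
    by (rule continuous_on_compose2[OF continuous_on_op_exp])
      (auto intro!: continuous_on_scaleR continuous_on_const continuous_on_product_coordinates)
  with Suc show ?case
    by (auto simp: exp_prod_def intro!: bounded_bilinear.continuous_on[OF bounded_bilinear_blinfun_compose])
qed (simp add: exp_prod_def)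

text \<open>The first \<open>k\<close> factors involve only the indices 1 to \<open>k\<close>; this
  is what makes a prefix independent of later operators.\<close>

lemma exp_prod_fun_upd:
  assumes "k < m"
  shows "exp_prod n (a(m := c)) k = exp_prod n a k"
  using assms unfolding exp_prod_def by (induction k) auto

text \<open>First-order term plus Taylor remainder, the square of the increment being at most the
  increment on the unit interval.\<close>

lemma op_exp_lipschitz:
  fixes B :: "'a::banach \<Rightarrow>\<^sub>L 'a"
  assumes "norm B \<le> S" "0 \<le> s" "s \<le> 1" "0 \<le> t" "t \<le> 1"
  shows "norm (op_exp (s *\<^sub>R B) - op_exp (t *\<^sub>R B)) \<le> (S + S\<^sup>2) * exp S * \<bar>s - t\<bar>"
  using assms(2-)
proof (induction s t rule: linorder_wlog)
  case (le s t)
  let ?h = "t - s"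
  have S: "0 \<le> S" using order_trans[OF norm_ge_zero assms(1)] .
  have e: "norm (op_exp (s *\<^sub>R B)) \<le> exp S"
  proof (rule order_trans[OF norm_op_exp_le])
    have "s * norm B \<le> 1 * S" using le assms(1) by (intro mult_mono) auto
    then show "exp (norm (s *\<^sub>R B)) \<le> exp S" using le by simp
  qed
  have "norm (op_exp (t *\<^sub>R B) - op_exp (s *\<^sub>R B))
      \<le> norm (op_exp (t *\<^sub>R B) - op_exp (s *\<^sub>R B) - ?h *\<^sub>R (B o\<^sub>L op_exp (s *\<^sub>R B)))
        + norm (?h *\<^sub>R (B o\<^sub>L op_exp (s *\<^sub>R B)))"
    using norm_triangle_ineq[of "op_exp (t *\<^sub>R B) - op_exp (s *\<^sub>R B) - ?h *\<^sub>R (B o\<^sub>L op_exp (s *\<^sub>R B))"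
      "?h *\<^sub>R (B o\<^sub>L op_exp (s *\<^sub>R B))"] by simp
  also have "\<dots> \<le> ?h\<^sup>2 * S\<^sup>2 * exp S + ?h * (S * exp S)"
  proof (rule add_mono)
    have "norm (op_exp (t *\<^sub>R B) - op_exp (s *\<^sub>R B) - ?h *\<^sub>R (B o\<^sub>L op_exp (s *\<^sub>R B)))
        \<le> ?h\<^sup>2 * (norm B)\<^sup>2 * exp (t * norm B)"
      using op_exp_taylor[of s ?h B] le by simp
    also have "\<dots> \<le> ?h\<^sup>2 * S\<^sup>2 * exp (1 * S)"
      using le assms(1) S by (intro mult_mono power_mono iffD2[OF exp_le_cancel_iff]) auto
    finally show "norm (op_exp (t *\<^sub>R B) - op_exp (s *\<^sub>R B) - ?h *\<^sub>R (B o\<^sub>L op_exp (s *\<^sub>R B)))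
        \<le> ?h\<^sup>2 * S\<^sup>2 * exp S" by simp
    show "norm (?h *\<^sub>R (B o\<^sub>L op_exp (s *\<^sub>R B))) \<le> ?h * (S * exp S)"
      using le e assms(1) by (auto intro!: mult_left_mono norm_blinfun_compose_le)
  qed
  also have "\<dots> \<le> (S + S\<^sup>2) * exp S * ?h"
  proof -
    have "?h\<^sup>2 * (S\<^sup>2 * exp S) \<le> ?h * (S\<^sup>2 * exp S)"
      using le by (intro mult_right_mono) (auto simp: power2_eq_square mult_left_le)
    then show ?thesis by (simp add: algebra_simps)
  qed
  finally show ?case using le by (simp add: norm_minus_commute)
qed (simp add: norm_minus_commute abs_minus_commute)

lemma norm_apply_le:
  "norm f \<le> c \<Longrightarrow> norm v \<le> d \<Longrightarrow> norm (blinfun_apply f v) \<le> c * d"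
  by (rule order_trans[OF norm_blinfun])
    (auto intro!: mult_mono intro: order_trans[OF norm_ge_zero])

subsection \<open>Products of exponentials of independent operators\<close>

locale iid_operators = iid_bochner M A \<rho>
  for M :: "'w measure" and A :: "nat \<Rightarrow> 'w \<Rightarrow> ('a::{real_inner, banach} \<Rightarrow>\<^sub>L 'a)" and \<rho> +
  fixes x y :: 'a
begin

text \<open>The factor 2 makes the estimates apply also to the rounded operators used in the discretisation,
  whose norm is at most \<open>2 * \<rho>\<close>.\<close>

definition op_bound :: real where "op_bound = 2 * (\<rho> + norm mean)"

lemma op_bound_ge: "0 \<le> op_bound" "norm mean \<le> op_bound" "\<rho> \<le> op_bound" "2 * \<rho> \<le> op_bound"
  "\<rho> + norm mean \<le> 2 * op_bound" "\<rho> + norm mean \<le> op_bound"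
  using r_nonneg by (auto simp: op_bound_def)

text \<open>Here \<open>k\<close> counts from 0: the slot \<open>c\<close> is meant for
  \<open>A (Suc k) - mean\<close>, with \<open>k\<close> mean steps before it and
  \<open>n - k - 1\<close> after it.\<close>

definition lin_term :: "nat \<Rightarrow> nat \<Rightarrow> ('a \<Rightarrow>\<^sub>L 'a) \<Rightarrow> real" where
  "lin_term n k c = y \<bullet> exp_step n mean k (c (exp_step n mean (n - Suc k) x))"

definition quad_term :: "nat \<Rightarrow> nat \<Rightarrow> nat \<Rightarrow> (nat \<Rightarrow> 'a \<Rightarrow>\<^sub>L 'a) \<Rightarrow> real" where
  "quad_term n k j a = y \<bullet> exp_prod n a j ((a (Suc j) - mean) (exp_step n mean (k - Suc j)
     ((a (Suc k) - mean) (exp_step n mean (n - Suc k) x))))"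

definition quad_bound :: real where
  "quad_bound = norm y * (exp op_bound * (2 * op_bound * (exp op_bound * (2 * op_bound * (exp op_bound * norm x)))))"

lemma quad_bound_nonneg: "0 \<le> quad_bound"
  unfolding quad_bound_def using op_bound_ge(1) by simp

text \<open>The centred factors are replaced by free operators \<open>c\<close> and
  \<open>d\<close>, since the independence argument turns one of them into a variable.\<close>

lemma sandwich_bound:
  fixes c d :: "'a \<Rightarrow>\<^sub>L 'a"
  assumes "\<And>i. norm (a i) \<le> op_bound" "norm c \<le> 2 * op_bound" "norm d \<le> 2 * op_bound" "j < k" "k < n"
  shows "\<bar>y \<bullet> exp_prod n a j (c (exp_step n mean (k - Suc j) (d (exp_step n mean (n - Suc k) x))))\<bar>
    \<le> quad_bound"
  unfolding quad_bound_def using assms op_bound_ge(2)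
  by (intro order_trans[OF Cauchy_Schwarz_ineq2] mult_left_mono norm_apply_le norm_exp_prod_le
      norm_exp_step_le order_refl) auto

lemma norm_centered_le:
  assumes "\<And>i. norm (a i) \<le> 2 * \<rho>"
  shows "norm (a i - mean) \<le> 2 * op_bound"
  using assms[of i] op_bound_ge by (intro order_trans[OF norm_triangle_ineq4]) auto

lemma quad_term_bound:
  assumes "\<And>i. norm (a i) \<le> 2 * \<rho>" "j < k" "k < n"
  shows "\<bar>quad_term n k j a\<bar> \<le> quad_bound"
  unfolding quad_term_def
  by (intro sandwich_bound norm_centered_le assms)
    (use assms op_bound_ge in \<open>auto intro: order_trans\<close>)

lemma continuous_on_centered: "continuous_on UNIV (\<lambda>a. a i - (mean :: 'a \<Rightarrow>\<^sub>L 'a))"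
  by (intro continuous_on_diff continuous_on_const continuous_on_product_coordinates)

lemma continuous_on_quad_term: "continuous_on UNIV (quad_term n k j)"
  unfolding quad_term_def
  by (intro continuous_on_inner continuous_on_const blinfun.continuous_on continuous_on_exp_prod
      continuous_on_centered)

text \<open>Of all the centred factors in the two terms, the one with the largest outer index, or for equal
  outer indices the largest inner one, occurs only once.\<close>

lemma quad_term_orthogonal:
  assumes jk: "j < k" "k < n" and jk': "j' < k'" "k' < n" and less: "k < k' \<or> k = k' \<and> j < j'"
  shows "expectation (\<lambda>\<omega>. quad_term n k j (\<lambda>i. A i \<omega>) * quad_term n k' j' (\<lambda>i. A i \<omega>)) = 0"
  using less
proof
  assume kk: "k < k'"
  \<comment> \<open>The slot \<open>c\<close> takes the place of \<open>A (Suc k') - mean\<close>;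
    every other index that occurs is smaller than \<open>Suc k'\<close>.\<close>
  define H where "H a c = quad_term n k j a * (y \<bullet> exp_prod n a j' ((a (Suc j') - mean)
    (exp_step n mean (k' - Suc j') (blinfun_apply c (exp_step n mean (n - Suc k') x)))))" for a c
  have "expectation (\<lambda>\<omega>. H (\<lambda>i. A i \<omega>) (A (Suc k') \<omega> - mean)) = 0"
  proof (rule expectation_independent_factor)
    show "continuous_on UNIV (\<lambda>a. H a c)" for c
      unfolding H_def
      by (intro continuous_on_mult continuous_on_quad_term continuous_on_inner continuous_on_const
          blinfun.continuous_on continuous_on_exp_prod continuous_on_centered)
    show "bounded_linear (H a)" for a
      using bounded_linear_sandwich[of "quad_term n k j a" y
        "exp_prod n a j' o\<^sub>L (a (Suc j') - mean) o\<^sub>L exp_step n mean (k' - Suc j')"]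
      unfolding H_def by simp
    show "H (a(Suc k' := 0)) c = H a c" for a c
      using kk jk jk' by (simp add: H_def quad_term_def exp_prod_fun_upd)
    show "\<bar>H a c\<bar> \<le> quad_bound * quad_bound"
      if "\<And>i. norm (a i) \<le> 2 * \<rho>" "norm c \<le> \<rho> + norm mean" for a c
      unfolding H_def abs_mult using quad_bound_nonneg jk jk' that op_bound_ge
      by (intro mult_mono quad_term_bound sandwich_bound norm_centered_le)
        (auto intro: order_trans)
  qed
  then show ?thesis by (simp add: H_def quad_term_def[of n k' j'])
next
  assume kk: "k = k' \<and> j < j'"
  \<comment> \<open>With equal outer indices the factor \<open>A (Suc k) - mean\<close> occurs in
    both terms. The factor at \<open>Suc j'\<close> occurs once, and the prefixes involve only
    indices up to \<open>j'\<close>.\<close>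
  define H where "H a c = quad_term n k j a * (y \<bullet> exp_prod n a j' (blinfun_apply c
    (exp_step n mean (k - Suc j') ((a (Suc k) - mean) (exp_step n mean (n - Suc k) x)))))" for a c
  have "expectation (\<lambda>\<omega>. H (\<lambda>i. A i \<omega>) (A (Suc j') \<omega> - mean)) = 0"
  proof (rule expectation_independent_factor)
    show "continuous_on UNIV (\<lambda>a. H a c)" for c
      unfolding H_def
      by (intro continuous_on_mult continuous_on_quad_term continuous_on_inner continuous_on_const
          blinfun.continuous_on continuous_on_exp_prod continuous_on_centered)
    show "bounded_linear (H a)" for a
      unfolding H_def by (rule bounded_linear_sandwich)
    show "H (a(Suc j' := 0)) c = H a c" for a c
      using kk jk jk' by (simp add: H_def quad_term_def exp_prod_fun_upd)
    show "\<bar>H a c\<bar> \<le> quad_bound * quad_bound"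
      if "\<And>i. norm (a i) \<le> 2 * \<rho>" "norm c \<le> \<rho> + norm mean" for a c
      unfolding H_def abs_mult using quad_bound_nonneg jk jk' kk that op_bound_ge
      by (intro mult_mono quad_term_bound sandwich_bound norm_centered_le)
        (auto intro: order_trans)
  qed
  then show ?thesis using kk by (simp add: H_def quad_term_def[of n k' j'])
qed

text \<open>At most \<open>n\<^sup>2\<close> orthogonal bounded terms have a sum with second moment
  of order \<open>n\<^sup>2\<close>, hence with first absolute moment of order
  \<open>n\<close>.\<close>

lemma quad_sum_L1:
  "integrable M (\<lambda>\<omega>. \<Sum>k<n. \<Sum>j<k. quad_term n k j (\<lambda>i. A i \<omega>))"
  "expectation (\<lambda>\<omega>. \<bar>\<Sum>k<n. \<Sum>j<k. quad_term n k j (\<lambda>i. A i \<omega>)\<bar>) \<le> n * quad_bound"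
proof -
  define I where "I = (SIGMA k:{..<n}. {..<k})"
  define f where "f p \<omega> = quad_term n (fst p) (snd p) (\<lambda>i. A i \<omega>)" for p \<omega>
  have fin: "finite I" by (simp add: I_def)
  have sum: "(\<Sum>k<n. \<Sum>j<k. quad_term n k j (\<lambda>i. A i \<omega>)) = (\<Sum>p\<in>I. f p \<omega>)" for \<omega>
    by (simp add: I_def f_def sum.Sigma split_def)
  have bd: "\<bar>quad_term n (fst p) (snd p) a * quad_term n (fst q) (snd q) a\<bar> \<le> quad_bound * quad_bound"
    if "p \<in> I" "q \<in> I" "\<And>i. norm (a i) \<le> \<rho>" for p q a
  proof -
    have "norm (a i) \<le> 2 * \<rho>" for i using that(3)[of i] r_nonneg by simp
    then show ?thesis unfolding abs_mult
      using that quad_bound_nonneg by (intro mult_mono quad_term_bound) (auto simp: I_def)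
  qed
  have int: "integrable M (\<lambda>\<omega>. f p \<omega> * f q \<omega>)" if "p \<in> I" "q \<in> I" for p q
    unfolding f_def
    by (rule integrable_continuous_sequence[where C="quad_bound * quad_bound"])
      (intro continuous_on_mult continuous_on_quad_term bd that)+
  have orth: "expectation (\<lambda>\<omega>. f p \<omega> * f q \<omega>) = 0" if "p \<in> I" "q \<in> I" "p \<noteq> q" for p q
  proof -
    obtain k j k' j' where pq: "p = (k, j)" "q = (k', j')" by (metis surj_pair)
    have *: "(k < k' \<or> k = k' \<and> j < j') \<or> (k' < k \<or> k' = k \<and> j' < j)" using that(3) pq by auto
    have jk: "j < k" "k < n" "j' < k'" "k' < n" using that pq by (auto simp: I_def)
    from * show ?thesis
      using quad_term_orthogonal[OF jk] quad_term_orthogonal[OF jk(3,4,1,2)]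
      by (auto simp: f_def pq mult.commute)
  qed
  have bound: "expectation (\<lambda>\<omega>. f p \<omega> * f p \<omega>) \<le> quad_bound * quad_bound" if "p \<in> I" for p
  proof -
    have "expectation (\<lambda>\<omega>. f p \<omega> * f p \<omega>) \<le> expectation (\<lambda>_. quad_bound * quad_bound)"
    proof (rule integral_mono_AE[OF int[OF that that]])
      show "AE \<omega> in M. f p \<omega> * f p \<omega> \<le> quad_bound * quad_bound"
        using AE_norm_X
      proof eventually_elim
        case (elim \<omega>)
        then show ?case using bd[OF that that, of "\<lambda>i. A i \<omega>"] by (simp add: f_def)
      qed
    qed simp
    then show ?thesis by (simp add: prob_space)
  qed
  note second = second_moment_orthogonal_sum[where f=f and I=I and c="quad_bound * quad_bound", OF fin int orth bound]
  have "card I \<le> card ({..<n} \<times> {..<n})" by (intro card_mono) (auto simp: I_def)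
  then have card: "card I \<le> n * n" by (simp add: card_cartesian_product)
  have meas: "random_variable borel (\<lambda>\<omega>. \<Sum>p\<in>I. f p \<omega>)"
    unfolding f_def
    by (intro borel_measurable_continuous_sequence continuous_on_sum continuous_on_quad_term
        borel_measurable_sum)
  note L1 = expectation_abs_le_sqrt[OF meas second(1)]
  show "integrable M (\<lambda>\<omega>. \<Sum>k<n. \<Sum>j<k. quad_term n k j (\<lambda>i. A i \<omega>))"
    unfolding sum by (rule L1(1))
  have "sqrt (expectation (\<lambda>\<omega>. (\<Sum>p\<in>I. f p \<omega>)\<^sup>2)) \<le> sqrt ((real n * quad_bound)\<^sup>2)"
  proof (rule real_sqrt_le_mono)
    have "card I * (quad_bound * quad_bound) \<le> real (n * n) * (quad_bound * quad_bound)"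
      using card by (intro mult_right_mono) (auto simp del: of_nat_mult)
    then show "expectation (\<lambda>\<omega>. (\<Sum>p\<in>I. f p \<omega>)\<^sup>2) \<le> (real n * quad_bound)\<^sup>2"
      using second(2) by (simp add: power2_eq_square mult_ac)
  qed
  then show "expectation (\<lambda>\<omega>. \<bar>\<Sum>k<n. \<Sum>j<k. quad_term n k j (\<lambda>i. A i \<omega>)\<bar>) \<le> n * quad_bound"
    unfolding sum using L1(2) quad_bound_nonneg by simp
qed

definition deviation :: "nat \<Rightarrow> (nat \<Rightarrow> 'a \<Rightarrow>\<^sub>L 'a) \<Rightarrow> real" where
  "deviation n a = y \<bullet> (sqrt (real n) *\<^sub>R (exp_prod n a n - op_exp mean)) x"

text \<open>The constant of \<open>exp_prod_expansion2\<close> for \<open>r = op_bound\<close>,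
  times the norms of \<open>y\<close> and \<open>x\<close>.\<close>

definition expansion_bound :: real where
  "expansion_bound = norm y * (2 * op_bound\<^sup>2 * exp op_bound ^ 3 * (1 + 2 * op_bound * exp op_bound) * norm x)"

lemma deviation_expansion:
  assumes a: "\<And>i. norm (a i) \<le> \<rho>" and n: "0 < n"
  shows "\<bar>deviation n a - (\<Sum>k<n. lin_term n k (a (Suc k) - mean) / sqrt (real n))
      - (\<Sum>k<n. \<Sum>j<k. quad_term n k j a) / (real n * sqrt (real n))\<bar> \<le> expansion_bound / sqrt (real n)"
proof -
  let ?E = "exp_step n mean" and ?d = "\<lambda>i. a i - mean"
  define Z where "Z = exp_prod n a n - ?E n
      - (1 / real n) *\<^sub>R (\<Sum>k<n. ?E k o\<^sub>L ?d (Suc k) o\<^sub>L ?E (n - Suc k))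
      - (1 / (real n)\<^sup>2) *\<^sub>R (\<Sum>k<n. \<Sum>j<k. exp_prod n a j o\<^sub>L ?d (Suc j) o\<^sub>L ?E (k - Suc j)
            o\<^sub>L ?d (Suc k) o\<^sub>L ?E (n - Suc k))"
  have aS: "norm (a i) \<le> op_bound" for i using a[of i] op_bound_ge by auto
  have Z: "norm Z \<le> 2 * op_bound\<^sup>2 * exp op_bound ^ 3 * (1 + 2 * op_bound * exp op_bound) / real n"
    unfolding Z_def by (rule exp_prod_expansion2[OF op_bound_ge(2) aS n])
  have En: "?E n = op_exp mean" using n by (simp add: exp_step_def)
  have c: "sqrt (real n) * (1 / real n) = 1 / sqrt (real n)" "sqrt (real n) * (1 / (real n)\<^sup>2) = 1 / (real n * sqrt (real n))"
    using n by (auto simp: field_simps power2_eq_square)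
  have "y \<bullet> blinfun_apply Z x = y \<bullet> blinfun_apply (exp_prod n a n - op_exp mean) x
      - (1 / real n) * (\<Sum>k<n. lin_term n k (?d (Suc k)))
      - (1 / (real n)\<^sup>2) * (\<Sum>k<n. \<Sum>j<k. quad_term n k j a)"
    by (simp add: Z_def En blinfun.diff_left blinfun.scaleR_left blinfun.sum_left inner_diff_right
        inner_sum_right lin_term_def quad_term_def)
  then have "sqrt (real n) * (y \<bullet> blinfun_apply Z x) = deviation n a - (sqrt (real n) * (1 / real n)) * (\<Sum>k<n. lin_term n k (?d (Suc k)))
      - (sqrt (real n) * (1 / (real n)\<^sup>2)) * (\<Sum>k<n. \<Sum>j<k. quad_term n k j a)"
    by (simp only: deviation_def blinfun.scaleR_left inner_scaleR_right right_diff_distrib mult.assoc)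
  then have eq: "deviation n a - (\<Sum>k<n. lin_term n k (a (Suc k) - mean) / sqrt (real n))
      - (\<Sum>k<n. \<Sum>j<k. quad_term n k j a) / (real n * sqrt (real n)) = sqrt (real n) * (y \<bullet> blinfun_apply Z x)"
    unfolding c by (simp add: sum_divide_distrib)
  have "\<bar>y \<bullet> blinfun_apply Z x\<bar> \<le> norm y * (2 * op_bound\<^sup>2 * exp op_bound ^ 3 * (1 + 2 * op_bound * exp op_bound) / real n * norm x)"
    by (intro order_trans[OF Cauchy_Schwarz_ineq2] mult_left_mono norm_apply_le Z) auto
  then have "\<bar>sqrt (real n) * (y \<bullet> blinfun_apply Z x)\<bar> \<le> sqrt (real n) * (norm y * (2 * op_bound\<^sup>2 * exp op_bound ^ 3 * (1 + 2 * op_bound * exp op_bound) / real n * norm x))"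
    unfolding abs_mult by (intro mult_mono) simp_all
  also have "\<dots> = expansion_bound * (sqrt (real n) * (1 / real n))" by (simp add: expansion_bound_def)
  finally show ?thesis unfolding eq c by simp
qed

lemma continuous_on_deviation: "continuous_on UNIV (deviation n)"
  unfolding deviation_def
  by (intro continuous_on_inner continuous_on_const blinfun.continuous_on continuous_on_scaleR
      continuous_on_diff continuous_on_exp_prod)

lemma continuous_on_lin_term: "continuous_on UNIV (lin_term n k)"
  unfolding lin_term_def
  by (intro continuous_on_inner continuous_on_const blinfun.continuous_on continuous_on_id)

lemma lin_term_bound:
  assumes "norm c \<le> 2 * op_bound" "k < n"
  shows "\<bar>lin_term n k c\<bar> \<le> norm y * (exp op_bound * (2 * op_bound * (exp op_bound * norm x)))"
  unfolding lin_term_def using assms op_bound_ge(2)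
  by (intro order_trans[OF Cauchy_Schwarz_ineq2] mult_left_mono norm_apply_le
      norm_exp_step_le order_refl) auto

section \<open>Reduction to the sum of independent terms\<close>

text \<open>The double sum has first absolute moment of order \<open>n\<close> and prefactor
  \<open>1 / (n * sqrt n)\<close>, so it is of order \<open>1 / sqrt n\<close>, like the
  deterministic error.\<close>

lemma char_deviation_lin_sum:
  "(\<lambda>n. char (distr M borel (\<lambda>\<omega>. deviation n (\<lambda>i. A i \<omega>))) t
    - char (distr M borel (\<lambda>\<omega>. \<Sum>k<n. lin_term n k (A (Suc k) \<omega> - mean) / sqrt n)) t) \<longlonglongrightarrow> 0"
proof (rule Lim_null_comparison)
  have "(\<lambda>n. 1 / sqrt (real n)) \<longlonglongrightarrow> 0" by real_asymp
  then show "(\<lambda>n. \<bar>t\<bar> * (expansion_bound + quad_bound) * (1 / sqrt (real n))) \<longlonglongrightarrow> 0"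
    by (rule tendsto_mult_right_zero)
  show "\<forall>\<^sub>F n in sequentially. norm (char (distr M borel (\<lambda>\<omega>. deviation n (\<lambda>i. A i \<omega>))) t
    - char (distr M borel (\<lambda>\<omega>. \<Sum>k<n. lin_term n k (A (Suc k) \<omega> - mean) / sqrt n)) t)
    \<le> \<bar>t\<bar> * (expansion_bound + quad_bound) * (1 / sqrt (real n))"
    using eventually_gt_at_top[of 0]
  proof eventually_elim
    case (elim n)
    define D where "D \<omega> = deviation n (\<lambda>i. A i \<omega>)" for \<omega>
    define L where "L \<omega> = (\<Sum>k<n. lin_term n k (A (Suc k) \<omega> - mean) / sqrt n)" for \<omega>
    define Q where "Q \<omega> = (\<Sum>k<n. \<Sum>j<k. quad_term n k j (\<lambda>i. A i \<omega>))" for \<omega>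
    have D: "random_variable borel D"
      unfolding D_def by (intro borel_measurable_continuous_sequence continuous_on_deviation)
    have "continuous_on UNIV (\<lambda>a. \<Sum>k<n. lin_term n k (a (Suc k) - mean) / sqrt n)"
      using elim by (intro continuous_on_sum continuous_on_divide continuous_on_const
        continuous_on_compose2[OF continuous_on_lin_term continuous_on_centered]) auto
    then have L: "random_variable borel L"
      unfolding L_def by (rule borel_measurable_continuous_sequence)
    have Q: "integrable M Q" "expectation (\<lambda>\<omega>. \<bar>Q \<omega>\<bar>) \<le> n * quad_bound"
      unfolding Q_def by (rule quad_sum_L1)+
    have le: "AE \<omega> in M. \<bar>D \<omega> - L \<omega>\<bar> \<le> expansion_bound / sqrt n + \<bar>Q \<omega>\<bar> / (n * sqrt n)"
      using AE_norm_X
    proof eventually_elim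
      case (elim \<omega>)
      have "\<bar>D \<omega> - L \<omega> - Q \<omega> / (n * sqrt n)\<bar> \<le> expansion_bound / sqrt n"
        unfolding D_def L_def Q_def using elim \<open>0 < n\<close> by (intro deviation_expansion) auto
      moreover have "\<bar>Q \<omega> / (n * sqrt n)\<bar> = \<bar>Q \<omega>\<bar> / (n * sqrt n)"
        by (simp add: abs_divide abs_mult)
      ultimately show ?case
        using abs_triangle_ineq[of "D \<omega> - L \<omega> - Q \<omega> / (n * sqrt n)" "Q \<omega> / (n * sqrt n)"] by simp
    qed
    have intR: "integrable M (\<lambda>\<omega>. expansion_bound / sqrt n + \<bar>Q \<omega>\<bar> / (n * sqrt n))"
      using Q(1) by auto
    have DL: "integrable M (\<lambda>\<omega>. D \<omega> - L \<omega>)"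
    proof (rule Bochner_Integration.integrable_bound[OF intR])
      show "AE \<omega> in M. norm (D \<omega> - L \<omega>) \<le> norm (expansion_bound / sqrt n + \<bar>Q \<omega>\<bar> / (n * sqrt n))"
        using le by eventually_elim auto
    qed (use D L in auto)
    have "expectation (\<lambda>\<omega>. \<bar>D \<omega> - L \<omega>\<bar>) \<le> expectation (\<lambda>\<omega>. expansion_bound / sqrt n + \<bar>Q \<omega>\<bar> / (n * sqrt n))"
      using DL by (intro integral_mono_AE intR le) auto
    also have "\<dots> = expansion_bound / sqrt n + expectation (\<lambda>\<omega>. \<bar>Q \<omega>\<bar>) / (n * sqrt n)"
      using Q(1) by (simp add: prob_space)
    also have "\<dots> \<le> expansion_bound / sqrt n + n * quad_bound / (n * sqrt n)"
      by (intro add_left_mono divide_right_mono Q(2)) simp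
    also have "\<dots> = (expansion_bound + quad_bound) * (1 / sqrt n)"
      using elim by (simp add: add_divide_distrib)
    finally have "\<bar>t\<bar> * expectation (\<lambda>\<omega>. \<bar>D \<omega> - L \<omega>\<bar>) \<le> \<bar>t\<bar> * ((expansion_bound + quad_bound) * (1 / sqrt n))"
      by (intro mult_left_mono) auto
    with char_distr_diff_le[OF D L DL, of t]
    show ?case by (simp add: D_def[abs_def] L_def[abs_def] mult.assoc)
  qed
qed

section \<open>Variances of the independent terms and their limit\<close>

text \<open>\<open>lin_term\<close> with its two discrete exponents freed, so that the grid points
  and the limiting pairs \<open>s\<close>, \<open>1 - s\<close> are values of one function.\<close>

definition sandwich :: "real \<Rightarrow> real \<Rightarrow> ('a \<Rightarrow>\<^sub>L 'a) \<Rightarrow> real" where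
  "sandwich s t c = y \<bullet> op_exp (s *\<^sub>R mean) (c (op_exp (t *\<^sub>R mean) x))"

lemma lin_term_eq_sandwich:
  "lin_term n k c = sandwich (real k / real n) (real (n - Suc k) / real n) c"
  by (simp add: lin_term_def sandwich_def exp_step_def)

definition sandwich_bound :: real where
  "sandwich_bound = norm y * (exp op_bound * (2 * op_bound * (exp op_bound * norm x)))"

definition sandwich_lip :: real where
  "sandwich_lip = norm y * ((op_bound + op_bound\<^sup>2) * exp op_bound * (2 * op_bound * (exp op_bound * norm x)))"

lemma norm_op_exp_mean_le:
  assumes "0 \<le> s" "s \<le> 1"
  shows "norm (op_exp (s *\<^sub>R mean)) \<le> exp op_bound"
proof (rule order_trans[OF norm_op_exp_le])
  have "s * norm mean \<le> 1 * op_bound" using assms op_bound_ge by (intro mult_mono) auto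
  then show "exp (norm (s *\<^sub>R mean)) \<le> exp op_bound" using assms by simp
qed

lemma sandwich_abs_le:
  assumes "0 \<le> s" "s \<le> 1" "0 \<le> t" "t \<le> 1" "norm c \<le> 2 * op_bound"
  shows "\<bar>sandwich s t c\<bar> \<le> sandwich_bound"
  unfolding sandwich_def sandwich_bound_def using assms
  by (intro order_trans[OF Cauchy_Schwarz_ineq2] mult_left_mono norm_apply_le
      norm_op_exp_mean_le order_refl) auto

lemma sandwich_lipschitz:
  assumes s: "0 \<le> s" "s \<le> 1" and t: "0 \<le> t" "t \<le> 1" and s': "0 \<le> s'" "s' \<le> 1"
    and t': "0 \<le> t'" "t' \<le> 1" and c: "norm c \<le> 2 * op_bound"
  shows "\<bar>sandwich s t c - sandwich s' t' c\<bar> \<le> sandwich_lip * (\<bar>s - s'\<bar> + \<bar>t - t'\<bar>)"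
proof -
  let ?e = "\<lambda>s. op_exp (s *\<^sub>R mean)" and ?L = "(op_bound + op_bound\<^sup>2) * exp op_bound"
  have L: "norm (?e s - ?e s') \<le> ?L * \<bar>s - s'\<bar>" "norm (?e t - ?e t') \<le> ?L * \<bar>t - t'\<bar>"
    using s t s' t' by (auto intro!: op_exp_lipschitz op_bound_ge)
  \<comment> \<open>The two exponents are changed one at a time.\<close>
  have "sandwich s t c - sandwich s' t' c
      = y \<bullet> (?e s - ?e s') (c (?e t x)) + y \<bullet> ?e s' (c ((?e t - ?e t') x))"
    by (simp add: sandwich_def blinfun.diff_left blinfun.diff_right inner_diff_right)
  also have "\<bar>\<dots>\<bar> \<le> norm y * (?L * \<bar>s - s'\<bar> * (2 * op_bound * (exp op_bound * norm x)))
      + norm y * (exp op_bound * (2 * op_bound * (?L * \<bar>t - t'\<bar> * norm x)))"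
    using s' t by (intro order_trans[OF abs_triangle_ineq] add_mono order_trans[OF Cauchy_Schwarz_ineq2]
      mult_left_mono norm_apply_le L norm_op_exp_mean_le c order_refl) auto
  also have "\<dots> = sandwich_lip * (\<bar>s - s'\<bar> + \<bar>t - t'\<bar>)"
    by (simp add: sandwich_lip_def algebra_simps)
  finally show ?thesis .
qed

lemma continuous_on_sandwich: "continuous_on UNIV (sandwich s t)"
  unfolding sandwich_def
  by (intro continuous_on_inner continuous_on_const blinfun.continuous_on continuous_on_id)

lemma norm_A_centered_le: "AE \<omega> in M. \<forall>i. norm (A i \<omega> - mean) \<le> 2 * op_bound"
  using AE_norm_X
proof eventually_elim
  case (elim \<omega>)
  show ?case
  proof
    fix i
    show "norm (A i \<omega> - mean) \<le> 2 * op_bound"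
      using norm_triangle_ineq4[of "A i \<omega>" mean] elim[rule_format, of i] op_bound_ge(5) by linarith
  qed
qed

definition limit_variance :: "real \<Rightarrow> real \<Rightarrow> real" where
  "limit_variance s t = expectation (\<lambda>\<omega>. (sandwich s t (A 0 \<omega> - mean))\<^sup>2)"

lemma sandwich_sq_integrable:
  assumes "0 \<le> s" "s \<le> 1" "0 \<le> t" "t \<le> 1"
  shows "integrable M (\<lambda>\<omega>. (sandwich s t (A 0 \<omega> - mean))\<^sup>2)"
proof (rule integrable_const_bound)
  show "AE \<omega> in M. norm ((sandwich s t (A 0 \<omega> - mean))\<^sup>2) \<le> sandwich_bound\<^sup>2"
    using norm_A_centered_le
  proof eventually_elim
    case (elim \<omega>)
    have "\<bar>sandwich s t (A 0 \<omega> - mean)\<bar>\<^sup>2 \<le> sandwich_bound\<^sup>2"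
      using elim by (intro power_mono sandwich_abs_le assms) auto
    then show ?case by simp
  qed
  show "random_variable borel (\<lambda>\<omega>. (sandwich s t (A 0 \<omega> - mean))\<^sup>2)"
    by (rule borel_measurable_continuous_sequence[where F="\<lambda>a. (sandwich s t (a 0 - mean))\<^sup>2"])
      (intro continuous_on_power continuous_on_compose2[OF continuous_on_sandwich continuous_on_centered] subset_UNIV)
qed

text \<open>Serves twice: for continuity of the limiting integrand and for the error of order
  \<open>1 / n\<close> at the grid points.\<close>

lemma limit_variance_lipschitz:
  assumes "0 \<le> s" "s \<le> 1" "0 \<le> t" "t \<le> 1" "0 \<le> s'" "s' \<le> 1" "0 \<le> t'" "t' \<le> 1"
  shows "\<bar>limit_variance s t - limit_variance s' t'\<bar>
    \<le> 2 * sandwich_bound * sandwich_lip * (\<bar>s - s'\<bar> + \<bar>t - t'\<bar>)"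
proof -
  let ?K = "2 * sandwich_bound * sandwich_lip * (\<bar>s - s'\<bar> + \<bar>t - t'\<bar>)"
  let ?f = "\<lambda>\<omega>. (sandwich s t (A 0 \<omega> - mean))\<^sup>2 - (sandwich s' t' (A 0 \<omega> - mean))\<^sup>2"
  have int: "integrable M ?f" using assms by (intro Bochner_Integration.integrable_diff sandwich_sq_integrable)
  have le: "AE \<omega> in M. \<bar>?f \<omega>\<bar> \<le> ?K"
    using norm_A_centered_le
  proof eventually_elim
    case (elim \<omega>)
    let ?c = "A 0 \<omega> - mean"
    have c: "norm ?c \<le> 2 * op_bound" using elim by blast
    have "\<bar>?f \<omega>\<bar> = \<bar>sandwich s t ?c + sandwich s' t' ?c\<bar> * \<bar>sandwich s t ?c - sandwich s' t' ?c\<bar>"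
      by (simp add: power2_eq_square algebra_simps flip: abs_mult)
    also have "\<dots> \<le> (sandwich_bound + sandwich_bound) * (sandwich_lip * (\<bar>s - s'\<bar> + \<bar>t - t'\<bar>))"
    proof (rule mult_mono)
      show "\<bar>sandwich s t ?c + sandwich s' t' ?c\<bar> \<le> sandwich_bound + sandwich_bound"
        using assms c by (intro order_trans[OF abs_triangle_ineq] add_mono sandwich_abs_le)
      then show "0 \<le> sandwich_bound + sandwich_bound" by linarith
    qed (use assms c in \<open>auto intro: sandwich_lipschitz\<close>)
    finally show ?case by simp
  qed
  have "limit_variance s t - limit_variance s' t' = expectation ?f"
    unfolding limit_variance_def using assms by (simp add: sandwich_sq_integrable)
  also have "\<bar>\<dots>\<bar> \<le> expectation (\<lambda>\<omega>. \<bar>?f \<omega>\<bar>)" by (rule integral_abs_bound)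
  also have "\<dots> \<le> expectation (\<lambda>_. ?K)" using int le by (intro integral_mono_AE) auto
  finally show ?thesis by (simp add: prob_space)
qed

lemma continuous_on_limit_variance: "continuous_on {0..1} (\<lambda>s. limit_variance s (1 - s))"
proof (rule lipschitz_on_continuous_on)
  show "\<bar>4 * sandwich_bound * sandwich_lip\<bar>-lipschitz_on {0..1} (\<lambda>s. limit_variance s (1 - s))"
  proof (rule lipschitz_onI)
    fix s t :: real assume "s \<in> {0..1}" "t \<in> {0..1}"
    then have "\<bar>limit_variance s (1 - s) - limit_variance t (1 - t)\<bar>
        \<le> 2 * sandwich_bound * sandwich_lip * (\<bar>s - t\<bar> + \<bar>(1 - s) - (1 - t)\<bar>)"
      by (intro limit_variance_lipschitz) auto
    also have "\<dots> = (4 * sandwich_bound * sandwich_lip) * \<bar>s - t\<bar>"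
      by (simp add: abs_minus_commute)
    also have "\<dots> \<le> \<bar>4 * sandwich_bound * sandwich_lip\<bar> * \<bar>s - t\<bar>"
      by (intro mult_right_mono) auto
    finally show "dist (limit_variance s (1 - s)) (limit_variance t (1 - t))
        \<le> \<bar>4 * sandwich_bound * sandwich_lip\<bar> * dist s t"
      by (simp add: dist_real_def)
  qed simp
qed

lemma expectation_lin_term_sq:
  "expectation (\<lambda>\<omega>. (lin_term n k (A i \<omega> - mean))\<^sup>2)
    = limit_variance (real k / real n) (real (n - Suc k) / real n)"
proof -
  let ?h = "\<lambda>c. (lin_term n k (c - mean))\<^sup>2"
  have h: "?h \<in> borel_measurable borel"
    by (intro borel_measurable_continuous_onI continuous_on_power
      continuous_on_compose2[OF continuous_on_lin_term] continuous_on_diff continuous_on_id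
      continuous_on_const subset_UNIV)
  show ?thesis
    using integral_distr[OF measurable_X h, of i, unfolded ident[of i]]
      integral_distr[OF measurable_X h, of 0]
    by (simp add: limit_variance_def lin_term_eq_sandwich)
qed

lemma char_lin_sum_tendsto:
  "(\<lambda>n. char (distr M borel (\<lambda>\<omega>. \<Sum>k<n. lin_term n k (A (Suc k) \<omega> - mean) / sqrt n)) t)
    \<longlonglongrightarrow> of_real (exp (- (t\<^sup>2 * integral {0..1} (\<lambda>s. limit_variance s (1 - s)) / 2)))"
proof (rule char_bounded_array_tendsto[where C=sandwich_bound])
  have sq: "expectation (\<lambda>\<omega>. (lin_term n k (A (Suc k) \<omega> - mean) / sqrt n)\<^sup>2)
      = limit_variance (real k / n) (real (n - Suc k) / n) / n" for n k
    by (simp add: power_divide expectation_lin_term_sq)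
  show "(\<lambda>n. \<Sum>k<n. expectation (\<lambda>\<omega>. (lin_term n k (A (Suc k) \<omega> - mean) / sqrt n)\<^sup>2))
      \<longlonglongrightarrow> integral {0..1} (\<lambda>s. limit_variance s (1 - s))"
    unfolding sq sum_divide_distrib[symmetric]
  proof (rule riemann_sum_approx[OF continuous_on_limit_variance])
    fix n k :: nat and s :: real
    assume k: "k < n" and s: "real k / n \<le> s" "s \<le> real (Suc k) / n"
    \<comment> \<open>As \<open>(n - k - 1) / n\<close> equals \<open>1 - (k + 1) / n\<close>, both
      exponents are within \<open>1 / n\<close> of their limiting values; this turns the Lipschitz
      factor 2 into 4.\<close>
    have d: "\<bar>s - real k / n\<bar> \<le> 1 / n" "\<bar>(1 - s) - real (n - Suc k) / n\<bar> \<le> 1 / n"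
    proof -
      have "real (n - Suc k) / n = 1 - real (Suc k) / n" "real (Suc k) / n = real k / n + 1 / n"
        using k by (simp_all add: of_nat_diff diff_divide_distrib add_divide_distrib)
      with s show "\<bar>s - real k / n\<bar> \<le> 1 / n" "\<bar>(1 - s) - real (n - Suc k) / n\<bar> \<le> 1 / n"
        by (simp_all only: abs_le_iff) linarith+
    qed
    have "0 \<le> real k / n" "real (Suc k) / n \<le> 1" using k by (auto simp: field_simps)
    then have s01: "0 \<le> s" "s \<le> 1" using s by linarith+
    have K: "0 \<le> sandwich_bound" "0 \<le> sandwich_lip"
      using op_bound_ge(1) by (auto simp: sandwich_bound_def sandwich_lip_def)
    have "\<bar>limit_variance s (1 - s) - limit_variance (real k / n) (real (n - Suc k) / n)\<bar>
        \<le> 2 * sandwich_bound * sandwich_lip * (\<bar>s - real k / n\<bar> + \<bar>(1 - s) - real (n - Suc k) / n\<bar>)"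
      using k s01 by (intro limit_variance_lipschitz) auto
    also have "\<dots> \<le> 2 * sandwich_bound * sandwich_lip * (1 / n + 1 / n)"
      using d K by (intro mult_left_mono add_mono) auto
    finally show "\<bar>limit_variance s (1 - s) - limit_variance (real k / n) (real (n - Suc k) / n)\<bar>
        \<le> 4 * sandwich_bound * sandwich_lip / n" by simp
  qed
  show "indep_vars (\<lambda>_. borel) (\<lambda>k \<omega>. lin_term n k (A (Suc k) \<omega> - mean) / sqrt n) {..<n}" for n
  proof (cases "n = 0")
    case False
    \<comment> \<open>The factors are \<open>A 1\<close> to \<open>A n\<close>, while the summation
      index starts at 0.\<close>
    have shift: "indep_vars (\<lambda>_. borel) (\<lambda>k. A (Suc k)) {..<n}"
      using indep_vars_reindex[OF _ indep_vars_subset[OF indep], of Suc "{..<n}"] by simp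
    show ?thesis
    proof (rule indep_vars_compose2[OF shift, where Y="\<lambda>k c. lin_term n k (c - mean) / sqrt n"])
      show "(\<lambda>c. lin_term n k (c - mean) / sqrt n) \<in> borel_measurable borel" for k
        using False
        by (intro borel_measurable_continuous_onI continuous_on_divide continuous_on_const
            continuous_on_compose2[OF continuous_on_lin_term] continuous_on_diff continuous_on_id
            subset_UNIV) simp
    qed
  qed (simp add: indep_vars_def indep_sets_def)
  show "AE \<omega> in M. \<bar>lin_term n k (A (Suc k) \<omega> - mean) / sqrt n\<bar> \<le> sandwich_bound / sqrt n" if "k < n" for n k
    using norm_A_centered_le
  proof eventually_elim
    case (elim \<omega>)
    have "\<bar>lin_term n k (A (Suc k) \<omega> - mean)\<bar> \<le> sandwich_bound"
      unfolding sandwich_bound_def using elim that by (intro lin_term_bound) auto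
    then show ?case by (simp add: abs_divide divide_right_mono)
  qed
  show "expectation (\<lambda>\<omega>. lin_term n k (A (Suc k) \<omega> - mean) / sqrt n) = 0" for n k
  proof -
    have "bounded_linear (lin_term n k)"
      using bounded_linear_sandwich[of 1] unfolding lin_term_def by simp
    then show ?thesis
      using integrable_functional expectation_functional
      by (simp add: linear_diff[OF bounded_linear.linear] prob_space)
  qed
  show "0 \<le> sandwich_bound" using op_bound_ge(1) by (simp add: sandwich_bound_def)
qed

section \<open>Identification of the limiting variance with the covariance operator\<close>

lemma has_bochner_int_tensor_sq:
  "has_bochner_int M (\<lambda>\<omega>. tensor_op_sq (A 0 \<omega> - mean)) (bochner_integral M (\<lambda>\<omega>. tensor_op_sq (A 0 \<omega> - mean)))"
proof (rule has_bochner_int_bounded[OF finite_measure_axioms complete_measure_axioms])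
  show "bochner_measurable M (\<lambda>\<omega>. tensor_op_sq (A 0 \<omega> - mean))"
    by (rule bochner_measurable_compose[OF _ bochner_measurable])
      (intro bounded_bilinear.continuous_on[OF bounded_bilinear_tensor_op] continuous_on_diff
        continuous_on_id continuous_on_const)
  show "AE \<omega> in M. norm (tensor_op_sq (A 0 \<omega> - mean)) \<le> (2 * op_bound) * (2 * op_bound)"
    using norm_A_centered_le
  proof eventually_elim
    case (elim \<omega>)
    have c: "norm (A 0 \<omega> - mean) \<le> 2 * op_bound" using elim by blast
    then show ?case
      using op_bound_ge(1) by (intro order_trans[OF norm_tensor_op_le] mult_mono) auto
  qed
qed

text \<open>By \<open>inner_tensor\<close>, the tensor squares of \<open>y\<close> and
  \<open>x\<close> pair with a product of operator tensor squares to the square of an ordinary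
  matrix element. Evaluation at these vectors is a bounded functional, so it passes through both
  Bochner integrals and produces \<open>limit_variance s (1 - s)\<close>.\<close>

lemma inner_tensor_sq_covariance:
  "tensor_sq y \<bullet> bochner_integral (lebesgue_on {0..1}) (\<lambda>s.
      tensor_op_sq (op_exp (s *\<^sub>R mean))
      o\<^sub>L bochner_integral M (\<lambda>\<omega>. tensor_op_sq (A 0 \<omega> - mean))
      o\<^sub>L tensor_op_sq (op_exp ((1 - s) *\<^sub>R mean))) (tensor_sq x)
    = integral {0..1} (\<lambda>s. limit_variance s (1 - s))"
proof -
  define \<Gamma> where "\<Gamma> = bochner_integral M (\<lambda>\<omega>. tensor_op_sq (A 0 \<omega> - mean))"
  define \<Phi> where "\<Phi> s = (tensor_op_sq (op_exp (s *\<^sub>R mean)) o\<^sub>L \<Gamma>) o\<^sub>L tensor_op_sq (op_exp ((1 - s) *\<^sub>R mean))" for s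
  have e: "continuous_on UNIV (\<lambda>s. op_exp (f s *\<^sub>R mean))" if "continuous_on UNIV f" for f :: "real \<Rightarrow> real"
    by (intro continuous_on_compose2[OF continuous_on_op_exp] continuous_on_scaleR that
        continuous_on_const subset_UNIV)
  have "continuous_on UNIV \<Phi>"
    unfolding \<Phi>_def
    by (intro bounded_bilinear.continuous_on[OF bounded_bilinear_blinfun_compose]
        bounded_bilinear.continuous_on[OF bounded_bilinear_tensor_op] e
        continuous_on_const continuous_on_id continuous_on_diff)
  \<comment> \<open>Since \<open>\<Phi>\<close> is continuous on the line, it suffices that the
    identity on the unit interval is Bochner measurable.\<close>
  moreover have "bochner_measurable (lebesgue_on {0..1}) (\<lambda>s::real. s)"
    by (intro bochner_measurable_borel_real measurable_restrict_space1 measurable_completion) simp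
  ultimately have meas: "bochner_measurable (lebesgue_on {0..1}) \<Phi>"
    by (rule bochner_measurable_compose)
  have sets: "{0..1::real} \<in> sets lebesgue" by simp
  have "has_bochner_int (lebesgue_on {0..1}) \<Phi> (bochner_integral (lebesgue_on {0..1}) \<Phi>)"
  proof (rule has_bochner_int_bounded[OF _ complete_measure_lebesgue_on[OF sets] meas])
    show "finite_measure (lebesgue_on {0..1::real})"
      by (intro finite_measureI) (simp add: emeasure_restrict_space space_restrict_space)
    show "AE s in lebesgue_on {0..1}. norm (\<Phi> s) \<le> exp op_bound * exp op_bound * norm \<Gamma> * (exp op_bound * exp op_bound)"
    proof (rule AE_I2)
      fix s assume "s \<in> space (lebesgue_on {0..1::real})"
      then have s: "0 \<le> s" "s \<le> 1" by (auto simp: space_restrict_space)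
      then have e: "norm (tensor_op_sq (op_exp (s *\<^sub>R mean))) \<le> exp op_bound * exp op_bound"
        "norm (tensor_op_sq (op_exp ((1 - s) *\<^sub>R mean))) \<le> exp op_bound * exp op_bound"
        by (auto intro!: order_trans[OF norm_tensor_op_le] mult_mono norm_op_exp_mean_le)
      then show "norm (\<Phi> s) \<le> exp op_bound * exp op_bound * norm \<Gamma> * (exp op_bound * exp op_bound)"
        unfolding \<Phi>_def by (intro norm_blinfun_compose_le order_refl)
    qed
  qed
  moreover have "bounded_linear (\<lambda>\<Psi>. tensor_sq y \<bullet> blinfun_apply \<Psi> (tensor_sq x))"
    using bounded_linear_sandwich[of 1 "tensor_sq y" id_blinfun "tensor_sq x"] by simp
  ultimately have "has_bochner_integral (lebesgue_on {0..1}) (\<lambda>s. tensor_sq y \<bullet> \<Phi> s (tensor_sq x))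
      (tensor_sq y \<bullet> bochner_integral (lebesgue_on {0..1}) \<Phi> (tensor_sq x))"
    by (rule has_bochner_integral_functional[rotated])
  moreover have "tensor_sq y \<bullet> \<Phi> s (tensor_sq x) = limit_variance s (1 - s)" for s
  proof -
    let ?v = "op_exp ((1 - s) *\<^sub>R mean) x"
    have "has_bochner_integral M (\<lambda>\<omega>. 1 * (tensor_sq y \<bullet> tensor_op_sq (op_exp (s *\<^sub>R mean))
        (tensor_op_sq (A 0 \<omega> - mean) (tensor_sq ?v))))
      (1 * (tensor_sq y \<bullet> tensor_op_sq (op_exp (s *\<^sub>R mean)) (\<Gamma> (tensor_sq ?v))))"
      unfolding \<Gamma>_def
      by (rule has_bochner_integral_functional[OF bounded_linear_sandwich has_bochner_int_tensor_sq])
    then show ?thesis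
      by (simp add: \<Phi>_def limit_variance_def sandwich_def inner_tensor power2_eq_square
          has_bochner_integral_integral_eq)
  qed
  ultimately have I: "has_bochner_integral (lebesgue_on {0..1}) (\<lambda>s. limit_variance s (1 - s))
      (tensor_sq y \<bullet> bochner_integral (lebesgue_on {0..1}) \<Phi> (tensor_sq x))" by simp
  \<comment> \<open>The covariance uses the Lebesgue integral, the Riemann sums the gauge integral;
    the two agree here.\<close>
  have "integral\<^sup>L (lebesgue_on {0..1}) (\<lambda>s. limit_variance s (1 - s))
      = integral {0..1} (\<lambda>s. limit_variance s (1 - s))"
    using integrable.intros[OF I] sets by (rule lebesgue_integral_eq_integral)
  then show ?thesis
    using has_bochner_integral_integral_eq[OF I] by (simp add: \<Phi>_def[abs_def] \<Gamma>_def)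
qed

lemma integral_limit_variance_nonneg: "0 \<le> integral {0..1} (\<lambda>s. limit_variance s (1 - s))"
  by (intro Henstock_Kurzweil_Integration.integral_nonneg integrable_continuous_real
      continuous_on_limit_variance) (simp add: limit_variance_def)

lemma deviation_weak_conv:
  "weak_conv_m (\<lambda>n. distr M borel (\<lambda>\<omega>. deviation n (\<lambda>i. A i \<omega>)))
    (normal_law 0 (integral {0..1} (\<lambda>s. limit_variance s (1 - s))))"
proof (rule levy_continuity)
  show "real_distribution (distr M borel (\<lambda>\<omega>. deviation n (\<lambda>i. A i \<omega>)))" for n
    by (rule real_distribution_distr[OF borel_measurable_continuous_sequence[OF continuous_on_deviation]])
  show "real_distribution (normal_law 0 (integral {0..1} (\<lambda>s. limit_variance s (1 - s))))"
    by (rule real_distribution_normal_law[OF integral_limit_variance_nonneg])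
  show "(\<lambda>n. char (distr M borel (\<lambda>\<omega>. deviation n (\<lambda>i. A i \<omega>))) t)
      \<longlonglongrightarrow> char (normal_law 0 (integral {0..1} (\<lambda>s. limit_variance s (1 - s)))) t" for t
    unfolding char_normal_law[OF integral_limit_variance_nonneg]
    by (rule Lim_transform[OF char_lin_sum_tendsto char_deviation_lin_sum])
qed

end

text \<open>\<open>A 0\<close> stands for the operator \<open>A\<close> of the claim and the product
  runs over \<open>A 1\<close> to \<open>A n\<close>. Nonnegativity is part of the conclusion so
  that \<open>normal_law\<close> is known to receive a genuine variance.\<close>

theorem theorem2p1:
  fixes M :: "'w measure"
    and A :: "nat \<Rightarrow> 'w \<Rightarrow> ('a::{real_inner, banach} \<Rightarrow>\<^sub>L 'a)"
    and \<rho> :: real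
  assumes "prob_space M" and "complete_measure M"
    and "\<rho> > 0" and "\<forall>\<omega>\<in>space M. norm (A 0 \<omega>) \<le> \<rho>"
    and "\<forall>i. random_operator M (A i)"
    and "prob_space.indep_vars M (\<lambda>_. borel) A UNIV"
    and "\<forall>i. distr M borel (A i) = distr M borel (A 0)"
  shows
    "let EA = bochner_integral M (A 0);
         \<Sigma> = bochner_integral (lebesgue_on {0..1}) (\<lambda>s.
               tensor_op_sq (op_exp (s *\<^sub>R EA))
               o\<^sub>L bochner_integral M (\<lambda>\<omega>. tensor_op_sq (A 0 \<omega> - EA))
               o\<^sub>L tensor_op_sq (op_exp ((1 - s) *\<^sub>R EA)));
         G = (\<lambda>n \<omega>. sqrt (real n) *\<^sub>R
               (op_prod (\<lambda>i. op_exp ((1 / real n) *\<^sub>R A i \<omega>)) n - op_exp EA))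
     in \<forall>x y. 0 \<le> tensor_sq y \<bullet> \<Sigma> (tensor_sq x) \<and>
          weak_conv_m (\<lambda>n. distr M borel (\<lambda>\<omega>. y \<bullet> G n \<omega> x))
            (normal_law 0 (tensor_sq y \<bullet> \<Sigma> (tensor_sq x)))"
proof -
  interpret prob_space M by fact
  interpret complete_measure M by fact
  interpret iid_bochner M A \<rho>
  proof
    show "random_operator M (A i)" for i using assms(5) by (rule spec)
    show "indep_vars (\<lambda>_. borel) A UNIV" by fact
    show "distr M borel (A i) = distr M borel (A 0)" for i using assms(7) by (rule spec)
    show "norm (A 0 \<omega>) \<le> \<rho>" if "\<omega> \<in> space M" for \<omega> using assms(4) that by blast
  qed
  show ?thesis
    unfolding Let_def mean_def[symmetric]
  proof (intro allI conjI)
    fix x y :: 'a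
    interpret iid_operators M A \<rho> x y ..
    show "0 \<le> tensor_sq y \<bullet> bochner_integral (lebesgue_on {0..1}) (\<lambda>s.
        tensor_op_sq (op_exp (s *\<^sub>R mean))
        o\<^sub>L bochner_integral M (\<lambda>\<omega>. tensor_op_sq (A 0 \<omega> - mean))
        o\<^sub>L tensor_op_sq (op_exp ((1 - s) *\<^sub>R mean))) (tensor_sq x)"
      unfolding inner_tensor_sq_covariance by (rule integral_limit_variance_nonneg)
    show "weak_conv_m (\<lambda>n. distr M borel (\<lambda>\<omega>. y \<bullet> (sqrt (real n) *\<^sub>R
        (op_prod (\<lambda>i. op_exp ((1 / real n) *\<^sub>R A i \<omega>)) n - op_exp mean)) x))
      (normal_law 0 (tensor_sq y \<bullet> bochner_integral (lebesgue_on {0..1}) (\<lambda>s.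
        tensor_op_sq (op_exp (s *\<^sub>R mean))
        o\<^sub>L bochner_integral M (\<lambda>\<omega>. tensor_op_sq (A 0 \<omega> - mean))
        o\<^sub>L tensor_op_sq (op_exp ((1 - s) *\<^sub>R mean))) (tensor_sq x)))"
      unfolding inner_tensor_sq_covariance
      using deviation_weak_conv by (simp add: deviation_def exp_prod_def)
  qed
qed

end
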